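(* Consider an $\llbracket n,k\rrbracket$ stabilizer code constructed from $m$-dimensional qudits. With respect to a partition of the qudits into $N$ disjoint non-empty subsets, let the code's min-distance, max-distance and disjointness be $d_\downarrow$, $d_\uparrow$ and $\Delta$. Now consider $r\ge1$ codeblocks of this code, and let $r'=\min(r,N!\,m^{n-k})$. If $M$ is a positive integer satisfying $$r'd_\uparrow\left(1-(1-1/\Delta)^{r'}\right)^{M-1}<d_\downarrow,$$ then all transversal logical operators on $r$ codeblocks are in the $M$-th level $\overline C_M$ of the Clifford hierarchy of the logical Pauli group of the $r$ codeblocks.
   Context: Fix a qudit dimension $m\ge2$, $\omega_m=e^{2\pi i/m}$, $X=\sum_{l}|l\oplus1\rangle\langle l|$ (addition mod $m$), $Z=\sum_l\omega_m^l|l\rangle\langle l|$. $\mathcal P_n$ is the group generated by the single-qudit $X$'s and $Z$'s on $n$ qudits (for $m=2$ one may also include $Y=iXZ$ among the generators). The group commutator is $[A,B]=ABA^\dagger B^\dagger$. Stabilizer code: an $\llbracket n,k\rrbracket$ code ($k\ge1$) is given by a group $\mathcal S=\langle s_1,\dots,s_{n-k}\rangle\subseteq\mathcal P_n$ of mutually commuting Paulis with $|\mathcal S|=m^{n-k}$; its code space $\mathcal C\subseteq(\mathbb C^m)^{\otimes n}$ is the simultaneous $+1$ eigenspace of $\mathcal S$, of dimension $m^k$. A logical operator is a unitary on the full Hilbert space mapping the code space to itself. Logical Pauli generators $\bar X_i,\bar Z_i\in\mathcal P_n$ ($1\le i\le k$) commute with $\mathcal S$ and satisfy $[\bar X_i,\bar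 Z_j]=\omega_m^{-\delta_{ij}}I$, $[\bar X_i,\bar X_j]=[\bar Z_i,\bar Z_j]=I$. The set of non-trivial logical Paulis is the set of cosets $\mathcal L=\{\mathcal S\prod_{i=1}^k\bar X_i^{a_i}\bar Z_i^{a_{i+k}}:a\in\{0,\dots,m-1\}^{2k}\setminus\{0\}\}$. Given a partition of the qudits into disjoint non-empty subsets $Q_1,\dots,Q_N$: a unitary $U$ is transversal if $U=\bigotimes_{i=1}^NU_i$ with $U_i$ acting only on the qudits of $Q_i$; $\mathrm{supp}(U)\subseteq[N]$ is the set of $i$ such that $U$ acts non-trivially (not as a scalar multiple of the identity) on $Q_i$. Distances: $d(G)=\min_{g\in G}|\mathrm{supp}(g)|$, $d_\downarrow=\min_{G\in\mathcal L}d(G)$, $d_\uparrow=\max_{G\in\mathcal L}d(G)$. Disjointness: for an integer $c\ge1$, $A\subseteq G$ is $c$-disjoint if for every $i\in[N]$ at most $c$ elements $a\in A$ have $i\in\mathrm{supp}(a)$; $\Delta_c(G)=\frac1c\max\{|A|:A\subseteq G\ c\text{-disjoint}\}$ and $\Delta=\max_{c\ge1}\min_{G\in\mathcal L}\Delta_c(G)$. Multiple codeblocks: $r$ codeblocks of the code, the $b$-th with the identical partition written $\{Q_i^{(b)}\}_{i=1}^N$, are treated as one $\llbracket rn,rk\rrbracket$ stabilizer code (the product code). Its qudits are partitioned into $Q_i=\bigcup_{b=1}^rQ^{(b)}_{\sigma_b(i)}$, $i\in[N]$, where $\sigma_b:[N]\to[N]$ are arbitrary fixed permutations. A transversal logical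 operator on $r$ codeblocks is a logical operator of this code that is transversal with respect to $\{Q_i\}$. Clifford hierarchy: for a Pauli group $\mathcal P$, $C_1(\mathcal P)=\mathcal P$ and $C_M(\mathcal P)=\{U \text{ unitary}:[U,p]\in C_{M-1}(\mathcal P)\ \forall p\in\mathcal P\}$, where unitaries are considered up to global phase. A logical operator is in $\overline C_M$ if the $rk$-qudit unitary it induces on the code space (identified with $(\mathbb C^m)^{\otimes rk}$ via the logical Paulis) lies in $C_M(\mathcal P_{rk})$ up to global phase. *)

theory Defs
  imports
    "HOL-Analysis.Analysis"
    "HOL-Algebra.Generated_Groups"
    "HOL-Library.Disjoint_Sets"
    Berlekamp_Zassenhaus.Finite_Field
begin

text \<open>
  The qudits of a register are the elements of a finite type \<open>'q\<close>, and the labels of the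
  computational basis of one qudit are the integers modulo \<open>m = CARD('d)\<close>, i.e. the type
  \<open>'d mod_ring\<close>; the class \<open>nontriv\<close> says \<open>CARD('d) > 1\<close>. A basis state of the register is a
  function \<open>'q \<Rightarrow> 'd mod_ring\<close>, and operators are matrices indexed by basis states.
\<close>

type_synonym ('q, 'd) basis = "'q \<Rightarrow> 'd mod_ring"
type_synonym ('q, 'd) state = "complex ^ ('q, 'd) basis"
type_synonym ('q, 'd) op = "complex ^ ('q, 'd) basis ^ ('q, 'd) basis"


section \<open>Unitaries\<close>

definition adj :: "complex ^ 'c ^ 'r \<Rightarrow> complex ^ 'r ^ 'c"
  where "adj A = (\<chi> i j. cnj (A $ j $ i))"

definition unitary :: "complex ^ 'x ^ 'x \<Rightarrow> bool"
  where "unitary U \<longleftrightarrow> U ** adj U = mat 1 \<and> adj U ** U = mat 1"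

definition unitary_group :: "(complex ^ 'x ^ 'x) monoid"
  where "unitary_group = \<lparr>carrier = {U. unitary U}, monoid.mult = (**), one = mat 1\<rparr>"

definition group_commutator :: "complex ^ 'x ^ 'x \<Rightarrow> complex ^ 'x ^ 'x \<Rightarrow> complex ^ 'x ^ 'x"
  where "group_commutator A B = A ** B ** adj A ** adj B"

lemma adj_adj [simp]: "adj (adj A) = A"
  by (simp add: adj_def vec_eq_iff)

lemma adj_one [simp]: "adj (mat 1) = mat 1"
  by (auto simp: adj_def vec_eq_iff mat_def)

lemma adj_mult: "adj (A ** B) = adj B ** adj A"
  by (simp add: adj_def vec_eq_iff matrix_matrix_mult_def mult.commute)

lemma unitary_mult:
  assumes "unitary A" "unitary B"
  shows "unitary (A ** B)"
proof -
  have "(A ** B) ** (adj B ** adj A) = A ** (B ** adj B) ** adj A"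
    and "(adj B ** adj A) ** (A ** B) = adj B ** (adj A ** A) ** B"
    by (simp_all only: matrix_mul_assoc)
  then show ?thesis
    using assms by (simp add: unitary_def adj_mult)
qed

lemma group_unitary_group: "group (unitary_group :: (complex ^ 'x ^ 'x) monoid)"
proof (rule groupI)
  fix A :: "complex ^ 'x ^ 'x"
  assume "A \<in> carrier unitary_group"
  then show "\<exists>B\<in>carrier unitary_group. B \<otimes>\<^bsub>unitary_group\<^esub> A = \<one>\<^bsub>unitary_group\<^esub>"
    by (intro bexI[of _ "adj A"]) (auto simp: unitary_group_def unitary_def)
qed (auto simp: unitary_group_def unitary_mult matrix_mul_assoc unitary_def[of "mat 1"])

lemma inv_unitary_group:
  assumes "unitary A"
  shows "inv\<^bsub>unitary_group\<^esub> A = adj A"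
proof -
  interpret group "unitary_group :: (complex ^ 'a ^ 'a) monoid"
    by (rule group_unitary_group)
  show ?thesis
    by (rule inv_equality) (use assms in \<open>auto simp: unitary_group_def unitary_def\<close>)
qed


section \<open>Local operators and Pauli groups\<close>

text \<open>
  The operator \<open>u \<otimes> I\<close>, where \<open>u\<close> acts on the qudits of \<open>Q\<close>. The matrix \<open>u\<close> is indexed by the
  basis states of these qudits, i.e. by restrictions of basis states to \<open>Q\<close>.
\<close>

definition local_op ::
  "'q set \<Rightarrow> (('q, 'd) basis \<Rightarrow> ('q, 'd) basis \<Rightarrow> complex) \<Rightarrow> ('q::finite, 'd::nontriv) op"
  where "local_op Q u =
    (\<chi> x y. if \<forall>q. q \<notin> Q \<longrightarrow> x q = y q then u (restrict x Q) (restrict y Q) else 0)"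

definition acts_only_on :: "('q::finite, 'd::nontriv) op \<Rightarrow> 'q set \<Rightarrow> bool"
  where "acts_only_on U Q \<longleftrightarrow> (\<exists>u. U = local_op Q u)"

definition at_qudit ::
  "'q \<Rightarrow> complex ^ 'd mod_ring ^ 'd mod_ring \<Rightarrow> ('q::finite, 'd::nontriv) op"
  where "at_qudit q A = local_op {q} (\<lambda>x y. A $ x q $ y q)"

definition root_of_unity :: "'d itself \<Rightarrow> complex"
  where "root_of_unity _ = cis (2 * pi / real CARD('d))"

definition pauli_X :: "complex ^ ('d::nontriv) mod_ring ^ 'd mod_ring"
  where "pauli_X = (\<chi> a b. if a = b + 1 then 1 else 0)"

definition pauli_Z :: "complex ^ ('d::nontriv) mod_ring ^ 'd mod_ring"
  where "pauli_Z =
    (\<chi> a b. if a = b then root_of_unity TYPE('d) ^ nat (to_int_mod_ring a) else 0)"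

definition pauli_Y :: "complex ^ ('d::nontriv) mod_ring ^ 'd mod_ring"
  where "pauli_Y = mat \<i> ** pauli_X ** pauli_Z"

text \<open>
  For qubits \<open>Y\<close> is included among the generators. This only adjoins the scalar \<open>\<i>\<close>, so every
  stabilizer code over the smaller group is also one over this group.
\<close>

definition pauli_group :: "('q::finite, 'd::nontriv) op set"
  where "pauli_group = generate unitary_group
    (range (\<lambda>q. at_qudit q pauli_X) \<union> range (\<lambda>q. at_qudit q pauli_Z) \<union>
     (if CARD('d) = 2 then range (\<lambda>q. at_qudit q pauli_Y) else {}))"


section \<open>Stabilizer codes\<close>

definition code_space :: "('q::finite, 'd::nontriv) op set \<Rightarrow> ('q, 'd) state set"
  where "code_space S = {v. \<forall>s\<in>S. s *v v = v}"

text \<open>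
  The last condition excludes groups containing a non-trivial scalar, whose code space is zero.
\<close>

definition stabilizer_code :: "nat \<Rightarrow> ('q::finite, 'd::nontriv) op set \<Rightarrow> bool"
  where "stabilizer_code k S \<longleftrightarrow>
    1 \<le> k \<and> k \<le> CARD('q) \<and>
    (\<exists>s :: nat \<Rightarrow> ('q, 'd) op.
       (\<forall>i < CARD('q) - k. s i \<in> pauli_group) \<and>
       (\<forall>i < CARD('q) - k. \<forall>j < CARD('q) - k. s i ** s j = s j ** s i) \<and>
       S = generate unitary_group (s ` {..<CARD('q) - k})) \<and>
    card S = CARD('d) ^ (CARD('q) - k) \<and>
    vec.dim (code_space S) = CARD('d) ^ k"

definition logical_operator :: "('q::finite, 'd::nontriv) op set \<Rightarrow> ('q, 'd) op \<Rightarrow> bool"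
  where "logical_operator S U \<longleftrightarrow> unitary U \<and> (\<forall>v\<in>code_space S. U *v v \<in> code_space S)"

definition logical_pauli_generators ::
  "('q::finite, 'd::nontriv) op set \<Rightarrow> ('k::finite \<Rightarrow> ('q, 'd) op) \<Rightarrow> ('k \<Rightarrow> ('q, 'd) op) \<Rightarrow> bool"
  where "logical_pauli_generators S LX LZ \<longleftrightarrow>
    (\<forall>i. LX i \<in> pauli_group \<and> LZ i \<in> pauli_group) \<and>
    (\<forall>i. \<forall>s\<in>S. LX i ** s = s ** LX i \<and> LZ i ** s = s ** LZ i) \<and>
    (\<forall>i j. group_commutator (LX i) (LZ j) =
             mat (if i = j then inverse (root_of_unity TYPE('d)) else 1) \<and>
           group_commutator (LX i) (LX j) = mat 1 \<and>
           group_commutator (LZ i) (LZ j) = mat 1)"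

text \<open>
  The exponent vector in \<open>{0,\<dots>,m-1}\<^sup>2\<^sup>k\<close> is split into its two halves \<open>a\<close> and \<open>b\<close>. The factors
  of the product commute for distinct \<open>i\<close>, so the order in which \<open>Finite_Set.fold\<close> multiplies
  them is irrelevant.
\<close>

definition logical_pauli ::
  "('k::finite \<Rightarrow> ('q::finite, 'd::nontriv) op) \<Rightarrow> ('k \<Rightarrow> ('q, 'd) op)
    \<Rightarrow> ('k \<Rightarrow> nat) \<Rightarrow> ('k \<Rightarrow> nat) \<Rightarrow> ('q, 'd) op"
  where "logical_pauli LX LZ a b = Finite_Set.fold
    (\<lambda>i P. (LX i [^]\<^bsub>unitary_group\<^esub> a i ** LZ i [^]\<^bsub>unitary_group\<^esub> b i) ** P) (mat 1) UNIV"

definition nontrivial_logical_paulis ::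
  "('q::finite, 'd::nontriv) op set \<Rightarrow> ('k::finite \<Rightarrow> ('q, 'd) op) \<Rightarrow> ('k \<Rightarrow> ('q, 'd) op)
    \<Rightarrow> ('q, 'd) op set set"
  where "nontrivial_logical_paulis S LX LZ =
    {S #>\<^bsub>unitary_group\<^esub> logical_pauli LX LZ a b | a b.
       (\<forall>i. a i < CARD('d) \<and> b i < CARD('d)) \<and> (\<exists>i. a i \<noteq> 0 \<or> b i \<noteq> 0)}"


section \<open>Transversality, distances and disjointness\<close>

definition qudit_partition :: "('p \<Rightarrow> 'q set) \<Rightarrow> bool"
  where "qudit_partition Q \<longleftrightarrow> (\<forall>i. Q i \<noteq> {}) \<and> disjoint_family Q \<and> (\<Union>i. Q i) = UNIV"

definition transversal :: "('p::finite \<Rightarrow> 'q set) \<Rightarrow> ('q::finite, 'd::nontriv) op \<Rightarrow> bool"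
  where "transversal Q U \<longleftrightarrow>
    (\<exists>u. (\<forall>i. unitary (local_op (Q i) (u i) :: ('q, 'd) op)) \<and>
         U = (\<chi> x y. \<Prod>i\<in>UNIV. u i (restrict x (Q i)) (restrict y (Q i))))"

text \<open>
  An operator acts trivially on \<open>Q i\<close> (as a scalar multiple of the identity) iff it has the form
  \<open>I \<otimes> V\<close> with \<open>V\<close> acting on the remaining qudits.
\<close>

definition supp :: "('p \<Rightarrow> 'q set) \<Rightarrow> ('q::finite, 'd::nontriv) op \<Rightarrow> 'p set"
  where "supp Q U = {i. \<not> acts_only_on U (- Q i)}"

definition coset_distance ::
  "('p::finite \<Rightarrow> 'q set) \<Rightarrow> ('q::finite, 'd::nontriv) op set \<Rightarrow> nat"
  where "coset_distance Q G = Min ((\<lambda>g. card (supp Q g)) ` G)"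

definition min_distance ::
  "('p::finite \<Rightarrow> 'q set) \<Rightarrow> ('q::finite, 'd::nontriv) op set
    \<Rightarrow> ('k::finite \<Rightarrow> ('q, 'd) op) \<Rightarrow> ('k \<Rightarrow> ('q, 'd) op) \<Rightarrow> nat"
  where "min_distance Q S LX LZ = Min (coset_distance Q ` nontrivial_logical_paulis S LX LZ)"

definition max_distance ::
  "('p::finite \<Rightarrow> 'q set) \<Rightarrow> ('q::finite, 'd::nontriv) op set
    \<Rightarrow> ('k::finite \<Rightarrow> ('q, 'd) op) \<Rightarrow> ('k \<Rightarrow> ('q, 'd) op) \<Rightarrow> nat"
  where "max_distance Q S LX LZ = Max (coset_distance Q ` nontrivial_logical_paulis S LX LZ)"

definition c_disjoint ::
  "('p::finite \<Rightarrow> 'q set) \<Rightarrow> nat \<Rightarrow> ('q::finite, 'd::nontriv) op set \<Rightarrow> bool"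
  where "c_disjoint Q c A \<longleftrightarrow> (\<forall>i. card {a \<in> A. i \<in> supp Q a} \<le> c)"

definition coset_disjointness ::
  "('p::finite \<Rightarrow> 'q set) \<Rightarrow> nat \<Rightarrow> ('q::finite, 'd::nontriv) op set \<Rightarrow> real"
  where "coset_disjointness Q c G = real (Max (card ` {A. A \<subseteq> G \<and> c_disjoint Q c A})) / real c"

text \<open>
  The supremum over \<open>c\<close> is a maximum: it is at least \<open>1\<close> (take \<open>c = 1\<close> and singletons), while
  the values are at most \<open>1\<close> once \<open>c\<close> exceeds the common size of the cosets.
\<close>

definition disjointness ::
  "('p::finite \<Rightarrow> 'q set) \<Rightarrow> ('q::finite, 'd::nontriv) op set
    \<Rightarrow> ('k::finite \<Rightarrow> ('q, 'd) op) \<Rightarrow> ('k \<Rightarrow> ('q, 'd) op) \<Rightarrow> real"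
  where "disjointness Q S LX LZ =
    (SUP c\<in>{1..}. Min (coset_disjointness Q c ` nontrivial_logical_paulis S LX LZ))"


section \<open>Several codeblocks\<close>

text \<open>
  The qudit \<open>(b, q)\<close> is the qudit \<open>q\<close> of codeblock \<open>b\<close>; likewise \<open>(b, i)\<close> is the logical qudit
  \<open>i\<close> of codeblock \<open>b\<close>.
\<close>

definition on_block :: "'b \<Rightarrow> ('q, 'd) op \<Rightarrow> ('b::finite \<times> 'q::finite, 'd::nontriv) op"
  where "on_block b A =
    local_op ({b} \<times> UNIV) (\<lambda>x y. A $ (\<lambda>q. x (b, q)) $ (\<lambda>q. y (b, q)))"

definition blocks_stabilizer ::
  "('q::finite, 'd::nontriv) op set \<Rightarrow> ('b::finite \<times> 'q, 'd) op set"
  where "blocks_stabilizer S = generate unitary_group (\<Union>b. on_block b ` S)"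

definition blocks_logical ::
  "('k \<Rightarrow> ('q, 'd) op) \<Rightarrow> 'b \<times> 'k \<Rightarrow> ('b::finite \<times> 'q::finite, 'd::nontriv) op"
  where "blocks_logical L = (\<lambda>(b, i). on_block b (L i))"

definition blocks_partition :: "('b \<Rightarrow> 'p \<Rightarrow> 'p) \<Rightarrow> ('p \<Rightarrow> 'q set) \<Rightarrow> 'p \<Rightarrow> ('b \<times> 'q) set"
  where "blocks_partition \<sigma> Q i = (\<Union>b. {b} \<times> Q (\<sigma> b i))"


section \<open>The Clifford hierarchy\<close>

text \<open>Levels are counted from \<open>1\<close>; level \<open>0\<close> is a dummy value.\<close>

fun clifford_level :: "nat \<Rightarrow> ('q::finite, 'd::nontriv) op set"
  where
    "clifford_level 0 = {}"
  | "clifford_level (Suc 0) = {mat c ** p | c p. cmod c = 1 \<and> p \<in> pauli_group}"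
  | "clifford_level (Suc (Suc M)) =
       {U. unitary U \<and> (\<forall>p\<in>pauli_group. group_commutator U p \<in> clifford_level (Suc M))}"

text \<open>
  An identification of the space of \<open>k\<close> qudits with the code space via the logical Paulis. Phases
  are allowed because logical Pauli generators need not have the same order as \<open>X\<close> and \<open>Z\<close>: for
  qubits, \<open>XZ\<close> is a legitimate choice of a generator, but it squares to \<open>-I\<close>.
\<close>

definition logical_encoding ::
  "('q::finite, 'd::nontriv) op set \<Rightarrow> ('k::finite \<Rightarrow> ('q, 'd) op) \<Rightarrow> ('k \<Rightarrow> ('q, 'd) op)
    \<Rightarrow> complex ^ ('k, 'd) basis ^ ('q, 'd) basis \<Rightarrow> bool"
  where "logical_encoding S LX LZ V \<longleftrightarrow>
    adj V ** V = mat 1 \<and> range ((*v) V) = code_space S \<and>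
    (\<forall>i. \<exists>c. cmod c = 1 \<and> V ** at_qudit i pauli_X = mat c ** LX i ** V) \<and>
    (\<forall>i. \<exists>c. cmod c = 1 \<and> V ** at_qudit i pauli_Z = mat c ** LZ i ** V)"

text \<open>
  Encodings are unique up to a phase and a Pauli operator on the logical qudits, neither of which
  affects membership in the hierarchy. Quantifying over all of them, and demanding that there is
  one, makes the definition visibly independent of the choice.
\<close>

definition logical_clifford_level ::
  "nat \<Rightarrow> ('q::finite, 'd::nontriv) op set \<Rightarrow> ('k::finite \<Rightarrow> ('q, 'd) op)
    \<Rightarrow> ('k \<Rightarrow> ('q, 'd) op) \<Rightarrow> ('q, 'd) op set"
  where "logical_clifford_level M S LX LZ =
    {U. logical_operator S U \<and> (\<exists>V. logical_encoding S LX LZ V) \<and>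
        (\<forall>V. logical_encoding S LX LZ V \<longrightarrow> adj V ** U ** V \<in> clifford_level M)}"

end

theory Submission
  imports Defs "HOL-Library.Function_Algebras"
begin

text \<open>
  Conjugating by a transversal operator preserves locality, so the group commutator of a
  transversal logical operator \<open>K\<close> with a Pauli \<open>P\<close> acts trivially on a part as soon as one of
  \<open>K\<close> and \<open>P\<close> does. In each block, a representative of a logical Pauli is drawn from a
  \<open>c\<close>-disjoint set; by averaging, all representatives together can be made to avoid a fraction
  \<open>(1 - 1/\<Delta>)^r\<close> of the support of \<open>K\<close>. Hence every commutator shrinks the support by the factor
  \<open>1 - (1 - 1/\<Delta>)^r\<close>. An operator with support smaller than the minimal distance is a combination of
  Paulis each of which compresses to a scalar on the code space, so it acts as a scalar; this is
  where the iterated commutators end. When \<open>r\<close> exceeds \<open>N! m^(n-k)\<close>, it suffices that \<open>\<Delta> > 1\<close>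
  allows every block to avoid any given part, as losing one part per step is enough.
\<close>

section \<open>Matrices up to scalars\<close>

text \<open>Locality is not handled through tensor factors. The Weyl operators X^a Z^c form a basis
  and commute with each other up to a phase, so acting only on T means commuting with all Weyl
  operators living off T; locality of products, adjoints and Pauli conjugates is then algebra.
  Phases cannot be controlled (the scalars in the Pauli group depend on m, logical generators may
  have the wrong order), hence most relations are stated up to a unit scalar. Group commutators do
  not see the phases of their arguments.

  The first commutator differs from the later ones: U may act on all parts. There the logical Pauli
  is represented with weight at most d_up in each block, which bounds the support by r' d_up; the
  factor 1 - (1 - 1/\<Delta>)^r' comes from each of the other M - 1 commutators. After M commutators
  a scalar must remain, so a level 0 of scalars is placed below the Paulis. The strict inequality
  forces \<Delta> > 1: at \<Delta> = 1 it would read r' d_up < d_down, although d_down <= d_up. The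
  cut-off N! m^(n-k) is large enough because \<Delta> <= |S| = m^(n-k) and N <= N!.\<close>

definition scal :: "complex \<Rightarrow> complex ^ 'c ^ 'r \<Rightarrow> complex ^ 'c ^ 'r" (infixr "\<cdot>" 75)
  where "c \<cdot> A = (\<chi> i j. c * A $ i $ j)"

lemma scal_nth [simp]: "(c \<cdot> A) $ i $ j = c * A $ i $ j"
  by (simp add: scal_def)

lemma mat_mult_eq_scal: "mat c ** A = c \<cdot> A"
  by (simp add: vec_eq_iff matrix_matrix_mult_def mat_def if_distrib[of "\<lambda>z. z * _"] cong: if_cong)

lemma scal_simps [simp]:
  "(c \<cdot> A) ** B = c \<cdot> (A ** B)" "A ** (c \<cdot> B) = c \<cdot> (A ** B)"
  "c \<cdot> d \<cdot> A = (c * d) \<cdot> A" "1 \<cdot> A = A" "0 \<cdot> A = 0"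
  "adj (c \<cdot> A) = cnj c \<cdot> adj A"
  by (simp_all add: vec_eq_iff matrix_matrix_mult_def adj_def sum_distrib_left mult_ac)

lemma trace_scal [simp]: "trace (c \<cdot> A) = c * trace A"
  by (simp add: trace_def sum_distrib_left)

lemma cnj_mult_self: "cmod c = 1 \<Longrightarrow> cnj c * c = 1" "cmod c = 1 \<Longrightarrow> c * cnj c = 1"
  using complex_norm_square[of c] by (simp_all add: mult.commute)

lemma unitary_scal: "cmod c = 1 \<Longrightarrow> unitary A \<Longrightarrow> unitary (c \<cdot> A)"
  by (simp add: unitary_def cnj_mult_self)

lemma unitary_adj: "unitary A \<Longrightarrow> unitary (adj A)"
  by (simp add: unitary_def)

lemma unitary_one: "unitary (mat 1)"
  by (simp add: unitary_def)

lemma unitary_cancel: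
  assumes "unitary A"
  shows "A ** adj A = mat 1" "adj A ** A = mat 1"
    "A ** (adj A ** B) = B" "adj A ** (A ** B) = B"
  using assms by (simp_all add: unitary_def matrix_mul_assoc)

definition phase_eq :: "complex ^ 'c ^ 'r \<Rightarrow> complex ^ 'c ^ 'r \<Rightarrow> bool" (infix "\<simeq>" 50)
  where "A \<simeq> B \<longleftrightarrow> (\<exists>c. cmod c = 1 \<and> A = c \<cdot> B)"

lemma phase_eqI: "cmod c = 1 \<Longrightarrow> c \<cdot> A \<simeq> A"
  by (auto simp: phase_eq_def)

lemma phase_eq_refl [simp]: "A \<simeq> A"
  unfolding phase_eq_def by (rule exI[of _ 1]) simp

lemma phase_eq_sym: "A \<simeq> B \<Longrightarrow> B \<simeq> A"
  unfolding phase_eq_def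
proof (elim exE conjE)
  fix c assume "cmod c = 1" "A = c \<cdot> B"
  then show "\<exists>c. cmod c = 1 \<and> B = c \<cdot> A"
    by (intro exI[of _ "cnj c"]) (simp add: cnj_mult_self)
qed

lemma phase_eq_trans [trans]: "A \<simeq> B \<Longrightarrow> B \<simeq> C \<Longrightarrow> A \<simeq> C"
  unfolding phase_eq_def
proof (elim exE conjE)
  fix c d assume "cmod c = 1" "A = c \<cdot> B" "cmod d = 1" "B = d \<cdot> C"
  then show "\<exists>c. cmod c = 1 \<and> A = c \<cdot> C"
    by (intro exI[of _ "c * d"]) (simp add: norm_mult)
qed

lemma phase_eq_mult:
  assumes "A \<simeq> B" "C \<simeq> D"
  shows "A ** C \<simeq> B ** D"
proof -
  obtain c d where *: "cmod c = 1" "A = c \<cdot> B" "cmod d = 1" "C = d \<cdot> D"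
    using assms unfolding phase_eq_def by blast
  have "A ** C = (c * d) \<cdot> (B ** D)"
    by (simp add: * mult.commute)
  then show ?thesis
    unfolding phase_eq_def using *(1,3) by (intro exI[of _ "c * d"]) (simp add: norm_mult)
qed

lemma phase_eq_adj: "A \<simeq> B \<Longrightarrow> adj A \<simeq> adj B"
  unfolding phase_eq_def
proof (elim exE conjE)
  fix c assume "cmod c = 1" "A = c \<cdot> B"
  then show "\<exists>c. cmod c = 1 \<and> adj A = c \<cdot> adj B"
    by (intro exI[of _ "cnj c"]) simp
qed

lemma unitary_phase_eq: "A \<simeq> B \<Longrightarrow> unitary B \<Longrightarrow> unitary A"
  by (auto simp: phase_eq_def intro: unitary_scal)

section \<open>Characters of the integers modulo m\<close>

text \<open>The standard additive character of the integers modulo m: \<open>pauli_Z\<close> is its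
  diagonal matrix, and the commutation phases of Weyl operators are its values.\<close>

definition chi :: "'d::nontriv mod_ring \<Rightarrow> complex"
  where "chi a = root_of_unity TYPE('d) ^ nat (to_int_mod_ring a)"

lemma root_of_unity_power: "root_of_unity TYPE('d::nontriv) ^ CARD('d) = 1"
proof -
  have "real CARD('d) * (2 * pi / real CARD('d)) = 2 * pi"
    using nontriv[where 'a='d] by simp
  then show ?thesis by (simp only: root_of_unity_def Complex.DeMoivre) simp
qed

lemma root_of_unity_power_mod:
  "root_of_unity TYPE('d::nontriv) ^ (j mod CARD('d)) = root_of_unity TYPE('d) ^ j"
proof -
  let ?m = "CARD('d)"
  have "root_of_unity TYPE('d) ^ j = root_of_unity TYPE('d) ^ (?m * (j div ?m) + j mod ?m)"
    by simp
  then show ?thesis by (simp only: power_add power_mult root_of_unity_power) simp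
qed

lemma to_int_mod_ring_nonneg: "0 \<le> to_int_mod_ring a" "to_int_mod_ring (a :: 'd::finite mod_ring) < int CARD('d)"
  using range_to_int_mod_ring[where 'a='d] by (metis atLeastLessThan_iff rangeI)+

lemma chi_0 [simp]: "chi 0 = 1"
  by (simp add: chi_def zero_mod_ring.rep_eq to_int_mod_ring.rep_eq)

lemma chi_1: "chi (1 :: 'd::nontriv mod_ring) = root_of_unity TYPE('d)"
  by (simp add: chi_def one_mod_ring.rep_eq to_int_mod_ring.rep_eq)

lemma chi_add: "chi (a + b) = chi a * chi (b :: 'd::nontriv mod_ring)"
proof -
  have "to_int_mod_ring (a + b) = (to_int_mod_ring a + to_int_mod_ring b) mod int CARD('d)"
    by transfer simp
  then have "nat (to_int_mod_ring (a + b))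
      = (nat (to_int_mod_ring a) + nat (to_int_mod_ring b)) mod CARD('d)"
    using to_int_mod_ring_nonneg[of a] to_int_mod_ring_nonneg[of b]
    by (simp add: nat_mod_distrib nat_add_distrib)
  then show ?thesis
    by (simp add: chi_def root_of_unity_power_mod power_add)
qed

lemma cmod_chi [simp]: "cmod (chi a) = 1"
  by (simp add: chi_def root_of_unity_def norm_power)

lemma chi_nonzero [simp]: "chi a \<noteq> 0"
  by (metis cmod_chi norm_zero zero_neq_one)

lemma chi_minus: "chi (- a) = cnj (chi a)"
proof -
  have "chi (- a) * chi a = 1" by (simp flip: chi_add)
  moreover have "cnj (chi a) * chi a = 1"
    by (metis cmod_chi complex_norm_square mult.commute of_real_1 power_one)
  ultimately show ?thesis by (metis chi_nonzero mult_right_cancel)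
qed

text \<open>The powers of a primitive m-th root of unity with exponents below m are distinct. This
  faithfulness turns equalities of commutation phases into equalities of exponents.\<close>

lemma chi_inj: "chi a = chi b \<longleftrightarrow> a = (b :: 'd::nontriv mod_ring)"
proof
  assume eq: "chi a = chi b"
  have m: "0 < CARD('d)" using nontriv[where 'a='d] by linarith
  have *: "chi c = cis (2 * pi * real (nat (to_int_mod_ring c)) / real CARD('d))"
    for c :: "'d mod_ring"
    by (simp only: chi_def root_of_unity_def Complex.DeMoivre) (simp add: mult_ac)
  have "inj_on (\<lambda>k. cis (2 * pi * real k / real CARD('d))) {..<CARD('d)}"
    using Complex.bij_betw_roots_unity[OF m] by (simp add: bij_betw_def)
  then have "nat (to_int_mod_ring a) = nat (to_int_mod_ring b)"
    by (rule inj_onD) (use eq to_int_mod_ring_nonneg[of a] to_int_mod_ring_nonneg[of b] in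
      \<open>auto simp: * nat_less_iff\<close>)
  then have "to_int_mod_ring a = to_int_mod_ring b"
    by (metis nat_0_le to_int_mod_ring_nonneg(1))
  then show "a = b" by (metis of_int_mod_ring_to_int_mod_ring)
qed simp

lemma chi_eq_1_iff: "chi a = 1 \<longleftrightarrow> a = 0"
  using chi_inj[of a 0] by simp

definition dot :: "('q::finite, 'd::nontriv) basis \<Rightarrow> ('q, 'd) basis \<Rightarrow> 'd mod_ring"
  where "dot c y = (\<Sum>q\<in>UNIV. c q * y q)"

lemma dot_simps [simp]:
  "dot (c + c') y = dot c y + dot c' y" "dot c (y + y') = dot c y + dot c y'"
  "dot (- c) y = - dot c y" "dot c (- y) = - dot c y" "dot 0 y = 0" "dot c 0 = 0"
  by (simp_all add: dot_def algebra_simps sum.distrib sum_negf)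

lemma dot_single [simp]: "dot c (0(q := t)) = c q * t" "dot (0(q := t)) c = t * c q"
  by (simp_all add: dot_def fun_upd_def if_distrib[of "\<lambda>z. _ * z"] if_distrib[of "\<lambda>z. z * _"]
      cong: if_cong)

lemma dot_commute: "dot c y = dot y c"
  by (simp add: dot_def mult.commute)

lemma sum_shift: "(\<Sum>y\<in>UNIV. f (y + e)) = (\<Sum>y\<in>UNIV. f (y :: 'a::{finite,ab_group_add}))"
  by (rule sum.reindex_bij_witness[of _ "\<lambda>y. y - e" "\<lambda>y. y + e"]) auto

text \<open>If c q is non-zero, translating y by one unit in coordinate q reproduces the sum
  multiplied by \<open>chi (c q)\<close>, which differs from 1, so the sum vanishes.\<close>

lemma sum_chi_dot:
  fixes c :: "('q::finite, 'd::nontriv) basis"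
  shows "(\<Sum>y\<in>UNIV. chi (dot c y)) = (if c = 0 then of_nat CARD(('q, 'd) basis) else 0)"
proof (cases "c = 0")
  case False
  then obtain q where q: "c q \<noteq> 0" by (auto simp: fun_eq_iff)
  have "(\<Sum>y\<in>UNIV. chi (dot c y)) = (\<Sum>y\<in>UNIV. chi (dot c (y + 0(q := 1))))"
    by (rule sum_shift[symmetric])
  also have "\<dots> = chi (c q) * (\<Sum>y\<in>UNIV. chi (dot c y))"
    by (simp add: chi_add sum_distrib_left mult.commute)
  finally show ?thesis using q False by (auto simp: chi_eq_1_iff)
qed simp

section \<open>Weyl operators\<close>

text \<open>The operator X^a Z^c, which sends the basis state y to y + a with phase
  \<open>chi (dot c y)\<close>. Fixing this order selects one representative in each phase class of
  Paulis.\<close>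

definition weyl :: "('q::finite, 'd::nontriv) basis \<Rightarrow> ('q, 'd) basis \<Rightarrow> ('q, 'd) op"
  where "weyl a c = (\<chi> x y. if x = y + a then chi (dot c y) else 0)"

lemma weyl_nth: "weyl a c $ x $ y = (if x = y + a then chi (dot c y) else 0)"
  by (simp add: weyl_def)

lemma weyl_mult_nth: "(weyl a c ** A) $ x $ y = chi (dot c (x - a)) * A $ (x - a) $ y"
proof -
  have "(weyl a c ** A) $ x $ y
      = (\<Sum>z\<in>UNIV. if z = x - a then chi (dot c z) * A $ z $ y else 0)"
    by (auto simp: matrix_matrix_mult_def weyl_def algebra_simps intro!: sum.cong)
  then show ?thesis by simp
qed

lemma mult_weyl_nth: "(A ** weyl a c) $ x $ y = A $ x $ (y + a) * chi (dot c y)"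
  by (simp add: matrix_matrix_mult_def weyl_def if_distrib[of "\<lambda>z. _ * z"] cong: if_cong)

lemma weyl_mult: "weyl a c ** weyl a' c' = chi (dot c a') \<cdot> weyl (a + a') (c + c')"
  by (auto simp: vec_eq_iff weyl_mult_nth weyl_nth algebra_simps simp flip: chi_add)

lemma weyl_0 [simp]: "weyl 0 0 = mat 1"
  by (simp add: vec_eq_iff weyl_nth mat_def)

lemma adj_weyl: "adj (weyl a c) = chi (dot c a) \<cdot> weyl (- a) (- c)"
  by (auto simp: vec_eq_iff adj_def weyl_nth algebra_simps simp flip: chi_add chi_minus)

lemma unitary_weyl: "unitary (weyl a c)"
  by (simp add: unitary_def adj_weyl weyl_mult flip: chi_add)

lemma weyl_commute:
  "weyl a c ** weyl a' c' = chi (dot c a' - dot c' a) \<cdot> (weyl a' c' ** weyl a c)"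
  by (simp add: weyl_mult add.commute flip: chi_add)

lemma trace_weyl:
  "trace (weyl a c :: ('q::finite, 'd::nontriv) op)
    = (if a = 0 \<and> c = 0 then of_nat CARD(('q, 'd) basis) else 0)"
proof -
  have "trace (weyl a c) = (if a = 0 then \<Sum>y\<in>UNIV. chi (dot c y) else 0)"
    by (simp add: trace_def weyl_nth)
  then show ?thesis by (simp add: sum_chi_dot)
qed

lemma phase_eq_weyl_mult: "weyl a c ** weyl a' c' \<simeq> weyl (a + a') (c + c')"
  by (simp add: weyl_mult phase_eqI)

lemma phase_eq_adj_weyl: "adj (weyl a c) \<simeq> weyl (- a) (- c)"
  by (simp add: adj_weyl phase_eqI)

text \<open>The Hilbert-Schmidt inner product with a Weyl operator, normalised by the dimension of
  the register.\<close>

definition weyl_coeff :: "('q::finite, 'd::nontriv) op \<Rightarrow> ('q, 'd) basis \<Rightarrow> ('q, 'd) basis \<Rightarrow> complex"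
  where "weyl_coeff K a c = trace (adj (weyl a c) ** K) / of_nat CARD(('q, 'd) basis)"

lemma weyl_coeff_alt:
  "weyl_coeff K a c = (\<Sum>y\<in>UNIV. chi (dot (- c) y) * K $ (y + a) $ y)
     / of_nat CARD(('q, 'd) basis)"
  for K :: "('q::finite, 'd::nontriv) op"
proof -
  have "(adj (weyl a c) ** K) $ y $ y = chi (dot (- c) y) * K $ (y + a) $ y" for y
    by (simp add: adj_weyl weyl_mult_nth mult.assoc[symmetric] flip: matrix_mul_assoc chi_add)
  then show ?thesis
    by (simp add: weyl_coeff_def trace_def del: dot_simps)
qed

text \<open>For fixed a, the coefficients are the Fourier transform of the entries K(y + a, y) along
  one shifted diagonal, and Fourier inversion recovers each diagonal separately.\<close>

lemma weyl_expansion: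
  fixes K :: "('q::finite, 'd::nontriv) op"
  shows "K = (\<Sum>a\<in>UNIV. \<Sum>c\<in>UNIV. weyl_coeff K a c \<cdot> weyl a c)"
proof -
  let ?N = "of_nat CARD(('q, 'd) basis) :: complex"
  have inner: "(\<Sum>c\<in>UNIV. weyl_coeff K a c * chi (dot c y)) = K $ (y + a) $ y" for a y
  proof -
    have "(\<Sum>c\<in>UNIV. weyl_coeff K a c * chi (dot c y))
        = (\<Sum>c\<in>UNIV. \<Sum>z\<in>UNIV. chi (dot c (y - z)) * K $ (z + a) $ z / ?N)"
      by (simp add: weyl_coeff_alt sum_distrib_left sum_divide_distrib mult_ac chi_add
          diff_conv_add_uminus del: add_uminus_conv_diff)
    also have "\<dots> = (\<Sum>z\<in>UNIV. (\<Sum>c\<in>UNIV. chi (dot (y - z) c)) * K $ (z + a) $ z / ?N)"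
      by (subst sum.swap) (simp add: sum_distrib_right sum_divide_distrib dot_commute)
    also have "\<dots> = (\<Sum>z\<in>UNIV. if z = y then K $ (z + a) $ z else 0)"
      by (rule sum.cong) (auto simp: sum_chi_dot)
    finally show ?thesis by simp
  qed
  have "(\<Sum>a\<in>UNIV. \<Sum>c\<in>UNIV. weyl_coeff K a c \<cdot> weyl a c) $ x $ y = K $ x $ y" for x y
  proof -
    have "(\<Sum>a\<in>UNIV. \<Sum>c\<in>UNIV. weyl_coeff K a c \<cdot> weyl a c) $ x $ y
        = (\<Sum>a\<in>UNIV. if a = x - y then \<Sum>c\<in>UNIV. weyl_coeff K a c * chi (dot c y) else 0)"
      by (auto simp: weyl_nth algebra_simps intro!: sum.cong)
    then show ?thesis by (simp add: inner)
  qed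
  then show ?thesis by (simp add: vec_eq_iff)
qed

text \<open>The coefficient is a trace, so conjugating both factors of the trace by \<open>p\<close> changes nothing.\<close>

lemma weyl_coeff_eq_0:
  assumes K: "K ** p = \<alpha> \<cdot> (p ** K)" and W: "weyl a c ** p = \<beta> \<cdot> (p ** weyl a c)"
    and p: "unitary p" and \<beta>: "cmod \<beta> = 1" and ne: "\<alpha> \<noteq> \<beta>"
  shows "weyl_coeff K a c = 0"
proof -
  let ?A = "adj (weyl a c)"
  have W': "?A ** p = cnj \<beta> \<cdot> (p ** ?A)"
  proof -
    have "p ** weyl a c = cnj \<beta> \<cdot> (weyl a c ** p)"
      using \<beta> by (simp add: W cnj_mult_self)
    have "?A ** p = ?A ** (p ** weyl a c) ** ?A"
      using unitary_weyl[of a c] by (simp add: unitary_cancel flip: matrix_mul_assoc)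
    also have "\<dots> = cnj \<beta> \<cdot> (?A ** (weyl a c ** p) ** ?A)"
      by (simp only: \<open>p ** weyl a c = _\<close> scal_simps)
    also have "\<dots> = cnj \<beta> \<cdot> (p ** ?A)"
      using unitary_weyl[of a c] by (simp only: unitary_cancel flip: matrix_mul_assoc)
    finally show ?thesis .
  qed
  have "?A ** K ** p = \<alpha> \<cdot> ((?A ** p) ** K)"
    by (simp add: K flip: matrix_mul_assoc)
  also have "\<dots> = (\<alpha> * cnj \<beta>) \<cdot> (p ** (?A ** K))"
    by (simp add: W' flip: matrix_mul_assoc)
  finally have "trace (adj p ** (?A ** K ** p)) = trace ((\<alpha> * cnj \<beta>) \<cdot> (?A ** K))"
    using p by (simp add: unitary_cancel)
  also have "\<dots> = (\<alpha> * cnj \<beta>) * trace (?A ** K)" by simp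
  also have "trace (adj p ** (?A ** K ** p)) = trace (?A ** K)"
    using p by (subst trace_mul_sym) (simp add: unitary_cancel flip: matrix_mul_assoc)
  finally have "trace (?A ** K) = (\<alpha> * cnj \<beta>) * trace (?A ** K)" .
  moreover have "\<alpha> * cnj \<beta> \<noteq> 1"
  proof
    assume "\<alpha> * cnj \<beta> = 1"
    then have "\<alpha> * (cnj \<beta> * \<beta>) = \<beta>" by (simp add: mult.assoc[symmetric])
    then show False using ne \<beta> by (simp add: cnj_mult_self)
  qed
  ultimately show ?thesis by (simp add: weyl_coeff_def)
qed

section \<open>Operators acting on a part of the register\<close>

lemma matrix_mult_sum_right: "A ** (\<Sum>i\<in>I. B i) = (\<Sum>i\<in>I. A ** B i)"
  for A :: "complex ^ 'b ^ 'a"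
  by (induction I rule: infinite_finite_induct) (simp_all add: matrix_add_ldistrib)

lemma matrix_mult_sum_left: "(\<Sum>i\<in>I. B i) ** A = (\<Sum>i\<in>I. B i ** A)"
  for A :: "complex ^ 'b ^ 'a"
  by (induction I rule: infinite_finite_induct) (simp_all add: matrix_matrix_mult_def vec_eq_iff sum.distrib algebra_simps)

text \<open>For the converse, U itself serves as the local matrix: \<open>restrict\<close> puts the
  same default value off T into rows and columns, so by the second condition U may be evaluated at
  restricted states.\<close>

lemma acts_only_on_iff_nth:
  "acts_only_on U T \<longleftrightarrow>
    (\<forall>x y q. U $ x $ y \<noteq> 0 \<longrightarrow> q \<notin> T \<longrightarrow> x q = y q) \<and>
    (\<forall>x y x' y'. (\<forall>q\<in>T. x q = x' q \<and> y q = y' q) \<longrightarrow>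
      (\<forall>q. q \<notin> T \<longrightarrow> x q = y q \<and> x' q = y' q) \<longrightarrow> U $ x $ y = U $ x' $ y')"
  (is "_ \<longleftrightarrow> ?A \<and> ?B")
proof
  assume "acts_only_on U T"
  then obtain u where u: "U = local_op T u" by (auto simp: acts_only_on_def)
  have ?B
  proof (intro allI impI)
    fix x y x' y' :: "('a, 'b) basis"
    assume 1: "\<forall>q\<in>T. x q = x' q \<and> y q = y' q" and 2: "\<forall>q. q \<notin> T \<longrightarrow> x q = y q \<and> x' q = y' q"
    then have "restrict x T = restrict x' T" "restrict y T = restrict y' T"
      by (auto simp: restrict_def fun_eq_iff)
    then show "U $ x $ y = U $ x' $ y'"
      using 2 by (simp add: u local_op_def)
  qed
  moreover have ?A by (auto simp: u local_op_def split: if_splits)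
  ultimately show "?A \<and> ?B" by blast
next
  assume *: "?A \<and> ?B"
  then have A: ?A by (rule conjunct1)
  have "U $ x $ y = local_op T (\<lambda>x y. U $ x $ y) $ x $ y" for x y :: "('a, 'b) basis"
  proof (cases "\<forall>q. q \<notin> T \<longrightarrow> x q = y q")
    case True
    have "U $ x $ y = U $ restrict x T $ restrict y T"
      by (rule conjunct2[OF *, THEN spec, THEN spec, THEN spec, THEN spec, THEN mp, THEN mp])
        (use True in auto)
    then show ?thesis using True by (simp add: local_op_def)
  next
    case False
    then show ?thesis using A by (auto simp: local_op_def)
  qed
  then have "U = local_op T (\<lambda>x y. U $ x $ y)" unfolding vec_eq_iff by blast
  then show "acts_only_on U T" unfolding acts_only_on_def by blast
qed

lemma dot_cong: "(\<And>q. c q * y q = c' q * y' q) \<Longrightarrow> dot c y = dot c' y'"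
  by (simp add: dot_def)

text \<open>The commutant description, which serves as the working definition of locality. In the
  converse, the diagonal Weyl operators off T force rows and columns to agree there, and the shifts
  off T make the entries independent of the common values.\<close>

lemma acts_only_on_iff_commute:
  fixes U :: "('q::finite, 'd::nontriv) op"
  shows "acts_only_on U T \<longleftrightarrow>
    (\<forall>a c. (\<forall>q\<in>T. a q = 0 \<and> c q = 0) \<longrightarrow> U ** weyl a c = weyl a c ** U)"
proof
  assume "acts_only_on U T"
  then have 1: "U $ x $ y = 0" if "x q \<noteq> y q" "q \<notin> T" for x y q
    using that unfolding acts_only_on_iff_nth by blast
  from \<open>acts_only_on U T\<close> have 2: "U $ x $ y = U $ x' $ y'"
      if "\<forall>q\<in>T. x q = x' q \<and> y q = y' q" "\<forall>q. q \<notin> T \<longrightarrow> x q = y q \<and> x' q = y' q" for x y x' y'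
    using that unfolding acts_only_on_iff_nth by blast
  show "\<forall>a c. (\<forall>q\<in>T. a q = 0 \<and> c q = 0) \<longrightarrow> U ** weyl a c = weyl a c ** U"
  proof (intro allI impI)
    fix a c :: "('q, 'd) basis" assume ac: "\<forall>q\<in>T. a q = 0 \<and> c q = 0"
    have "U $ x $ (y + a) * chi (dot c y) = chi (dot c (x - a)) * U $ (x - a) $ y" for x y
    proof (cases "\<forall>q. q \<notin> T \<longrightarrow> x q = y q + a q")
      case True
      have "U $ x $ (y + a) = U $ (x - a) $ y"
        by (rule 2) (use True ac in auto)
      moreover have "dot c y = dot c (x - a)"
        by (rule dot_cong) (use True ac in \<open>auto simp: fun_diff_def\<close>, metis add_diff_cancel_right' mult_zero_left)
      ultimately show ?thesis by simp
    next
      case False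
      then obtain q where q: "q \<notin> T" "x q \<noteq> y q + a q" by blast
      then have "U $ x $ (y + a) = 0" "U $ (x - a) $ y = 0"
        by (auto intro!: 1[of _ q] simp: fun_diff_def diff_eq_eq)
      then show ?thesis by simp
    qed
    then show "U ** weyl a c = weyl a c ** U"
      by (simp add: vec_eq_iff weyl_mult_nth mult_weyl_nth)
  qed
next
  assume comm: "\<forall>a c. (\<forall>q\<in>T. a q = 0 \<and> c q = 0) \<longrightarrow> U ** weyl a c = weyl a c ** U"
  have C: "U $ x $ (y + a) * chi (dot c y) = chi (dot c (x - a)) * U $ (x - a) $ y"
    if "\<forall>q\<in>T. a q = 0 \<and> c q = 0" for x y a c
  proof -
    have "(U ** weyl a c) $ x $ y = (weyl a c ** U) $ x $ y" using comm that by simp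
    then show ?thesis by (simp only: weyl_mult_nth mult_weyl_nth)
  qed
  show "acts_only_on U T"
    unfolding acts_only_on_iff_nth
  proof (intro conjI allI impI)
    fix x y q assume nz: "U $ x $ y \<noteq> 0" and q: "q \<notin> T"
    have "\<forall>r\<in>T. (0 :: ('q, 'd) basis) r = 0 \<and> ((0 :: ('q, 'd) basis)(q := 1)) r = 0" using q by auto
    from C[of 0 "0(q := 1)" x y, OF this] show "x q = y q" using nz by (simp add: chi_inj)
  next
    fix x y x' y' :: "('q, 'd) basis"
    assume 1: "\<forall>q\<in>T. x q = x' q \<and> y q = y' q" and 2: "\<forall>q. q \<notin> T \<longrightarrow> x q = y q \<and> x' q = y' q"
    have "x' - x = y' - y" using 1 2 by (auto simp: fun_eq_iff fun_diff_def) (metis diff_self)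
    then have "y + (x' - x) = y'" by simp
    then show "U $ x $ y = U $ x' $ y'"
      using C[of "x' - x" 0 x' y] 1 by (simp add: fun_diff_def)
  qed
qed

lemma acts_only_onI:
  assumes "\<And>a c. (\<And>q. q \<in> T \<Longrightarrow> a q = 0) \<Longrightarrow> (\<And>q. q \<in> T \<Longrightarrow> c q = 0) \<Longrightarrow> U ** weyl a c = weyl a c ** U"
  shows "acts_only_on U T"
  using assms by (simp add: acts_only_on_iff_commute)

lemma acts_only_on_weylD:
  assumes "acts_only_on U T" "\<And>q. q \<in> T \<Longrightarrow> a q = 0" "\<And>q. q \<in> T \<Longrightarrow> c q = 0"
  shows "U ** weyl a c = weyl a c ** U"
  using assms by (simp add: acts_only_on_iff_commute)

lemma acts_only_on_mult:
  assumes "acts_only_on U T" "acts_only_on V T"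
  shows "acts_only_on (U ** V) T"
proof (rule acts_only_onI)
  fix a c :: "('a, 'b) basis"
  assume *: "\<And>q. q \<in> T \<Longrightarrow> a q = 0" "\<And>q. q \<in> T \<Longrightarrow> c q = 0"
  have "U ** V ** weyl a c = U ** (weyl a c ** V)"
    by (simp only: acts_only_on_weylD[OF assms(2) *] flip: matrix_mul_assoc)
  also have "\<dots> = weyl a c ** (U ** V)"
    by (simp only: acts_only_on_weylD[OF assms(1) *] matrix_mul_assoc)
  finally show "U ** V ** weyl a c = weyl a c ** (U ** V)" .
qed

lemma acts_only_on_scal: "acts_only_on U T \<Longrightarrow> acts_only_on (k \<cdot> U) T"
  unfolding acts_only_on_iff_commute by simp

lemma acts_only_on_phase_eq: "U \<simeq> V \<Longrightarrow> acts_only_on U T \<longleftrightarrow> acts_only_on V T"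
  by (metis acts_only_on_scal phase_eq_def phase_eq_sym)

lemma acts_only_on_adj:
  assumes "acts_only_on U T" shows "acts_only_on (adj U) T"
proof (rule acts_only_onI)
  fix a c :: "('a, 'b) basis"
  assume *: "\<And>q. q \<in> T \<Longrightarrow> a q = 0" "\<And>q. q \<in> T \<Longrightarrow> c q = 0"
  then have "U ** weyl (- a) (- c) = weyl (- a) (- c) ** U"
    by (intro acts_only_on_weylD[OF assms]) simp_all
  then have "adj (U ** adj (weyl a c)) = adj (adj (weyl a c) ** U)"
    by (simp add: adj_weyl)
  then show "adj U ** weyl a c = weyl a c ** adj U"
    by (simp add: adj_mult)
qed

lemma scal_cancel:
  assumes "unitary A" "k \<cdot> A = l \<cdot> A" shows "k = l"
proof -
  have "(k \<cdot> A) ** adj A = (l \<cdot> A) ** adj A" using assms(2) by simp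
  then have "k \<cdot> mat 1 = (l \<cdot> mat 1 :: complex ^ 'a ^ 'a)" using assms(1) by (simp add: unitary_cancel)
  then have "(k \<cdot> mat 1 :: complex ^ 'a ^ 'a) $ i $ i = (l \<cdot> mat 1 :: complex ^ 'a ^ 'a) $ i $ i" for i by simp
  then show "k = l" by (simp add: mat_def)
qed

lemma scal_unitary_eq_iff: "unitary A \<Longrightarrow> k \<cdot> A = A \<longleftrightarrow> k = 1"
  using scal_cancel[of A k 1] by auto

lemma weyl_commute_iff: "weyl a c ** weyl a' c' = weyl a' c' ** weyl a c \<longleftrightarrow> dot c a' = dot c' a"
proof -
  have "unitary (weyl a' c' ** weyl a c)" by (intro unitary_mult unitary_weyl)
  then show ?thesis
    by (simp only: weyl_commute[of a c a' c'] scal_unitary_eq_iff chi_eq_1_iff right_minus_eq)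
qed

lemma acts_only_on_weyl_iff: "acts_only_on (weyl a c) T \<longleftrightarrow> (\<forall>q. q \<notin> T \<longrightarrow> a q = 0 \<and> c q = 0)"
proof
  assume *: "acts_only_on (weyl a c) T"
  show "\<forall>q. q \<notin> T \<longrightarrow> a q = 0 \<and> c q = 0"
  proof (intro allI impI)
    fix q assume "q \<notin> T"
    then have "weyl a c ** weyl (0(q := 1)) 0 = weyl (0(q := 1)) 0 ** weyl a c"
      "weyl a c ** weyl 0 (0(q := 1)) = weyl 0 (0(q := 1)) ** weyl a c"
      by (auto intro!: acts_only_on_weylD[OF *])
    then show "a q = 0 \<and> c q = 0" by (simp add: weyl_commute_iff)
  qed
next
  assume *: "\<forall>q. q \<notin> T \<longrightarrow> a q = 0 \<and> c q = 0"
  show "acts_only_on (weyl a c) T"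
  proof (rule acts_only_onI, unfold weyl_commute_iff, rule dot_cong)
    fix a' c' :: "('a, 'b) basis" and q
    assume "\<And>q. q \<in> T \<Longrightarrow> a' q = 0" "\<And>q. q \<in> T \<Longrightarrow> c' q = 0"
    then show "c q * a' q = c' q * a q" using * by (cases "q \<in> T") simp_all
  qed
qed

text \<open>The shift X at q detects c q and the phase operator Z at q detects a q: a Weyl operator
  with a non-zero exponent at q fails to commute with one of them, whereas K commutes with
  both.\<close>

lemma weyl_coeff_eq_0_off:
  assumes "K ** weyl (0(q := 1)) 0 = weyl (0(q := 1)) 0 ** K"
    and "K ** weyl 0 (0(q := 1)) = weyl 0 (0(q := 1)) ** K"
    and "a q \<noteq> 0 \<or> c q \<noteq> 0"
  shows "weyl_coeff K a c = 0"
proof (cases "c q = 0")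
  case False
  show ?thesis
    by (rule weyl_coeff_eq_0[where \<alpha> = 1, OF _ weyl_commute unitary_weyl cmod_chi])
      (use assms(1) False in \<open>auto simp: chi_eq_1_iff dest: sym\<close>)
next
  case True
  show ?thesis
    by (rule weyl_coeff_eq_0[where \<alpha> = 1, OF _ weyl_commute unitary_weyl cmod_chi])
      (use assms(2,3) True in \<open>auto simp: chi_eq_1_iff dest: sym\<close>)
qed

lemma weyl_coeff_acts_only_on:
  assumes "acts_only_on K T" "weyl_coeff K a c \<noteq> 0" "q \<notin> T"
  shows "a q = 0 \<and> c q = 0"
proof (rule ccontr)
  assume "\<not> ?thesis"
  moreover have "K ** weyl (0(q := 1)) 0 = weyl (0(q := 1)) 0 ** K"
    "K ** weyl 0 (0(q := 1)) = weyl 0 (0(q := 1)) ** K"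
    using assms(3) by (auto intro!: acts_only_on_weylD[OF assms(1)])
  ultimately show False using weyl_coeff_eq_0_off assms(2) by blast
qed

text \<open>Expand B in Weyl operators: those with a non-zero coefficient have zero exponents on T,
  and A commutes with each of them.\<close>

lemma acts_only_on_commute:
  assumes A: "acts_only_on A T" and B: "acts_only_on B (- T)"
  shows "A ** B = B ** A"
proof -
  have "A ** (weyl_coeff B a c \<cdot> weyl a c) = (weyl_coeff B a c \<cdot> weyl a c) ** A" for a c
  proof (cases "weyl_coeff B a c = 0")
    case False
    then have "\<forall>q\<in>T. a q = 0 \<and> c q = 0" using weyl_coeff_acts_only_on[OF B] by blast
    then show ?thesis using A by (simp add: acts_only_on_iff_commute)
  qed simp
  then show ?thesis
    by (subst (1 2) weyl_expansion[of B])
      (simp only: matrix_mult_sum_left matrix_mult_sum_right)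
qed

section \<open>Pauli groups\<close>

lemma at_qudit_nth:
  "at_qudit q A $ x $ y = (if \<forall>r. r \<noteq> q \<longrightarrow> x r = y r then A $ x q $ y q else 0)"
  by (auto simp: at_qudit_def local_op_def)

lemma eq_add_single_iff: "x = y + 0(q := t) \<longleftrightarrow> (\<forall>r. r \<noteq> q \<longrightarrow> x r = y r) \<and> x q = y q + t"
  for x y :: "'q \<Rightarrow> 'a::comm_monoid_add"
  by (auto simp: fun_eq_iff)

lemma at_qudit_eqI:
  assumes "\<And>a b. A $ a $ b = (if a = b + t then k * chi (s * b) else 0)"
  shows "at_qudit q A = k \<cdot> weyl (0(q := t)) (0(q := s))"
proof -
  have "at_qudit q A $ x $ y = k * weyl (0(q := t)) (0(q := s)) $ x $ y" for x y
    by (simp only: at_qudit_nth weyl_nth eq_add_single_iff assms) (auto simp del: fun_upd_apply)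
  then show ?thesis unfolding vec_eq_iff scal_nth by blast
qed

lemma at_qudit_X: "at_qudit q pauli_X = weyl (0(q := 1)) 0"
proof -
  have "at_qudit q pauli_X = 1 \<cdot> (weyl (0(q := 1)) (0(q := 0)) :: ('a, 'b) op)"
    by (rule at_qudit_eqI) (simp add: pauli_X_def)
  moreover have "(0(q := 0) :: ('a, 'b) basis) = 0" by auto
  ultimately show ?thesis by simp
qed

lemma at_qudit_Z: "at_qudit q pauli_Z = weyl 0 (0(q := 1))"
proof -
  have "at_qudit q pauli_Z = 1 \<cdot> (weyl (0(q := 0)) (0(q := 1)) :: ('a, 'b) op)"
    by (rule at_qudit_eqI) (simp add: pauli_Z_def flip: chi_def)
  moreover have "(0(q := 0) :: ('a, 'b) basis) = 0" by auto
  ultimately show ?thesis by simp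
qed

lemma at_qudit_Y: "at_qudit q pauli_Y \<simeq> weyl (0(q := 1)) (0(q := 1))"
proof -
  have "at_qudit q pauli_Y = \<i> \<cdot> (weyl (0(q := 1)) (0(q := 1)) :: ('a, 'b) op)"
  proof (rule at_qudit_eqI)
    fix a b :: "'b mod_ring"
    have "pauli_Z $ z $ b = (if z = b then chi b else 0)" for z
      by (simp add: pauli_Z_def chi_def)
    then have "(pauli_X ** pauli_Z) $ a $ b = pauli_X $ a $ b * chi b"
      by (simp add: matrix_matrix_mult_def if_distrib[of "\<lambda>z. _ * z"] cong: if_cong)
    then show "pauli_Y $ a $ b = (if a = b + 1 then \<i> * chi (1 * b) else 0)"
      by (simp add: pauli_Y_def mat_mult_eq_scal) (simp add: pauli_X_def)
  qed
  then show ?thesis by (simp add: phase_eqI)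
qed

text \<open>Membership up to an arbitrary phase, so that the scalars contained in
  \<open>pauli_group\<close>, which depend on m, never have to be determined.\<close>

definition is_pauli :: "('q::finite, 'd::nontriv) op \<Rightarrow> bool"
  where "is_pauli P \<longleftrightarrow> (\<exists>a c. P \<simeq> weyl a c)"

lemma is_pauli_weyl [simp]: "is_pauli (weyl a c)"
  using is_pauli_def phase_eq_refl by blast

lemma is_pauli_mult: "is_pauli P \<Longrightarrow> is_pauli P' \<Longrightarrow> is_pauli (P ** P')"
  unfolding is_pauli_def by (meson phase_eq_mult phase_eq_trans phase_eq_weyl_mult)

lemma is_pauli_adj: "is_pauli P \<Longrightarrow> is_pauli (adj P)"
  unfolding is_pauli_def by (meson phase_eq_adj phase_eq_trans phase_eq_adj_weyl)

lemma is_pauli_unitary: "is_pauli P \<Longrightarrow> unitary P"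
  unfolding is_pauli_def by (meson unitary_phase_eq unitary_weyl)

lemma pauli_group_is_pauli: "P \<in> pauli_group \<Longrightarrow> is_pauli P"
  unfolding pauli_group_def
proof (induction rule: generate.induct)
  case one
  show ?case by (metis is_pauli_weyl weyl_0 monoid.select_convs(2) unitary_group_def)
next
  case (incl h)
  then show ?case
    by (auto simp: at_qudit_X at_qudit_Z split: if_splits) (use at_qudit_Y is_pauli_def in blast)
next
  case (inv h)
  then have "is_pauli h"
    by (auto simp: at_qudit_X at_qudit_Z split: if_splits) (use at_qudit_Y is_pauli_def in blast)
  then show ?case by (simp add: inv_unitary_group is_pauli_unitary is_pauli_adj)
next
  case (eng h1 h2)
  then show ?case by (simp add: unitary_group_def is_pauli_mult)
qed

lemma generate_unitary_group_mult:
  "A \<in> generate unitary_group H \<Longrightarrow> B \<in> generate unitary_group H \<Longrightarrow> A ** B \<in> generate unitary_group H"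
  using generate.eng[of A unitary_group H B] by (simp add: unitary_group_def)

lemma generate_unitary_group_one: "mat 1 \<in> generate unitary_group H"
  using generate.one[of unitary_group H] by (simp add: unitary_group_def)

lemma of_nat_to_int_mod_ring: "of_nat (nat (to_int_mod_ring a)) = (a :: 'd::nontriv mod_ring)"
  using to_int_mod_ring_nonneg(1)[of a] by (simp add: of_nat_of_int_mod_ring)

text \<open>Exact membership, with no phase to adjust: powers of X alone and of Z alone multiply
  without phases, so they are assembled separately, and X^a Z^c in this order is
  \<open>weyl a c\<close> itself.\<close>

lemma weyl_mem_pauli_group: "weyl a c \<in> pauli_group"
proof -
  let ?e = "\<lambda>q n. (0 :: ('a, 'b) basis)(q := of_nat n)"
  have X: "weyl (?e q 1) 0 \<in> pauli_group" and Z: "weyl 0 (?e q 1) \<in> pauli_group" for q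
    unfolding pauli_group_def by (auto intro!: generate.incl simp flip: at_qudit_X at_qudit_Z)
  have e: "?e q (Suc n) = ?e q n + ?e q 1" for q n by (auto simp: fun_eq_iff)
  have e0: "?e q 0 = 0" for q by (auto simp: fun_eq_iff)
  have mult: "A ** B \<in> pauli_group" if "A \<in> pauli_group" "B \<in> pauli_group" for A B :: "('a, 'b) op"
    using that unfolding pauli_group_def by (rule generate_unitary_group_mult)
  have one: "weyl 0 0 \<in> pauli_group" by (simp add: pauli_group_def generate_unitary_group_one)
  have Xn: "weyl (?e q n) 0 \<in> pauli_group" for q n
  proof (induction n)
    case 0
    show ?case by (subst e0) (rule one)
  next
    case (Suc n)
    have "weyl (?e q n) 0 ** weyl (?e q 1) 0 \<in> pauli_group" by (rule mult[OF Suc X])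
    then show ?case by (subst e) (simp only: weyl_mult dot_simps chi_0 scal_simps add_0_right)
  qed
  have Zn: "weyl 0 (?e q n) \<in> pauli_group" for q n
  proof (induction n)
    case 0
    show ?case by (subst e0) (rule one)
  next
    case (Suc n)
    have "weyl 0 (?e q n) ** weyl 0 (?e q 1) \<in> pauli_group" by (rule mult[OF Suc Z])
    then show ?case by (subst e) (simp only: weyl_mult dot_simps chi_0 scal_simps add_0_right)
  qed
  have fin: "weyl (\<lambda>q. if q \<in> B then a q else 0) 0 \<in> pauli_group \<and>
      weyl 0 (\<lambda>q. if q \<in> B then c q else 0) \<in> pauli_group" for B
  proof (induction B rule: finite_induct[OF finite])
    case 1
    then show ?case using one by (simp add: zero_fun_def)
  next
    case (2 q B)
    have "(\<lambda>r. if r \<in> insert q B then f r else 0)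
        = (\<lambda>r. if r \<in> B then f r else 0) + ?e q (nat (to_int_mod_ring (f q)))" for f
      using 2(2) by (auto simp: fun_eq_iff of_nat_to_int_mod_ring)
    then show ?case
      using mult[OF conjunct1[OF 2(3)] Xn] mult[OF conjunct2[OF 2(3)] Zn]
      by (simp add: weyl_mult)
  qed
  have "weyl a 0 ** weyl 0 c \<in> pauli_group"
    using fin[of UNIV] by (intro mult) auto
  then show ?thesis by (simp add: weyl_mult)
qed

lemma unitary_scal_iff:
  assumes "unitary A" shows "unitary (k \<cdot> A) \<longleftrightarrow> cmod k = 1"
proof
  assume "unitary (k \<cdot> A)"
  then have "(k * cnj k) \<cdot> (mat 1 :: complex ^ 'a ^ 'a) = 1 \<cdot> mat 1"
    using assms by (simp add: unitary_def)
  then have "k * cnj k = 1" by (rule scal_cancel[OF unitary_one])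
  then have "complex_of_real ((cmod k)\<^sup>2) = 1" by (simp only: complex_norm_square)
  then have "(cmod k)\<^sup>2 = 1" by (metis of_real_eq_1_iff)
  then show "cmod k = 1" by (simp add: power2_eq_1_iff) (smt (verit) norm_ge_zero)
qed (simp add: assms unitary_scal)

text \<open>Schur's lemma for Weyl operators: every coefficient except the one at the identity is
  killed by some single-qudit X or Z.\<close>

lemma commutes_imp_scalar:
  assumes "\<And>q. W ** weyl (0(q := 1)) 0 = weyl (0(q := 1)) 0 ** W"
    and "\<And>q. W ** weyl 0 (0(q := 1)) = weyl 0 (0(q := 1)) ** W"
  shows "W = weyl_coeff W 0 0 \<cdot> mat 1"
proof -
  have *: "weyl_coeff W a c \<cdot> weyl a c
      = (if c = 0 then if a = 0 then weyl_coeff W 0 0 \<cdot> mat 1 else 0 else 0)" for a c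
  proof (cases "a = 0 \<and> c = 0")
    case False
    then obtain q where "a q \<noteq> 0 \<or> c q \<noteq> 0" by (auto simp: fun_eq_iff)
    then show ?thesis using weyl_coeff_eq_0_off[OF assms] False by auto
  qed simp
  show ?thesis
    by (subst weyl_expansion[of W]) (simp add: *)
qed

text \<open>The scalars arising with X and Z at q determine the exponents c q and a q of every Weyl
  operator that occurs in W. Hence just one occurs, and unitarity makes its coefficient a
  phase.\<close>

lemma commutes_up_to_scalar_imp_pauli:
  assumes U: "unitary W"
    and X: "\<And>q. \<exists>k. W ** weyl (0(q := 1)) 0 = k \<cdot> (weyl (0(q := 1)) 0 ** W)"
    and Z: "\<And>q. \<exists>k. W ** weyl 0 (0(q := 1)) = k \<cdot> (weyl 0 (0(q := 1)) ** W)"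
  shows "is_pauli W"
proof -
  have "\<exists>a c. weyl_coeff W a c \<noteq> 0"
  proof (rule ccontr)
    assume "\<nexists>a c. weyl_coeff W a c \<noteq> 0"
    then have "W = 0" by (subst weyl_expansion[of W]) simp
    then have "0 = (mat 1 :: ('a, 'b) op)" using U by (simp add: unitary_def matrix_matrix_mult_def zero_vec_def)
    then have "(0 :: ('a, 'b) op) $ 0 $ 0 = (mat 1 :: ('a, 'b) op) $ 0 $ 0" by simp
    then show False by (simp add: mat_def)
  qed
  then obtain a0 c0 where nz: "weyl_coeff W a0 c0 \<noteq> 0" by blast
  obtain kX where kX: "\<And>q. W ** weyl (0(q := 1)) 0 = kX q \<cdot> (weyl (0(q := 1)) 0 ** W)"
    using X by metis
  obtain kZ where kZ: "\<And>q. W ** weyl 0 (0(q := 1)) = kZ q \<cdot> (weyl 0 (0(q := 1)) ** W)"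
    using Z by metis
  have cX: "kX q = chi (c q)" if "weyl_coeff W a c \<noteq> 0" for a c q
    using weyl_coeff_eq_0[OF kX[of q] weyl_commute[of a c] unitary_weyl cmod_chi] that by auto
  have cZ: "kZ q = chi (- a q)" if "weyl_coeff W a c \<noteq> 0" for a c q
    using weyl_coeff_eq_0[OF kZ[of q] weyl_commute[of a c] unitary_weyl cmod_chi] that by auto
  define D where "D = weyl_coeff W a0 c0 \<cdot> weyl a0 c0"
  have *: "weyl_coeff W a c \<cdot> weyl a c = (if c = c0 then if a = a0 then D else 0 else 0)" for a c
  proof (cases "weyl_coeff W a c = 0")
    case False
    have "chi (c q) = chi (c0 q)" "chi (- a q) = chi (- a0 q)" for q
      using cX[OF False] cX[OF nz] cZ[OF False] cZ[OF nz] by metis+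
    then have "a = a0" "c = c0" by (auto simp: chi_inj)
    then show ?thesis by (simp add: D_def)
  qed (use nz in auto)
  have "W = D"
    by (subst weyl_expansion[of W]) (simp add: *)
  then obtain k where W: "W = k \<cdot> weyl a0 c0" unfolding D_def by (rule that)
  then have "cmod k = 1" using U unitary_scal_iff[OF unitary_weyl, of k a0 c0] by simp
  then have "W \<simeq> weyl a0 c0" unfolding W by (rule phase_eqI)
  then show ?thesis unfolding is_pauli_def by (intro exI)
qed

lemma is_pauli_commute:
  assumes "is_pauli P"
  shows "\<exists>k. cmod k = 1 \<and> P ** weyl a c = k \<cdot> (weyl a c ** P)"
proof -
  obtain a' c' \<mu> where P: "P = \<mu> \<cdot> weyl a' c'" using assms by (auto simp: is_pauli_def phase_eq_def)
  show ?thesis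
    by (rule exI[of _ "chi (dot c' a - dot c a')"]) (simp add: P weyl_commute[of a' c'] mult.commute)
qed

text \<open>A Weyl operator moved past P changes only by a phase, and the phases picked up from P
  and from its adjoint cancel.\<close>

lemma acts_only_on_conj_pauli:
  assumes P: "is_pauli P" and A: "acts_only_on A T"
  shows "acts_only_on (adj P ** A ** P) T"
proof (rule acts_only_onI)
  fix a c :: "('a, 'b) basis"
  assume ac: "\<And>q. q \<in> T \<Longrightarrow> a q = 0" "\<And>q. q \<in> T \<Longrightarrow> c q = 0"
  let ?W = "weyl a c"
  obtain k where k: "cmod k = 1" "P ** ?W = k \<cdot> (?W ** P)" using is_pauli_commute[OF P] by blast
  have U: "unitary P" using P by (rule is_pauli_unitary)
  have "?W ** adj P = adj P ** (P ** ?W) ** adj P"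
    using U by (simp add: unitary_cancel flip: matrix_mul_assoc)
  also have "\<dots> = k \<cdot> (adj P ** ?W)"
    unfolding k(2) using U by (simp add: unitary_cancel flip: matrix_mul_assoc)
  finally have k': "?W ** adj P = k \<cdot> (adj P ** ?W)" .
  have "adj P ** A ** P ** ?W = k \<cdot> (adj P ** (A ** ?W) ** P)"
    by (simp add: k(2) flip: matrix_mul_assoc)
  also have "\<dots> = (k \<cdot> (adj P ** ?W)) ** A ** P"
    by (simp add: acts_only_on_weylD[OF A ac] flip: matrix_mul_assoc)
  also have "\<dots> = ?W ** (adj P ** A ** P)"
    by (simp only: k'[symmetric] matrix_mul_assoc)
  finally show "adj P ** A ** P ** ?W = ?W ** (adj P ** A ** P)" .
qed

section \<open>Supports and locality\<close>

lemma supp_phase_eq: "A \<simeq> B \<Longrightarrow> supp Q A = supp Q B"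
  by (simp add: supp_def acts_only_on_phase_eq)

lemma supp_weyl: "supp Q (weyl a c) = {i. \<exists>q\<in>Q i. a q \<noteq> 0 \<or> c q \<noteq> 0}"
  by (auto simp: supp_def acts_only_on_weyl_iff)

text \<open>The part of transversality that the iteration keeps. It passes to products, and every
  Pauli has it for every partition, so commutators with Paulis inherit it. The adjoint is tracked
  separately because the condition conjugates in one direction only.\<close>

definition local_preserving :: "('p \<Rightarrow> 'q set) \<Rightarrow> ('q::finite, 'd::nontriv) op \<Rightarrow> bool"
  where "local_preserving Q K \<longleftrightarrow>
    (\<forall>i A. acts_only_on A (Q i) \<longrightarrow> acts_only_on (adj K ** A ** K) (Q i))"

lemma local_preserving_pauli: "is_pauli P \<Longrightarrow> local_preserving Q P"
  by (simp add: local_preserving_def acts_only_on_conj_pauli)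

lemma local_preserving_mult:
  assumes "local_preserving Q K" "local_preserving Q L"
  shows "local_preserving Q (K ** L)"
  unfolding local_preserving_def
proof (intro allI impI)
  fix i and A :: "('b, 'c) op"
  assume "acts_only_on A (Q i)"
  then have "acts_only_on (adj L ** (adj K ** A ** K) ** L) (Q i)"
    using assms by (simp add: local_preserving_def)
  then show "acts_only_on (adj (K ** L) ** A ** (K ** L)) (Q i)"
    by (simp only: adj_mult matrix_mul_assoc)
qed

lemma local_preserving_commutator:
  assumes "local_preserving Q K" "local_preserving Q (adj K)" "is_pauli P"
  shows "local_preserving Q (group_commutator K P)" "local_preserving Q (adj (group_commutator K P))"
  using assms
  by (simp_all add: group_commutator_def adj_mult local_preserving_mult local_preserving_pauli is_pauli_adj)

text \<open>Bracket the commutator as K times (P adj K adj P): the second factor is a Pauli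
  conjugate of the adjoint of K, so both factors are trivial wherever K is.\<close>

lemma supp_commutator_subset:
  assumes P: "is_pauli P"
  shows "supp Q (group_commutator K P) \<subseteq> supp Q K"
proof -
  have "acts_only_on (K ** (adj (adj P) ** adj K ** adj P)) T" if "acts_only_on K T" for T
    using that by (intro acts_only_on_mult acts_only_on_conj_pauli is_pauli_adj P acts_only_on_adj)
  then show ?thesis by (auto simp: supp_def group_commutator_def matrix_mul_assoc)
qed

text \<open>A Weyl operator living on Q i commutes with P, and so does its conjugate by K, which
  still lives on Q i. Hence it passes through the whole commutator.\<close>

lemma supp_commutator_disjoint:
  assumes K: "unitary K" "local_preserving Q K" and P: "unitary P" "acts_only_on P (- Q i)"
  shows "i \<notin> supp Q (group_commutator K P)"
proof -
  have "acts_only_on (K ** P ** adj K ** adj P) (- Q i)"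
  proof (rule acts_only_onI)
    fix a c :: "('a, 'b) basis"
    assume ac: "\<And>q. q \<in> - Q i \<Longrightarrow> a q = 0" "\<And>q. q \<in> - Q i \<Longrightarrow> c q = 0"
    let ?W = "weyl a c"
    have "acts_only_on ?W (Q i)" using ac by (simp add: acts_only_on_weyl_iff)
    then have "acts_only_on (adj K ** ?W ** K) (Q i)" using K(2) by (simp add: local_preserving_def)
    then have 1: "(adj K ** ?W ** K) ** P = P ** (adj K ** ?W ** K)"
      using P(2) by (rule acts_only_on_commute)
    have 2: "adj P ** ?W = ?W ** adj P"
      by (rule acts_only_on_weylD[OF acts_only_on_adj[OF P(2)] ac])
    have "K ** P ** adj K ** adj P ** ?W = K ** P ** adj K ** ?W ** adj P"
      by (simp add: 2 flip: matrix_mul_assoc)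
    also have "\<dots> = K ** (P ** (adj K ** ?W ** K)) ** adj K ** adj P"
      using K(1) by (simp add: unitary_cancel flip: matrix_mul_assoc)
    also have "\<dots> = ?W ** (K ** P ** adj K ** adj P)"
      unfolding 1[symmetric] using K(1) by (simp add: unitary_cancel flip: matrix_mul_assoc)
    finally show "K ** P ** adj K ** adj P ** ?W = ?W ** (K ** P ** adj K ** adj P)" .
  qed
  then show ?thesis by (simp add: supp_def group_commutator_def)
qed

lemma transversal_factor:
  fixes u :: "'p::finite \<Rightarrow> ('q::finite, 'd::nontriv) basis \<Rightarrow> ('q, 'd) basis \<Rightarrow> complex"
  assumes "disjoint_family Q"
  shows "(\<chi> x y. \<Prod>j\<in>UNIV. u j (restrict x (Q j)) (restrict y (Q j)))
    = local_op (Q i) (u i) **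
      local_op (- Q i) (\<lambda>x y. \<Prod>j\<in>-{i}. u j (restrict x (Q j)) (restrict y (Q j)))"
proof -
  let ?R = "\<lambda>x y. \<Prod>j\<in>-{i}. u j (restrict x (Q j)) (restrict y (Q j))"
  have "(\<Prod>j\<in>UNIV. u j (restrict x (Q j)) (restrict y (Q j)))
    = (local_op (Q i) (u i) ** local_op (- Q i) ?R) $ x $ y" for x y
  proof -
    \<comment> \<open>The only intermediate basis state contributing to the matrix product: the left
      factor forces agreement with x off Q i, the right factor agreement with y on Q i.\<close>
    let ?z = "\<lambda>q. if q \<in> Q i then y q else x q"
    have sub: "Q j \<subseteq> - Q i" if "j \<noteq> i" for j
      using assms that by (auto simp: disjoint_family_on_def)
    have "(local_op (Q i) (u i) ** local_op (- Q i) ?R) $ x $ y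
        = (\<Sum>z\<in>UNIV. if z = ?z then u i (restrict x (Q i)) (restrict z (Q i)) *
            ?R (restrict z (- Q i)) (restrict y (- Q i)) else 0)"
      unfolding matrix_matrix_mult_def local_op_def
      by (auto simp: fun_eq_iff intro!: sum.cong)
    also have "\<dots> = u i (restrict x (Q i)) (restrict ?z (Q i)) *
            ?R (restrict ?z (- Q i)) (restrict y (- Q i))"
      by simp
    also have "restrict ?z (Q i) = restrict y (Q i)"
      by (auto simp: restrict_def)
    also have "?R (restrict ?z (- Q i)) (restrict y (- Q i)) = ?R x y"
    proof (rule prod.cong[OF refl])
      fix j assume "j \<in> - {i}"
      then have "restrict (restrict ?z (- Q i)) (Q j) = restrict x (Q j)"
        "restrict (restrict y (- Q i)) (Q j) = restrict y (Q j)"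
        using sub[of j] by (auto simp: restrict_def fun_eq_iff)
      then show "u j (restrict (restrict ?z (- Q i)) (Q j)) (restrict (restrict y (- Q i)) (Q j))
        = u j (restrict x (Q j)) (restrict y (Q j))" by simp
    qed
    also have "u i (restrict x (Q i)) (restrict y (Q i)) * ?R x y
        = (\<Prod>j\<in>UNIV. u j (restrict x (Q j)) (restrict y (Q j)))"
      by (subst prod.remove[of UNIV i]) (auto simp: Compl_eq_Diff_UNIV)
    finally show ?thesis by (rule sym)
  qed
  then show ?thesis by (simp only: vec_eq_iff vec_lambda_beta) blast
qed

text \<open>Write K = U R with U on Q i and R off it. Conjugating an operator on Q i by K amounts to
  conjugating it by U, since R commutes through and cancels.\<close>

lemma transversal_imp_local_preserving:
  fixes Q :: "'p::finite \<Rightarrow> 'q::finite set" and K :: "('q, 'd::nontriv) op"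
  assumes Q: "disjoint_family Q" and K: "unitary K" "transversal Q K"
  shows "local_preserving Q K" "local_preserving Q (adj K)"
proof -
  have *: "acts_only_on (adj K ** A ** K) (Q i) \<and> acts_only_on (K ** A ** adj K) (Q i)"
    if A: "acts_only_on A (Q i)" for A i
  proof -
    obtain u where u: "\<And>i. unitary (local_op (Q i) (u i) :: ('q, 'd) op)"
      and Ku: "K = (\<chi> x y. \<Prod>i\<in>UNIV. u i (restrict x (Q i)) (restrict y (Q i)))"
      using K(2) by (auto simp: transversal_def)
    define U R :: "('q, 'd) op" where "U = local_op (Q i) (u i)"
      and "R = local_op (- Q i) (\<lambda>x y. \<Prod>j\<in>-{i}. u j (restrict x (Q j)) (restrict y (Q j)))"
    have KUR: "K = U ** R" unfolding Ku U_def R_def by (rule transversal_factor[OF Q])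
    have U: "unitary U" "acts_only_on U (Q i)" using u by (auto simp: U_def acts_only_on_def)
    have R: "acts_only_on R (- Q i)" by (auto simp: R_def acts_only_on_def)
    have "R = adj U ** K" using U(1) by (simp add: KUR unitary_cancel)
    then have R': "unitary R" using U(1) K(1) by (simp add: unitary_mult unitary_adj)
    have 1: "acts_only_on (adj U ** A ** U) (Q i)"
      by (intro acts_only_on_mult acts_only_on_adj U A)
    have 2: "acts_only_on (U ** A ** adj U) (Q i)"
      by (intro acts_only_on_mult acts_only_on_adj U A)
    have "adj K ** A ** K = adj R ** ((adj U ** A ** U) ** R)"
      by (simp add: KUR adj_mult matrix_mul_assoc)
    also have "\<dots> = adj U ** A ** U"
      unfolding acts_only_on_commute[OF 1 R] using R' by (simp add: unitary_cancel)
    finally have 3: "adj K ** A ** K = adj U ** A ** U" .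
    have "K ** A ** adj K = U ** (R ** A) ** adj R ** adj U"
      by (simp add: KUR adj_mult matrix_mul_assoc)
    also have "\<dots> = U ** A ** adj U"
      unfolding acts_only_on_commute[OF A R, symmetric] using R'
      by (simp add: unitary_cancel flip: matrix_mul_assoc)
    finally show ?thesis using 1 2 3 by simp
  qed
  then show "local_preserving Q K" "local_preserving Q (adj K)"
    by (simp_all add: local_preserving_def)
qed

section \<open>Powers of unitaries\<close>

lemma scal_sum_right: "k \<cdot> (\<Sum>i\<in>I. A i) = (\<Sum>i\<in>I. k \<cdot> A i)"
  by (simp add: vec_eq_iff sum_distrib_left)

lemma scal_sum_left: "(\<Sum>i\<in>I. k i) \<cdot> A = (\<Sum>i\<in>I. k i \<cdot> A)"
  by (simp add: vec_eq_iff sum_distrib_right)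

lemma sum_chi: "(\<Sum>t\<in>UNIV. chi (t * j)) = (if j = 0 then of_nat CARD('d) else 0)"
  for j :: "'d::nontriv mod_ring"
proof (cases "j = 0")
  case False
  have "(\<Sum>t\<in>UNIV. chi (t * j)) = (\<Sum>t\<in>UNIV. chi ((t + 1) * j))"
    by (rule sum_shift[symmetric])
  also have "\<dots> = chi j * (\<Sum>t\<in>UNIV. chi (t * j))"
    by (simp only: distrib_right mult_1 chi_add sum_distrib_left mult.commute[of _ "chi j"])
  finally show ?thesis using False by (auto simp: chi_eq_1_iff)
qed simp

definition pw :: "complex ^ 'x ^ 'x \<Rightarrow> nat \<Rightarrow> complex ^ 'x ^ 'x"
  where "pw A n = A [^]\<^bsub>unitary_group\<^esub> n"

lemma pw_0 [simp]: "pw A 0 = mat 1"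
  by (simp add: pw_def nat_pow_def unitary_group_def)

lemma pw_Suc: "pw A (Suc n) = pw A n ** A"
  by (simp add: pw_def nat_pow_def unitary_group_def)

lemma pw_commute: "C ** A = k \<cdot> (A ** C) \<Longrightarrow> C ** pw A n = k ^ n \<cdot> (pw A n ** C)"
proof (induction n)
  case (Suc n)
  have "C ** pw A (Suc n) = C ** pw A n ** A"
    by (simp add: pw_Suc matrix_mul_assoc)
  also have "\<dots> = k ^ n \<cdot> (pw A n ** (C ** A))"
    by (simp add: Suc.IH[OF Suc.prems] flip: matrix_mul_assoc)
  also have "\<dots> = k ^ Suc n \<cdot> (pw A (Suc n) ** C)"
    unfolding Suc.prems by (simp add: pw_Suc matrix_mul_assoc mult.commute)
  finally show ?case .
qed simp

lemma pw_commute1: "C ** A = A ** C \<Longrightarrow> C ** pw A n = pw A n ** C"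
  using pw_commute[of C A 1 n] by simp

lemma pw_Suc2: "pw A (Suc n) = A ** pw A n"
  by (simp add: pw_Suc pw_commute1)

lemma pw_add: "pw A (n + l) = pw A n ** pw A l"
  by (induction l) (simp_all add: pw_Suc matrix_mul_assoc)

lemma pw_scal: "pw (c \<cdot> A) n = c ^ n \<cdot> pw A n"
  by (induction n) (simp_all add: pw_Suc mult.commute)

lemma pw_phase_eq: "A \<simeq> B \<Longrightarrow> pw A n \<simeq> pw B n"
  by (induction n) (simp_all add: pw_Suc phase_eq_mult)

lemma pw_weyl: "pw (weyl a c) n \<simeq> weyl (\<lambda>q. of_nat n * a q) (\<lambda>q. of_nat n * c q)"
proof (induction n)
  case 0
  have "weyl (\<lambda>q. of_nat 0 * a q) (\<lambda>q. of_nat 0 * c q) = weyl 0 0"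
    by (intro arg_cong2[where f = weyl]) auto
  then show ?case by simp
next
  case (Suc n)
  have "pw (weyl a c) (Suc n) \<simeq> weyl (\<lambda>q. of_nat n * a q) (\<lambda>q. of_nat n * c q) ** weyl a c"
    by (simp add: pw_Suc Suc phase_eq_mult)
  also have "\<dots> \<simeq> weyl ((\<lambda>q. of_nat n * a q) + a) ((\<lambda>q. of_nat n * c q) + c)"
    by (rule phase_eq_weyl_mult)
  also have "\<dots> = weyl (\<lambda>q. of_nat (Suc n) * a q) (\<lambda>q. of_nat (Suc n) * c q)"
    by (intro arg_cong2[where f = weyl]) (auto simp: algebra_simps)
  finally show ?case .
qed

lemma is_pauli_one: "is_pauli (mat 1)"
  using is_pauli_weyl[of 0 0] by simp

lemma is_pauli_pw: "is_pauli P \<Longrightarrow> is_pauli (pw P n)"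
  by (induction n) (simp_all add: pw_Suc is_pauli_mult is_pauli_one)

lemma pw_mod:
  assumes "pw A m = mat 1" shows "pw A (n mod m) = pw A n"
proof -
  have *: "pw A (m * j) = mat 1" for j
    by (induction j) (simp_all add: pw_add assms)
  have "pw A n = pw A (m * (n div m) + n mod m)" by simp
  then show ?thesis by (simp only: pw_add *) simp
qed

lemma ex_root_of_phase:
  assumes "cmod z = 1" "n > 0" shows "\<exists>c. cmod c = 1 \<and> c ^ n = z"
proof -
  obtain t where "z = cis t"
    using assms(1) by (metis mult_1 of_real_1 rcis_cmod_Arg rcis_def)
  then have "cis (t / real n) ^ n = z"
    using assms(2) by (simp add: Complex.DeMoivre)
  then show ?thesis by (intro exI[of _ "cis (t / real n)"]) simp
qed

text \<open>The m-th power of a Pauli is a scalar but not always 1: XZ squares to -1 for qubits.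
  Rescaling by an m-th root of the inverse phase repairs this.\<close>

lemma pauli_normalize:
  assumes "is_pauli (P :: ('q::finite, 'd::nontriv) op)"
  shows "\<exists>c. cmod c = 1 \<and> pw (c \<cdot> P) CARD('d) = mat 1"
proof -
  obtain a c where "P \<simeq> weyl a c" using assms by (auto simp: is_pauli_def)
  then have "pw P CARD('d) \<simeq> weyl (\<lambda>q. of_nat CARD('d) * a q) (\<lambda>q. of_nat CARD('d) * c q)"
    using pw_phase_eq pw_weyl phase_eq_trans by blast
  also have "\<dots> = weyl 0 0"
    by (simp only: of_nat_card_eq_0) (intro arg_cong2[where f = weyl]; auto)
  finally obtain z where z: "cmod z = 1" "pw P CARD('d) = z \<cdot> mat 1"
    by (auto simp: phase_eq_def)
  moreover have "0 < CARD('d)" by simp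
  ultimately obtain c where "cmod c = 1" "c ^ CARD('d) = cnj z"
    using ex_root_of_phase[of "cnj z" "CARD('d)"] by auto
  then show ?thesis using z by (intro exI[of _ c]) (simp add: pw_scal cnj_mult_self)
qed

text \<open>Powers with exponents modulo m. The law \<open>rp_add_1\<close> has to wrap around at m,
  which is where \<open>pw A CARD('d) = mat 1\<close> enters.\<close>

definition rp :: "complex ^ 'x ^ 'x \<Rightarrow> 'd::nontriv mod_ring \<Rightarrow> complex ^ 'x ^ 'x"
  where "rp A j = pw A (nat (to_int_mod_ring j))"

lemma rp_0 [simp]: "rp A 0 = mat 1"
  by (simp add: rp_def zero_mod_ring.rep_eq to_int_mod_ring.rep_eq)

lemma rp_add_1:
  assumes "pw A CARD('d::nontriv) = mat 1"
  shows "A ** rp A (j :: 'd mod_ring) = rp A (j + 1)"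
proof -
  have "to_int_mod_ring (j + 1) = (to_int_mod_ring j + 1) mod int CARD('d)"
    by transfer simp
  then have "nat (to_int_mod_ring (j + 1)) = Suc (nat (to_int_mod_ring j)) mod CARD('d)"
    using to_int_mod_ring_nonneg(1)[of j] by (simp add: nat_mod_distrib nat_add_distrib)
  then show ?thesis
    by (simp only: rp_def pw_mod[OF assms] pw_Suc2)
qed

lemma rp_commute: "C ** A = A ** C \<Longrightarrow> C ** rp A j = rp A j ** C"
  by (simp add: rp_def pw_commute1)

lemma chi_of_nat: "chi (of_nat n :: 'd mod_ring) = chi (1 :: 'd::nontriv mod_ring) ^ n"
  by (induction n) (simp_all add: chi_add)

lemma rp_commute_chi:
  assumes "C ** A = chi (1 :: 'd::nontriv mod_ring) \<cdot> (A ** C)"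
  shows "C ** rp A j = chi (j :: 'd mod_ring) \<cdot> (rp A j ** C)"
  using pw_commute[OF assms, of "nat (to_int_mod_ring j)"]
  by (simp add: rp_def of_nat_to_int_mod_ring flip: chi_of_nat)

text \<open>M t is m times the spectral projection of A for the eigenvalue \<open>chi t\<close>,
  written as a Fourier sum over the powers of A. As a polynomial in A it commutes with whatever
  commutes with A.\<close>

lemma ex_eigen_decomposition:
  fixes A :: "complex ^ 'x ^ 'x"
  assumes A: "pw A CARD('d::nontriv) = mat 1"
  shows "\<exists>M :: 'd mod_ring \<Rightarrow> _. (\<forall>t. A ** M t = chi t \<cdot> M t) \<and>
    (\<Sum>t\<in>UNIV. M t) = of_nat CARD('d) \<cdot> mat 1 \<and>
    (\<forall>t C. C ** A = A ** C \<longrightarrow> C ** M t = M t ** C)"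
proof -
  define M :: "'d mod_ring \<Rightarrow> complex ^ 'x ^ 'x"
    where "M t = (\<Sum>j\<in>UNIV. chi (t * - j) \<cdot> rp A j)" for t
  have "A ** M t = chi t \<cdot> M t" for t
  proof -
    have "A ** M t = (\<Sum>j\<in>UNIV. chi t \<cdot> chi (t * - (j + 1)) \<cdot> rp A (j + 1))"
      by (simp add: M_def matrix_mult_sum_right rp_add_1[OF A] algebra_simps flip: chi_add)
    also have "\<dots> = chi t \<cdot> M t"
      by (simp only: M_def scal_sum_right sum_shift[of "\<lambda>j. chi t \<cdot> chi (t * - j) \<cdot> rp A j" 1])
    finally show ?thesis .
  qed
  moreover have "(\<Sum>t\<in>UNIV. M t) = of_nat CARD('d) \<cdot> mat 1"
  proof -
    have "(\<Sum>t\<in>UNIV. M t) = (\<Sum>j\<in>UNIV. (\<Sum>t\<in>UNIV. chi (t * - (j :: 'd mod_ring))) \<cdot> rp A j)"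
      unfolding M_def scal_sum_left by (rule sum.swap)
    also have "\<dots> = (\<Sum>j\<in>UNIV. if j = (0 :: 'd mod_ring) then of_nat CARD('d) \<cdot> mat 1 else 0)"
      unfolding sum_chi by (rule sum.cong) auto
    finally show ?thesis by simp
  qed
  moreover have "C ** M t = M t ** C" if "C ** A = A ** C" for t C
    by (simp add: M_def matrix_mult_sum_left matrix_mult_sum_right rp_commute[OF that])
  ultimately show ?thesis by blast
qed

lemma scal_mult_vec: "(k \<cdot> A) *v v = k *s (A *v v)"
  by (simp add: vec_eq_iff matrix_vector_mult_def sum_distrib_left mult_ac)

lemma sum_mult_vec: "(\<Sum>i\<in>I. A i) *v v = (\<Sum>i\<in>I. A i *v v)" for A :: "_ \<Rightarrow> complex ^ 'b ^ 'a"
  by (induction I rule: infinite_finite_induct) (simp_all add: matrix_vector_mult_add_rdistrib)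

section \<open>Stabilizer codes\<close>

text \<open>Collects what the argument extracts from a code and its logical generators, in terms of
  commutation up to phases. \<open>LZX\<close> reads [X, Z] = omega^-1 in the opposite order, so
  that its phase is \<open>chi 1\<close> = omega.\<close>

locale pauli_code =
  fixes S :: "('q::finite, 'd::nontriv) op set"
    and LX LZ :: "'k::finite \<Rightarrow> ('q, 'd) op"
  assumes finite_S: "finite S" and one_mem: "mat 1 \<in> S"
    and mult_mem: "s \<in> S \<Longrightarrow> t \<in> S \<Longrightarrow> s ** t \<in> S"
    and adj_mem: "s \<in> S \<Longrightarrow> adj s \<in> S"
    and S_pauli: "s \<in> S \<Longrightarrow> is_pauli s"
    and LX_pauli: "is_pauli (LX i)" and LZ_pauli: "is_pauli (LZ i)"
    and LX_S: "s \<in> S \<Longrightarrow> s ** LX i = LX i ** s" and LZ_S: "s \<in> S \<Longrightarrow> s ** LZ i = LZ i ** s"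
    and LXX: "LX i ** LX j = LX j ** LX i" and LZZ: "LZ i ** LZ j = LZ j ** LZ i"
    and LZX: "LZ i ** LX j = chi (if i = j then 1 else 0 :: 'd mod_ring) \<cdot> (LX j ** LZ i)"
    and dim_code: "vec.dim (code_space S) = CARD('d) ^ CARD('k)"
begin

lemma S_unitary: "s \<in> S \<Longrightarrow> unitary s"
  by (simp add: S_pauli is_pauli_unitary)

text \<open>The orthogonal projection onto the code space.\<close>

definition proj :: "('q, 'd) op"
  where "proj = (1 / of_nat (card S)) \<cdot> (\<Sum>s\<in>S. s)"

lemma card_S_nonzero: "of_nat (card S) \<noteq> (0 :: complex)"
  using finite_S one_mem by auto

lemma proj_absorb:
  assumes "s \<in> S" shows "s ** proj = proj" "proj ** s = proj"
proof -
  have "(\<Sum>t\<in>S. s ** t) = (\<Sum>t\<in>S. t)"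
    by (rule sum.reindex_bij_witness[of _ "\<lambda>t. adj s ** t" "\<lambda>t. s ** t"])
      (use assms S_unitary in \<open>auto simp: unitary_cancel mult_mem adj_mem\<close>)
  then show "s ** proj = proj" by (simp add: proj_def matrix_mult_sum_right)
  have "(\<Sum>t\<in>S. t ** s) = (\<Sum>t\<in>S. t)"
    by (rule sum.reindex_bij_witness[of _ "\<lambda>t. t ** adj s" "\<lambda>t. t ** s"])
      (use assms S_unitary in \<open>auto simp: unitary_cancel mult_mem adj_mem simp flip: matrix_mul_assoc\<close>)
  then show "proj ** s = proj" by (simp add: proj_def matrix_mult_sum_left)
qed

lemma proj_eqI:
  assumes "\<And>s. s \<in> S \<Longrightarrow> s ** A = A" shows "proj ** A = A"
  using assms card_S_nonzero by (simp add: proj_def matrix_mult_sum_left vec_eq_iff)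

text \<open>The logical Z operators are diagonalised one after another. The spectral pieces M t of
  the next one sum to a non-zero multiple of the identity, so one of them keeps v non-zero; they
  commute with S and with the other logical Z operators, so what has been gained is
  preserved.\<close>

lemma joint_eigenvector:
  "\<exists>v. v \<noteq> 0 \<and> v \<in> code_space S \<and> (\<forall>i\<in>B. \<exists>\<zeta>. cmod \<zeta> = 1 \<and> LZ i *v v = \<zeta> *s v)"
proof (induction B rule: finite_induct[OF finite])
  case 1
  have "\<not> code_space S \<subseteq> {0}"
  proof
    assume "code_space S \<subseteq> {0}"
    then have "vec.dim (code_space S) = 0" by (metis vec.dim_eq_0)
    then show False using dim_code by simp
  qed
  then show ?case by auto
next
  case (2 i B)
  then obtain v where v: "v \<noteq> 0" "v \<in> code_space S"
    and vB: "\<And>j. j \<in> B \<Longrightarrow> \<exists>\<zeta>. cmod \<zeta> = 1 \<and> LZ j *v v = \<zeta> *s v" by blast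
  obtain c where c: "cmod c = 1" "pw (c \<cdot> LZ i) CARD('d) = mat 1"
    using pauli_normalize[OF LZ_pauli] by blast
  obtain M :: "'d mod_ring \<Rightarrow> _" where M: "\<And>t. (c \<cdot> LZ i) ** M t = chi t \<cdot> M t"
    "(\<Sum>t\<in>UNIV. M t) = of_nat CARD('d) \<cdot> mat 1"
    and comm: "\<And>t C. C ** (c \<cdot> LZ i) = (c \<cdot> LZ i) ** C \<Longrightarrow> C ** M t = M t ** C"
    using ex_eigen_decomposition[OF c(2)] by blast
  have "(\<Sum>t\<in>UNIV. M t) *v v \<noteq> 0"
    using v(1) by (simp add: M(2) scal_mult_vec)
  then obtain t where t: "M t *v v \<noteq> 0"
    unfolding sum_mult_vec by (meson sum.neutral)
  have "M t *v v \<in> code_space S"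
    unfolding code_space_def
  proof (intro CollectI ballI)
    fix s assume s: "s \<in> S"
    have "s ** M t = M t ** s" by (rule comm) (simp add: LZ_S[OF s])
    then have "s *v (M t *v v) = M t *v (s *v v)" by (simp add: matrix_vector_mul_assoc)
    then show "s *v (M t *v v) = M t *v v" using v(2) s by (simp add: code_space_def)
  qed
  moreover have "\<exists>\<zeta>. cmod \<zeta> = 1 \<and> LZ j *v (M t *v v) = \<zeta> *s (M t *v v)" if j: "j \<in> insert i B" for j
  proof (cases "j = i")
    case True
    have "cnj c \<cdot> ((c \<cdot> LZ i) ** M t) = LZ i ** M t"
      using c(1) by (simp add: cnj_mult_self)
    then have "LZ i ** M t = (cnj c * chi t) \<cdot> M t" unfolding M(1) by simp
    then have "LZ j *v (M t *v v) = (cnj c * chi t) *s (M t *v v)"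
      by (simp add: True matrix_vector_mul_assoc scal_mult_vec)
    then show ?thesis using c(1) by (intro exI[of _ "cnj c * chi t"]) (simp add: norm_mult)
  next
    case False
    then obtain \<zeta> where \<zeta>: "cmod \<zeta> = 1" "LZ j *v v = \<zeta> *s v" using vB j by blast
    have "LZ j ** M t = M t ** LZ j" by (rule comm) (simp add: LZZ[of j i])
    then have "LZ j *v (M t *v v) = M t *v (LZ j *v v)" by (simp add: matrix_vector_mul_assoc)
    then show ?thesis using \<zeta> by (auto simp: vector_scalar_commute)
  qed
  ultimately show ?case using t by blast
qed

text \<open>For B = \<open>UNIV\<close>, the vector u a is T^a v, the code word of the basis state
  a. During the induction the coordinates outside B are inert, so in the step for i the power of T i
  alone accounts for a i.\<close>

lemma shifted_eigenvectors:
  assumes TP: "\<And>i. \<exists>c. cmod c = 1 \<and> T i = c \<cdot> LX i" and T: "\<And>i. pw (T i) CARD('d) = mat 1"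
    and v: "v \<in> code_space S" "\<And>i. LZ i *v v = \<zeta> i *s v"
  shows "\<exists>u :: ('k, 'd) basis \<Rightarrow> _. u 0 = v \<and> (\<forall>a. u a \<in> code_space S) \<and>
    (\<forall>i a. i \<in> B \<longrightarrow> T i *v u a = u (a + 0(i := 1))) \<and>
    (\<forall>i a. i \<notin> B \<longrightarrow> u (a + 0(i := 1)) = u a) \<and>
    (\<forall>i a. LZ i *v u a = (\<zeta> i * (if i \<in> B then chi (a i) else 1)) *s u a)"
proof (induction B rule: finite_induct[OF finite])
  case 1
  show ?case by (rule exI[of _ "\<lambda>_. v"]) (simp add: v)
next
  case (2 i B)
  then obtain u :: "('k, 'd) basis \<Rightarrow> _" where u0: "u 0 = v" and uS: "\<And>a. u a \<in> code_space S"
    and uX: "\<And>j a. j \<in> B \<Longrightarrow> T j *v u a = u (a + 0(j := 1))"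
    and uX': "\<And>j a. j \<notin> B \<Longrightarrow> u (a + 0(j := 1)) = u a"
    and uZ: "\<And>j a. LZ j *v u a = (\<zeta> j * (if j \<in> B then chi (a j) else 1)) *s u a" by blast
  obtain c where c: "T i = c \<cdot> LX i" using TP by blast
  have TT: "T j ** T i = T i ** T j" for j
    using TP[of j] TP[of i] by (auto simp: LXX[of i j] mult.commute)
  define w where "w a = rp (T i) (a i) *v u a" for a
  have "w 0 = v" by (simp add: w_def u0)
  moreover have "w a \<in> code_space S" for a
    unfolding code_space_def
  proof (intro CollectI ballI)
    fix s assume s: "s \<in> S"
    have "s ** rp (T i) (a i) = rp (T i) (a i) ** s" by (rule rp_commute) (simp add: c LX_S[OF s])
    moreover have "s *v u a = u a" using uS s by (simp add: code_space_def)
    ultimately show "s *v w a = w a"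
      by (simp add: w_def matrix_vector_mul_assoc) (simp flip: matrix_vector_mul_assoc)
  qed
  moreover have "T j *v w a = w (a + 0(j := 1))" if j: "j \<in> insert i B" for j a
  proof (cases "j = i")
    case True
    then show ?thesis
      using uX'[OF 2(2)] by (simp add: w_def matrix_vector_mul_assoc rp_add_1[OF T])
  next
    case False
    then show ?thesis
      using uX j by (simp add: w_def matrix_vector_mul_assoc rp_commute[OF TT])
        (simp flip: matrix_vector_mul_assoc)
  qed
  moreover have "w (a + 0(j := 1)) = w a" if "j \<notin> insert i B" for j a
    using that uX'[of j a] by (auto simp: w_def)
  moreover have "LZ j *v w a = (\<zeta> j * (if j \<in> insert i B then chi (a j) else 1)) *s w a" for j a
  proof (cases "j = i")
    case True
    have "LZ i ** T i = chi (1 :: 'd mod_ring) \<cdot> (T i ** LZ i)"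
      by (simp add: c LZX mult.commute)
    then have "LZ i *v w a = chi (a i) *s (rp (T i) (a i) *v (LZ i *v u a))"
      by (simp add: w_def matrix_vector_mul_assoc rp_commute_chi scal_mult_vec)
    then show ?thesis using True 2(2) by (simp add: uZ w_def vector_scalar_commute mult.commute)
  next
    case False
    have "LZ j ** T i = T i ** LZ j"
      using False by (simp add: c LZX[of j i])
    then have "LZ j *v w a = rp (T i) (a i) *v (LZ j *v u a)"
      by (simp add: w_def matrix_vector_mul_assoc rp_commute)
    then show ?thesis using False by (simp add: uZ w_def vector_scalar_commute)
  qed
  ultimately show ?case by (intro exI[of _ w]) blast
qed

end

section \<open>Encodings\<close>

lemma logical_encodingD:
  assumes "logical_encoding S LX LZ V"
  shows "adj V ** V = mat 1" and "range ((*v) V) = code_space S"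
    and "s \<in> S \<Longrightarrow> s ** V = V"
    and "LX i ** V \<simeq> V ** weyl (0(i := 1)) 0" and "LZ i ** V \<simeq> V ** weyl 0 (0(i := 1))"
proof -
  show 1: "adj V ** V = mat 1" and 2: "range ((*v) V) = code_space S"
    using assms by (simp_all add: logical_encoding_def)
  show "s ** V = V" if "s \<in> S"
  proof -
    have "(s ** V) *v w = V *v w" for w
    proof -
      have "V *v w \<in> code_space S" using 2 by blast
      then show ?thesis using that by (simp add: code_space_def matrix_vector_mul_assoc)
    qed
    then show ?thesis unfolding matrix_eq by blast
  qed
  show "LX i ** V \<simeq> V ** weyl (0(i := 1)) 0"
    by (rule phase_eq_sym, unfold phase_eq_def)
      (use assms in \<open>simp add: logical_encoding_def at_qudit_X mat_mult_eq_scal\<close>)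
  show "LZ i ** V \<simeq> V ** weyl 0 (0(i := 1))"
    by (rule phase_eq_sym, unfold phase_eq_def)
      (use assms in \<open>simp add: logical_encoding_def at_qudit_Z mat_mult_eq_scal\<close>)
qed

text \<open>V adj V is the projection onto the range of V, which is the code space, and the
  hypothesis says that A maps into the code space.\<close>

lemma encoding_absorb:
  assumes V: "logical_encoding S LX LZ V" and A: "\<And>s. s \<in> S \<Longrightarrow> s ** A = A"
  shows "V ** adj V ** A = A"
proof -
  have "(V ** adj V ** A) *v w = A *v w" for w
  proof -
    have "A *v w \<in> code_space S" by (simp add: code_space_def matrix_vector_mul_assoc A)
    then obtain z where z: "A *v w = V *v z"
      using logical_encodingD(2)[OF V] by (metis rangeE)
    have "(V ** adj V ** A) *v w = (V ** adj V) *v (A *v w)"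
      by (simp add: matrix_vector_mul_assoc)
    also have "\<dots> = (V ** (adj V ** V)) *v z"
      by (simp add: z matrix_vector_mul_assoc matrix_mul_assoc)
    also have "\<dots> = A *v w" by (simp add: logical_encodingD(1)[OF V] z)
    finally show ?thesis .
  qed
  then show ?thesis unfolding matrix_eq by blast
qed

definition represents ::
  "complex ^ ('k, 'd) basis ^ ('q, 'd) basis \<Rightarrow> ('q::finite, 'd::nontriv) op
    \<Rightarrow> ('k::finite, 'd) basis \<Rightarrow> ('k, 'd) basis \<Rightarrow> bool"
  where "represents V P a c \<longleftrightarrow> P ** V \<simeq> V ** weyl a c"

lemma represents_mult:
  assumes "represents V P a c" "represents V P' a' c'"
  shows "represents V (P ** P') (a + a') (c + c')"
proof -
  have "P ** P' ** V = P ** (P' ** V)" by (simp add: matrix_mul_assoc)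
  also have "\<dots> \<simeq> P ** (V ** weyl a' c')"
    using assms(2) by (intro phase_eq_mult) (simp_all add: represents_def)
  also have "\<dots> = (P ** V) ** weyl a' c'" by (simp add: matrix_mul_assoc)
  also have "\<dots> \<simeq> (V ** weyl a c) ** weyl a' c'"
    using assms(1) by (intro phase_eq_mult) (simp_all add: represents_def)
  also have "\<dots> = V ** (weyl a c ** weyl a' c')" by (simp add: matrix_mul_assoc)
  also have "\<dots> \<simeq> V ** weyl (a + a') (c + c')"
    by (intro phase_eq_mult phase_eq_weyl_mult phase_eq_refl)
  finally show ?thesis by (simp add: represents_def)
qed

lemma represents_one: "P ** V = V \<Longrightarrow> represents V P 0 0"
  by (simp add: represents_def)

lemma zero_upd_zero: "0(q := 0) = (0 :: 'a \<Rightarrow> 'b::zero)"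
  by auto

lemma represents_pw:
  assumes "represents V P (0(q := x)) (0(q := z))"
  shows "represents V (pw P n) (0(q := of_nat n * x)) (0(q := of_nat n * z))"
proof (induction n)
  case 0
  show ?case unfolding of_nat_0 mult_zero_left zero_upd_zero by (rule represents_one) simp
next
  case (Suc n)
  have "0(q := of_nat n * y) + 0(q := y) = 0(q := of_nat (Suc n) * y)" for y :: "'b mod_ring"
    by (auto simp: algebra_simps)
  then show ?case
    using represents_mult[OF Suc assms] unfolding pw_Suc by (simp only:)
qed

text \<open>Taking adjoints in T V = k V W gives W adj V = cnj k adj V T, and the two phases cancel
  around the Gram matrix adj V V. Schur's lemma can then replace a direct proof that the code words
  are orthogonal.\<close>

lemma gram_commutes:
  assumes T: "unitary T" and W: "unitary W" and TV: "T ** V = k \<cdot> (V ** W)" and k: "cmod k = 1"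
  shows "adj V ** V ** W = W ** (adj V ** V)"
proof -
  have "adj V ** adj T = cnj k \<cdot> (adj W ** adj V)"
    using arg_cong[OF TV, of adj] by (simp add: adj_mult)
  then have "W ** (adj V ** adj T) ** T = cnj k \<cdot> (W ** (adj W ** adj V)) ** T" by simp
  then have 1: "W ** adj V = cnj k \<cdot> (adj V ** T)"
    using T W by (simp add: unitary_cancel flip: matrix_mul_assoc)
  have "W ** (adj V ** V) = cnj k \<cdot> (adj V ** (T ** V))"
    by (simp add: 1 matrix_mul_assoc)
  also have "\<dots> = adj V ** V ** W"
    by (simp add: TV cnj_mult_self[OF k] matrix_mul_assoc)
  finally show ?thesis by (rule sym)
qed

lemma code_space_subspace: "vec.subspace (code_space S)"
  by (rule vec.subspaceI)
    (auto simp: code_space_def matrix_vector_right_distrib vector_scalar_commute)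

section \<open>Existence of an encoding and the action of logical Paulis under it\<close>

context pauli_code
begin

text \<open>The columns of V are the shifted eigenvectors. Their Gram matrix commutes with every X
  and Z, hence is scalar; it is positive because v is non-zero, so V can be normalised to an
  isometry. The range lies in the code space and has the same dimension.\<close>

lemma encoding_exists: "\<exists>V. logical_encoding S LX LZ V"
proof -
  obtain v where v: "v \<noteq> 0" "v \<in> code_space S"
    and ev: "\<And>i. \<exists>\<zeta>. cmod \<zeta> = 1 \<and> LZ i *v v = \<zeta> *s v"
    using joint_eigenvector[of UNIV] by blast
  obtain \<zeta> where \<zeta>: "\<And>i. cmod (\<zeta> i) = 1" "\<And>i. LZ i *v v = \<zeta> i *s v" using ev by metis
  obtain x where x: "\<And>i. cmod (x i) = 1" "\<And>i. pw (x i \<cdot> LX i) CARD('d) = mat 1"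
    using pauli_normalize[OF LX_pauli] by metis
  have "\<exists>c. cmod c = 1 \<and> x i \<cdot> LX i = c \<cdot> LX i" for i using x(1) by blast
  from shifted_eigenvectors[OF this x(2) v(2) \<zeta>(2), of UNIV]
  obtain u :: "('k, 'd) basis \<Rightarrow> _" where u0: "u 0 = v" and uS: "\<And>a. u a \<in> code_space S"
    and uX: "\<And>i a. (x i \<cdot> LX i) *v u a = u (a + 0(i := 1))"
    and uZ: "\<And>i a. LZ i *v u a = (\<zeta> i * chi (a i)) *s u a" by auto
  define V :: "complex ^ ('k, 'd) basis ^ ('q, 'd) basis" where "V = (\<chi> y a. u a $ y)"
  have V_nth: "(A ** V) $ y $ a = (A *v u a) $ y" for A y a
    by (simp add: V_def matrix_matrix_mult_def matrix_vector_mult_def)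
  have TV: "(x i \<cdot> LX i) ** V = 1 \<cdot> (V ** weyl (0(i := 1)) 0)" for i
    unfolding vec_eq_iff V_nth uX scal_nth mult_weyl_nth by (simp add: V_def)
  have ZV: "LZ i ** V = \<zeta> i \<cdot> (V ** weyl 0 (0(i := 1)))" for i
    unfolding vec_eq_iff V_nth uZ scal_nth mult_weyl_nth by (simp add: V_def mult_ac)
  have SV: "s ** V = V" if "s \<in> S" for s
    unfolding vec_eq_iff V_nth using uS that by (simp add: code_space_def V_def)
  define G where "G = adj V ** V"
  have "G ** weyl (0(i := 1)) 0 = weyl (0(i := 1)) 0 ** G" for i
    unfolding G_def
    by (rule gram_commutes[OF _ unitary_weyl TV]) (simp_all add: unitary_scal x is_pauli_unitary LX_pauli)
  moreover have "G ** weyl 0 (0(i := 1)) = weyl 0 (0(i := 1)) ** G" for i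
    unfolding G_def
    by (rule gram_commutes[OF _ unitary_weyl ZV]) (simp_all add: \<zeta> is_pauli_unitary LZ_pauli)
  ultimately obtain g where g: "G = g \<cdot> mat 1" using commutes_imp_scalar by blast
  define r where "r = (\<Sum>y\<in>UNIV. (cmod (v $ y))\<^sup>2)"
  have "g = G $ 0 $ 0" by (simp add: g mat_def)
  also have "\<dots> = (\<Sum>y\<in>UNIV. v $ y * cnj (v $ y))"
    by (simp add: G_def matrix_matrix_mult_def adj_def V_def u0 mult.commute)
  also have "\<dots> = complex_of_real r"
    by (simp only: r_def of_real_sum complex_norm_square)
  finally have gr: "g = complex_of_real r" .
  have "r > 0"
  proof -
    obtain y where "v $ y \<noteq> 0" using v(1) by (auto simp: vec_eq_iff)
    then have "0 < (cmod (v $ y))\<^sup>2" by simp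
    also have "\<dots> \<le> r" unfolding r_def by (rule member_le_sum) auto
    finally show ?thesis .
  qed
  \<comment> \<open>The inverse norm of v: the scalar g is the Gram entry at 0, which is the squared
    norm r of the column v.\<close>
  define k where "k = complex_of_real (1 / sqrt r)"
  have k: "cnj k * k * g = 1"
    using \<open>r > 0\<close> by (simp add: k_def gr flip: of_real_mult of_real_divide)
  define V1 where "V1 = k \<cdot> V"
  have iso: "adj V1 ** V1 = mat 1"
    using k by (simp add: V1_def g flip: G_def) (simp add: mult_ac)
  have "range ((*v) V1) = code_space S"
  proof (rule vec.subspace_dim_equal)
    show "vec.subspace (range ((*v) V1))"
      by (rule vec.linear_subspace_image[OF matrix_vector_mul_linear_gen vec.subspace_UNIV])
    show "range ((*v) V1) \<subseteq> code_space S"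
      by (auto simp: code_space_def matrix_vector_mul_assoc V1_def SV)
    have "inj ((*v) V1)"
      by (rule inj_on_inverseI[of _ "\<lambda>w. adj V1 *v w"]) (simp add: matrix_vector_mul_assoc iso)
    then have "vec.dim (range ((*v) V1)) = vec.dim (UNIV :: (complex ^ ('k, 'd) basis) set)"
      by (intro vec.dim_image_eq matrix_vector_mul_linear_gen) (auto intro: inj_on_subset)
    then show "vec.dim (code_space S) \<le> vec.dim (range ((*v) V1))"
      unfolding dim_code vec_dim_card by (simp add: card_fun)
  qed (rule code_space_subspace)
  moreover have "\<exists>c. cmod c = 1 \<and> V1 ** at_qudit i pauli_X = mat c ** LX i ** V1" for i
    using TV[of i] x(1)[of i] by (intro exI[of _ "x i"]) (simp add: V1_def at_qudit_X mat_mult_eq_scal)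
  moreover have "\<exists>c. cmod c = 1 \<and> V1 ** at_qudit i pauli_Z = mat c ** LZ i ** V1" for i
    using \<zeta>(1)[of i]
    by (intro exI[of _ "cnj (\<zeta> i)"])
      (simp add: V1_def at_qudit_Z mat_mult_eq_scal ZV mult.left_commute[of "cnj _"] cnj_mult_self)
  ultimately show ?thesis using iso unfolding logical_encoding_def by blast
qed

lemma logical_pauli_properties:
  shows is_pauli_logical_pauli: "is_pauli (logical_pauli LX LZ a b)"
    and logical_pauli_S: "s \<in> S \<Longrightarrow> s ** logical_pauli LX LZ a b = logical_pauli LX LZ a b ** s"
    and represents_logical_pauli: "logical_encoding S LX LZ V \<Longrightarrow>
      represents V (logical_pauli LX LZ a b) (\<lambda>i. of_nat (a i)) (\<lambda>i. of_nat (b i))"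
proof -
  define g where "g i = pw (LX i) (a i) ** pw (LZ i) (b i)" for i
  let ?F = "Finite_Set.fold (\<lambda>i P. g i ** P) (mat 1)"
  have L: "logical_pauli LX LZ a b = ?F UNIV"
    by (simp add: logical_pauli_def g_def pw_def)
  have g_comm: "C ** g i = g i ** C" if "C ** LX i = LX i ** C" "C ** LZ i = LZ i ** C" for C i
  proof -
    have "C ** g i = pw (LX i) (a i) ** (C ** pw (LZ i) (b i))"
      by (simp add: g_def matrix_mul_assoc pw_commute1[OF that(1)])
    then show ?thesis by (simp add: g_def matrix_mul_assoc pw_commute1[OF that(2)])
  qed
  \<comment> \<open>The factors must commute for \<open>Finite_Set.fold\<close> to be evaluated. X i
    and Z i themselves do not commute, but equal indices are trivial and distinct ones involve only
    commuting generators.\<close>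
  have gg: "g i ** g j = g j ** g i" for i j
  proof (cases "i = j")
    case False
    have X: "g i ** LX j = LX j ** g i"
      by (rule sym, rule g_comm) (use LZX[of i j] False in \<open>simp_all add: LXX[of i j]\<close>)
    have Z: "g i ** LZ j = LZ j ** g i"
      by (rule sym, rule g_comm) (use LZX[of j i] False in \<open>simp_all add: LZZ[of i j]\<close>)
    show ?thesis using g_comm[OF X Z] .
  qed simp
  interpret comp_fun_commute "\<lambda>i P. g i ** P"
    by unfold_locales (simp add: fun_eq_iff matrix_mul_assoc gg)
  have F: "is_pauli (?F B) \<and> (\<forall>s\<in>S. s ** ?F B = ?F B ** s) \<and>
    (\<forall>V. logical_encoding S LX LZ V \<longrightarrow> represents V (?F B)
      (\<lambda>i. if i \<in> B then of_nat (a i) else 0) (\<lambda>i. if i \<in> B then of_nat (b i) else 0))" for B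
  proof (induction B rule: finite_induct[OF finite])
    case 1
    have "represents V (mat 1) 0 0" for V :: "complex ^ ('k, 'd) basis ^ ('q, 'd) basis"
      by (rule represents_one) simp
    then show ?case by (simp add: is_pauli_one zero_fun_def)
  next
    case (2 i B)
    have ins: "?F (insert i B) = g i ** ?F B" using 2 by simp
    have "is_pauli (g i)"
      unfolding g_def by (intro is_pauli_mult is_pauli_pw LX_pauli LZ_pauli)
    moreover have "s ** (g i ** ?F B) = g i ** ?F B ** s" if s: "s \<in> S" for s
    proof -
      have "s ** (g i ** ?F B) = g i ** (s ** ?F B)"
        using g_comm[of s i] LX_S[OF s] LZ_S[OF s] by (simp add: matrix_mul_assoc)
      then show ?thesis using 2 s by (simp add: matrix_mul_assoc)
    qed
    moreover have "represents V (g i ** ?F B)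
      (\<lambda>j. if j \<in> insert i B then of_nat (a j) else 0) (\<lambda>j. if j \<in> insert i B then of_nat (b j) else 0)"
      if V: "logical_encoding S LX LZ V" for V
    proof -
      have "represents V (LX i) (0(i := 1)) (0(i := 0))" "represents V (LZ i) (0(i := 0)) (0(i := 1))"
        using logical_encodingD(4,5)[OF V] by (simp_all only: represents_def zero_upd_zero)
      from represents_mult[OF represents_pw[OF this(1)] represents_pw[OF this(2)], of "a i" "b i"]
      have "represents V (g i) (0(i := of_nat (a i) * 1) + 0(i := of_nat (b i) * 0))
        (0(i := of_nat (a i) * 0) + 0(i := of_nat (b i) * 1))"
        by (simp only: g_def)
      from represents_mult[OF this, of "?F B"] 2(3) V
      have *: "represents V (g i ** ?F B)
        (0(i := of_nat (a i) * 1) + 0(i := of_nat (b i) * 0) + (\<lambda>i. if i \<in> B then of_nat (a i) else 0))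
        (0(i := of_nat (a i) * 0) + 0(i := of_nat (b i) * 1) + (\<lambda>i. if i \<in> B then of_nat (b i) else 0))"
        by blast
      show ?thesis
        by (rule back_subst[of "\<lambda>x. x", OF *], rule arg_cong2[where f = "represents V (g i ** ?F B)"])
          (use 2(2) in \<open>auto simp: fun_eq_iff\<close>)
    qed
    ultimately show ?case using 2 by (simp only: ins is_pauli_mult) blast
  qed
  show "is_pauli (logical_pauli LX LZ a b)" using F[of UNIV] by (simp add: L)
  show "s ** logical_pauli LX LZ a b = logical_pauli LX LZ a b ** s" if "s \<in> S"
    using F[of UNIV] that by (simp add: L)
  show "represents V (logical_pauli LX LZ a b) (\<lambda>i. of_nat (a i)) (\<lambda>i. of_nat (b i))"
    if "logical_encoding S LX LZ V"
    using F[of UNIV] that by (simp add: L)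
qed

end

section \<open>Cosets of logical Paulis\<close>

lemma pauli_pauli_commute:
  assumes "is_pauli P" "is_pauli R"
  shows "\<exists>k. P ** R = k \<cdot> (R ** P)"
proof -
  obtain a c \<mu> where R: "R = \<mu> \<cdot> weyl a c" using assms(2) by (auto simp: is_pauli_def phase_eq_def)
  obtain k where "P ** weyl a c = k \<cdot> (weyl a c ** P)" using is_pauli_commute[OF assms(1)] by blast
  then show ?thesis by (intro exI[of _ k]) (simp add: R mult.commute)
qed

lemma trace_sum: "trace (\<Sum>i\<in>I. A i) = (\<Sum>i\<in>I. trace (A i))"
  for A :: "_ \<Rightarrow> complex ^ 'a ^ 'a"
  by (simp add: trace_def) (rule sum.swap)

lemma scal_eq_self: "A = k \<cdot> A \<Longrightarrow> k \<noteq> 1 \<Longrightarrow> A = 0"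
  by (auto simp: vec_eq_iff)

lemma r_coset_unitary_group: "S #>\<^bsub>unitary_group\<^esub> L = (\<lambda>s. s ** L) ` S"
  by (auto simp: r_coset_def unitary_group_def)

definition residue_rep :: "('k, 'd::nontriv) basis \<Rightarrow> 'k \<Rightarrow> nat"
  where "residue_rep a i = nat (to_int_mod_ring (a i))"

lemma residue_rep_simps [simp]:
  "of_nat (residue_rep a i) = a i" "residue_rep (a :: ('k, 'd::nontriv) basis) i < CARD('d)"
  using to_int_mod_ring_nonneg[of "a i"]
  by (simp_all add: residue_rep_def of_nat_to_int_mod_ring nat_less_iff)

lemma residue_rep_0: "residue_rep a i = 0 \<Longrightarrow> a i = 0"
  by (metis residue_rep_simps(1) of_nat_0)

lemma finite_nontrivial_logical_paulis: "finite (nontrivial_logical_paulis S LX (LZ :: 'k::finite \<Rightarrow> ('q::finite, 'd::nontriv) op))"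
proof -
  let ?A = "PiE (UNIV :: 'k set) (\<lambda>_. {..<CARD('d)})"
  have "nontrivial_logical_paulis S LX LZ
      \<subseteq> (\<lambda>(a, b). S #>\<^bsub>unitary_group\<^esub> logical_pauli LX LZ a b) ` (?A \<times> ?A)"
    by (auto simp: nontrivial_logical_paulis_def)
  moreover have "finite (?A \<times> ?A)" by (intro finite_cartesian_product finite_PiE) auto
  ultimately show ?thesis by (meson finite_imageI finite_subset)
qed

section \<open>Distances of cosets and detection of Paulis with small support\<close>

context pauli_code
begin

abbreviation nontrivial :: "('q, 'd) op set set"
  where "nontrivial \<equiv> nontrivial_logical_paulis S LX LZ"

lemma coset_mem_nontrivial:
  fixes a c :: "('k, 'd) basis"
  assumes "a \<noteq> 0 \<or> c \<noteq> 0"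
  shows "(\<lambda>s. s ** logical_pauli LX LZ (residue_rep a) (residue_rep c)) ` S \<in> nontrivial"
proof -
  have ex: "\<exists>i. residue_rep a i \<noteq> 0 \<or> residue_rep c i \<noteq> 0"
    using assms by (metis ext residue_rep_0 zero_fun_apply)
  show ?thesis
    unfolding nontrivial_logical_paulis_def r_coset_unitary_group
    by (rule CollectI, rule exI[of _ "residue_rep a"], rule exI[of _ "residue_rep c"]) (use ex in simp)
qed

lemma nontrivial_coset:
  assumes "G \<in> nontrivial"
  obtains a b where "G = (\<lambda>s. s ** logical_pauli LX LZ a b) ` S"
  using assms by (auto simp: nontrivial_logical_paulis_def r_coset_unitary_group)

lemma nontrivial_finite: "G \<in> nontrivial \<Longrightarrow> finite G"
  and nontrivial_nonempty: "G \<in> nontrivial \<Longrightarrow> G \<noteq> {}"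
  and nontrivial_card: "G \<in> nontrivial \<Longrightarrow> card G \<le> card S"
  and nontrivial_pauli: "G \<in> nontrivial \<Longrightarrow> g \<in> G \<Longrightarrow> is_pauli g"
  using finite_S one_mem
  by (auto elim!: nontrivial_coset intro: card_image_le is_pauli_mult S_pauli is_pauli_logical_pauli)

lemma min_distance_le:
  assumes "G \<in> nontrivial" "g \<in> G"
  shows "min_distance Q S LX LZ \<le> card (supp Q g)"
proof -
  have "min_distance Q S LX LZ \<le> coset_distance Q G"
    unfolding min_distance_def
    using finite_nontrivial_logical_paulis assms by (intro Min_le) auto
  also have "\<dots> \<le> card (supp Q g)"
    unfolding coset_distance_def using nontrivial_finite assms by (intro Min_le) auto
  finally show ?thesis .
qed

lemma ex_le_max_distance:
  assumes "G \<in> nontrivial"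
  shows "\<exists>g\<in>G. card (supp Q g) \<le> max_distance Q S LX LZ"
proof -
  have "coset_distance Q G \<in> (\<lambda>g. card (supp Q g)) ` G"
    unfolding coset_distance_def using nontrivial_finite nontrivial_nonempty assms
    by (intro Min_in) auto
  moreover have "coset_distance Q G \<le> max_distance Q S LX LZ"
    unfolding max_distance_def
    using finite_nontrivial_logical_paulis assms by (intro Max_ge) auto
  ultimately show ?thesis by auto
qed

lemma min_distance_le_max_distance: "min_distance Q S LX LZ \<le> max_distance Q S LX LZ"
proof -
  \<comment> \<open>Any non-trivial logical Pauli will do; the one with all exponents equal to 1 is
    picked.\<close>
  have "(1 :: ('k, 'd) basis) \<noteq> 0" by (simp add: fun_eq_iff)
  then obtain G where G: "G \<in> nontrivial" using coset_mem_nontrivial by blast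
  then obtain g where "g \<in> G" "card (supp Q g) \<le> max_distance Q S LX LZ"
    using ex_le_max_distance by blast
  then show ?thesis using min_distance_le[OF G] le_trans by blast
qed

text \<open>
  If \<open>P\<close> fixes the code space, then \<open>P ** proj\<close> has non-zero trace, so that some \<open>P ** s\<close> has
  non-zero trace and is therefore a scalar.
\<close>

lemma fixes_code_imp_stabilizer:
  assumes V: "logical_encoding S LX LZ V" and P: "is_pauli P" and PV: "P ** V \<simeq> V"
  shows "\<exists>s\<in>S. P \<simeq> s"
proof -
  obtain k where k: "cmod k = 1" "P ** V = k \<cdot> V" using PV by (auto simp: phase_eq_def)
  have absorb: "V ** adj V ** proj = proj"
    by (rule encoding_absorb[OF V]) (rule proj_absorb)
  have projV: "proj ** V = V"
    by (rule proj_eqI) (rule logical_encodingD(3)[OF V])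
  have "trace proj = trace (V ** (adj V ** proj))"
    by (simp only: matrix_mul_assoc absorb)
  also have "\<dots> = trace (adj V ** V)"
    by (subst trace_mul_sym) (simp add: projV flip: matrix_mul_assoc)
  finally have tr: "trace proj \<noteq> 0"
    by (simp add: logical_encodingD(1)[OF V] trace_I)
  have "P ** proj = (P ** V) ** (adj V ** proj)"
    by (simp only: absorb flip: matrix_mul_assoc) (simp only: absorb matrix_mul_assoc)
  also have "\<dots> = k \<cdot> (V ** adj V ** proj)"
    by (simp add: k(2) matrix_mul_assoc)
  finally have "trace (P ** proj) \<noteq> 0"
    using tr k(1) by (auto simp: absorb)
  moreover have "trace (P ** proj) = 1 / of_nat (card S) * (\<Sum>s\<in>S. trace (P ** s))"
    by (simp add: proj_def matrix_mult_sum_right trace_sum)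
  ultimately have "(\<Sum>s\<in>S. trace (P ** s)) \<noteq> 0" by auto
  then have "\<exists>s\<in>S. trace (P ** s) \<noteq> 0" by (rule contrapos_np) (simp add: sum.neutral)
  then obtain s where s: "s \<in> S" "trace (P ** s) \<noteq> 0" by blast
  obtain a c where ac: "P ** s \<simeq> weyl a c"
    using is_pauli_mult[OF P S_pauli[OF s(1)]] by (auto simp: is_pauli_def)
  then obtain \<mu> where "P ** s = \<mu> \<cdot> weyl a c" by (auto simp: phase_eq_def)
  then have "a = 0 \<and> c = 0" using s(2) by (simp add: trace_weyl split: if_splits)
  then have "P ** s ** adj s \<simeq> mat 1 ** adj s" using ac by (intro phase_eq_mult) auto
  then have "P \<simeq> adj s"
    using S_unitary[OF s(1)] by (simp add: unitary_cancel flip: matrix_mul_assoc)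
  then show ?thesis using adj_mem[OF s(1)] by blast
qed

text \<open>The error-detection property. If P fails to commute with some stabilizer, its
  compression vanishes. Otherwise P preserves the code and acts there as a logical Pauli; a
  non-trivial one would put P, up to phase, into a non-trivial coset, and its support would have at
  least d_down parts.\<close>

lemma small_support_scalar:
  assumes P: "is_pauli P" and small: "card (supp Q P) < min_distance Q S LX LZ"
  shows "\<exists>c. proj ** P ** proj = c \<cdot> proj"
proof (cases "\<forall>s\<in>S. P ** s = s ** P")
  case False
  then obtain s where s: "s \<in> S" "P ** s \<noteq> s ** P" by blast
  obtain \<beta> where \<beta>: "P ** s = \<beta> \<cdot> (s ** P)" using pauli_pauli_commute[OF P S_pauli[OF s(1)]] by blast
  have "proj ** P ** proj = proj ** (P ** s) ** proj"
    by (simp only: proj_absorb[OF s(1)] flip: matrix_mul_assoc)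
  also have "\<dots> = \<beta> \<cdot> ((proj ** s) ** P ** proj)"
    by (simp add: \<beta> matrix_mul_assoc)
  also have "\<dots> = \<beta> \<cdot> (proj ** P ** proj)"
    by (simp only: proj_absorb[OF s(1)])
  finally have "proj ** P ** proj = \<beta> \<cdot> (proj ** P ** proj)" .
  moreover have "\<beta> \<noteq> 1" using \<beta> s(2) by auto
  ultimately have "proj ** P ** proj = 0" by (rule scal_eq_self)
  then show ?thesis by (intro exI[of _ 0]) simp
next
  case comm: True
  obtain V where V: "logical_encoding S LX LZ V" using encoding_exists by blast
  note iso = logical_encodingD(1)[OF V]
  define W where "W = adj V ** P ** V"
  have VW: "V ** W = P ** V"
  proof -
    have "V ** adj V ** (P ** V) = P ** V"
    proof (rule encoding_absorb[OF V])
      fix s assume s: "s \<in> S"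
      have "s ** (P ** V) = P ** (s ** V)" using comm s by (simp add: matrix_mul_assoc)
      then show "s ** (P ** V) = P ** V" by (simp add: logical_encodingD(3)[OF V s])
    qed
    then show ?thesis by (simp add: W_def matrix_mul_assoc)
  qed
  have UP: "unitary P" by (rule is_pauli_unitary[OF P])
  have "adj W ** W = adj V ** (adj P ** (V ** W))"
    by (simp add: W_def[of] adj_mult flip: matrix_mul_assoc)
  also have "\<dots> = mat 1"
    using UP by (simp add: VW unitary_cancel iso)
  finally have WW: "adj W ** W = mat 1" .
  then have UW: "unitary W" using matrix_left_right_inverse by (auto simp: unitary_def)
  \<comment> \<open>W inherits from P the commutation scalars with the logical generators, and these
    make it a Pauli on the logical qudits.\<close>
  have key: "\<exists>k. W ** weyl a c = k \<cdot> (weyl a c ** W)"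
    if L: "is_pauli L" "L ** V \<simeq> V ** weyl a c" for L a c
  proof -
    obtain \<beta> where \<beta>: "P ** L = \<beta> \<cdot> (L ** P)" using pauli_pauli_commute[OF P L(1)] by blast
    obtain l where l: "cmod l = 1" "L ** V = l \<cdot> (V ** weyl a c)" using L(2) by (auto simp: phase_eq_def)
    have 1: "V ** weyl a c = cnj l \<cdot> (L ** V)" using l(1) by (simp add: l(2) cnj_mult_self)
    have "V ** (W ** weyl a c) = P ** (V ** weyl a c)"
      by (simp add: VW matrix_mul_assoc)
    also have "\<dots> = (cnj l * \<beta>) \<cdot> (L ** (V ** W))"
      by (simp add: 1 VW \<beta> matrix_mul_assoc)
    also have "\<dots> = \<beta> \<cdot> (V ** (weyl a c ** W))"
      using l(1) by (simp add: matrix_mul_assoc l(2) mult_ac cnj_mult_self)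
    finally have "adj V ** (V ** (W ** weyl a c)) = adj V ** (\<beta> \<cdot> (V ** (weyl a c ** W)))" by simp
    then have "W ** weyl a c = \<beta> \<cdot> (weyl a c ** W)"
      by (simp only: scal_simps matrix_mul_assoc iso matrix_mul_lid)
    then show ?thesis by blast
  qed
  have "is_pauli W"
    by (rule commutes_up_to_scalar_imp_pauli[OF UW])
      (rule key[OF LX_pauli logical_encodingD(4)[OF V]] key[OF LZ_pauli logical_encodingD(5)[OF V]])+
  then obtain a c where ac: "W \<simeq> weyl a c" by (auto simp: is_pauli_def)
  have PVac: "P ** V \<simeq> V ** weyl a c"
    unfolding VW[symmetric] by (intro phase_eq_mult ac phase_eq_refl)
  \<comment> \<open>h is the logical Pauli with the same action as P, so \<open>adj h ** P\<close>
    fixes the code up to phase and is a stabilizer up to phase; this places P in the coset of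
    h.\<close>
  define h where "h = logical_pauli LX LZ (residue_rep a) (residue_rep c)"
  have hV: "h ** V \<simeq> V ** weyl a c"
    using represents_logical_pauli[OF V, of "residue_rep a" "residue_rep c"]
    by (simp add: represents_def h_def)
  have h: "is_pauli h" by (simp add: h_def is_pauli_logical_pauli)
  have "adj h ** P ** V \<simeq> V"
  proof -
    have "P ** V \<simeq> h ** V" using PVac phase_eq_sym[OF hV] by (rule phase_eq_trans)
    then have "adj h ** (P ** V) \<simeq> adj h ** (h ** V)" by (rule phase_eq_mult[OF phase_eq_refl])
    then show ?thesis using is_pauli_unitary[OF h] by (simp add: unitary_cancel flip: matrix_mul_assoc)
  qed
  then obtain s where s: "s \<in> S" "adj h ** P \<simeq> s"
    using fixes_code_imp_stabilizer[OF V is_pauli_mult[OF is_pauli_adj[OF h] P]] by blast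
  have "h ** (adj h ** P) \<simeq> h ** s" using s(2) by (intro phase_eq_mult phase_eq_refl)
  then have Psh: "P \<simeq> s ** h"
    using is_pauli_unitary[OF h] logical_pauli_S[OF s(1)] by (simp add: unitary_cancel h_def)
  show ?thesis
  proof (cases "a = 0 \<and> c = 0")
    case True
    then have "P ** V \<simeq> V" using PVac by simp
    then obtain k where k: "P ** V = k \<cdot> V" by (auto simp: phase_eq_def)
    have absorb: "V ** adj V ** proj = proj"
      by (rule encoding_absorb[OF V]) (rule proj_absorb)
    have Pproj: "P ** proj = k \<cdot> proj"
    proof -
      have "P ** (V ** adj V ** proj) = k \<cdot> (V ** adj V ** proj)"
        by (simp add: matrix_mul_assoc k)
      then show ?thesis by (simp only: absorb)
    qed
    have "proj ** P ** proj = k \<cdot> (proj ** proj)"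
      by (simp add: Pproj flip: matrix_mul_assoc)
    also have "proj ** proj = proj" by (rule proj_eqI) (rule proj_absorb)
    finally show ?thesis by blast
  next
    case False
    then have "(\<lambda>s. s ** h) ` S \<in> nontrivial" unfolding h_def by (intro coset_mem_nontrivial) blast
    then have "min_distance Q S LX LZ \<le> card (supp Q (s ** h))"
      using s(1) by (intro min_distance_le) auto
    then show ?thesis using small supp_phase_eq[OF Psh, of Q] by simp
  qed
qed

end

section \<open>Several codeblocks\<close>

text \<open>The tensor product over the blocks. Rectangular factors are allowed so that encodings
  can be tensored as well.\<close>

definition tens :: "('b::finite \<Rightarrow> complex ^ ('k::finite, 'd::nontriv) basis ^ ('q::finite, 'd) basis)
    \<Rightarrow> complex ^ ('b \<times> 'k, 'd) basis ^ ('b \<times> 'q, 'd) basis"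
  where "tens f = (\<chi> x y. \<Prod>b\<in>UNIV. f b $ (\<lambda>q. x (b, q)) $ (\<lambda>q. y (b, q)))"

lemma tens_nth: "tens f $ x $ y = (\<Prod>b\<in>UNIV. f b $ (\<lambda>q. x (b, q)) $ (\<lambda>q. y (b, q)))"
  by (simp add: tens_def)

text \<open>A basis state of the whole register is a family of basis states of the blocks, so this
  is the distributive law.\<close>

lemma sum_prod_blocks:
  fixes h :: "'b::finite \<Rightarrow> ('q::finite \<Rightarrow> 'c::finite) \<Rightarrow> 'e::comm_semiring_1"
  shows "(\<Sum>z\<in>UNIV. \<Prod>b\<in>UNIV. h b (\<lambda>q. z (b, q))) = (\<Prod>b\<in>UNIV. \<Sum>w\<in>UNIV. h b w)"
proof -
  have "(\<Prod>b\<in>UNIV. \<Sum>w\<in>UNIV. h b w) = (\<Sum>g\<in>UNIV. \<Prod>b\<in>UNIV. h b (g b))"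
    using prod_sum_PiE[of UNIV "\<lambda>_. UNIV" h] by simp
  also have "\<dots> = (\<Sum>z\<in>UNIV. \<Prod>b\<in>UNIV. h b (\<lambda>q. z (b, q)))"
    by (rule sum.reindex_bij_witness[of _ "\<lambda>z b q. z (b, q)" "\<lambda>g (b, q). g b q"]) auto
  finally show ?thesis by (rule sym)
qed

lemma tens_mult:
  fixes f :: "'b::finite \<Rightarrow> complex ^ ('k::finite, 'd::nontriv) basis ^ ('q::finite, 'd) basis"
  shows "tens f ** tens g = tens (\<lambda>b. f b ** g b)"
proof -
  have "(tens f ** tens g) $ x $ y = tens (\<lambda>b. f b ** g b) $ x $ y" for x y
    unfolding tens_nth matrix_matrix_mult_def vec_lambda_beta prod.distrib[symmetric]
    by (rule sum_prod_blocks)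
  then show ?thesis unfolding vec_eq_iff by blast
qed

lemma prod_if_distrib:
  "finite A \<Longrightarrow> (\<Prod>b\<in>A. if P b then f b else 0) = (if \<forall>b\<in>A. P b then \<Prod>b\<in>A. f b else (0 :: 'a::comm_semiring_1))"
  by (induction A rule: finite_induct) auto

lemma tens_one: "tens (\<lambda>_. mat 1) = mat 1"
proof -
  have "(\<forall>b. (\<lambda>q. x (b, q)) = (\<lambda>q. y (b, q))) \<longleftrightarrow> x = y" for x y :: "'a \<times> 'b \<Rightarrow> 'c mod_ring"
    by (auto simp: fun_eq_iff)
  then show ?thesis
    by (simp add: vec_eq_iff tens_nth mat_def prod_if_distrib)
qed

lemma adj_tens: "adj (tens f) = tens (\<lambda>b. adj (f b))"
  by (simp add: vec_eq_iff tens_nth adj_def)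

lemma tens_scal: "tens (\<lambda>b. k b \<cdot> f b) = (\<Prod>b\<in>UNIV. k b) \<cdot> tens f"
  by (simp add: vec_eq_iff tens_nth prod.distrib)

lemma tens_scal_single:
  assumes "\<And>b'. b' \<noteq> b \<Longrightarrow> g b' = f b'" "g b = k \<cdot> f b"
  shows "tens g = k \<cdot> tens f"
proof -
  have "g = (\<lambda>b'. (if b' = b then k else 1) \<cdot> f b')" using assms by (auto simp: fun_eq_iff)
  then have "tens g = (\<Prod>b'\<in>UNIV. if b' = b then k else 1) \<cdot> tens f" by (simp only: tens_scal)
  then show ?thesis by simp
qed

lemma chi_sum: "chi (\<Sum>i\<in>I. f i) = (\<Prod>i\<in>I. chi (f i))"
  by (induction I rule: infinite_finite_induct) (simp_all add: chi_add)

lemma dot_blocks: "dot c y = (\<Sum>b\<in>UNIV. dot (\<lambda>q. c (b, q)) (\<lambda>q. y (b, q)))"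
  unfolding dot_def by (simp add: sum.cartesian_product)

text \<open>Shifts act blockwise and \<open>dot\<close> is a sum over the blocks, so the character
  factors.\<close>

lemma weyl_eq_tens: "weyl a c = tens (\<lambda>b. weyl (\<lambda>q. a (b, q)) (\<lambda>q. c (b, q)))"
proof -
  have "(\<forall>b. (\<lambda>q. x (b, q)) = (\<lambda>q. y (b, q)) + (\<lambda>q. a (b, q))) \<longleftrightarrow> x = y + a" for x y
    by (auto simp: fun_eq_iff)
  then show ?thesis
    by (simp add: vec_eq_iff tens_nth weyl_nth prod_if_distrib dot_blocks[of c] chi_sum)
qed

definition agree_off :: "'b \<Rightarrow> ('b \<times> 'q \<Rightarrow> 'c) \<Rightarrow> ('b \<times> 'q \<Rightarrow> 'c) \<Rightarrow> bool"
  where "agree_off b x y \<longleftrightarrow> (\<forall>b'\<in>UNIV - {b}. (\<lambda>q. x (b', q)) = (\<lambda>q. y (b', q)))"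

lemma on_block_nth:
  "on_block b A $ x $ y = (if agree_off b x y then A $ (\<lambda>q. x (b, q)) $ (\<lambda>q. y (b, q)) else 0)"
proof -
  have "(\<forall>q. q \<notin> {b} \<times> UNIV \<longrightarrow> x q = y q) \<longleftrightarrow> agree_off b x y"
    by (auto simp: fun_eq_iff agree_off_def)
  then show ?thesis by (simp only: on_block_def local_op_def vec_lambda_beta restrict_apply) simp
qed

lemma on_block_eq_tens: "on_block b A = tens (\<lambda>b'. if b' = b then A else mat 1)"
proof -
  have "tens (\<lambda>b'. if b' = b then A else mat 1) $ x $ y = on_block b A $ x $ y" for x y
  proof -
    have "tens (\<lambda>b'. if b' = b then A else mat 1) $ x $ y = A $ (\<lambda>q. x (b, q)) $ (\<lambda>q. y (b, q)) *
       (\<Prod>b'\<in>UNIV - {b}. (if b' = b then A else mat 1) $ (\<lambda>q. x (b', q)) $ (\<lambda>q. y (b', q)))"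
      unfolding tens_nth by (subst prod.remove[of UNIV b]) auto
    also have "(\<Prod>b'\<in>UNIV - {b}. (if b' = b then A else mat 1) $ (\<lambda>q. x (b', q)) $ (\<lambda>q. y (b', q)))
      = (\<Prod>b'\<in>UNIV - {b}. if (\<lambda>q. x (b', q)) = (\<lambda>q. y (b', q)) then 1 else 0)"
      by (rule prod.cong) (auto simp: mat_def)
    also have "\<dots> = (if agree_off b x y then 1 else 0)"
      unfolding agree_off_def by (subst prod_if_distrib) auto
    finally show ?thesis by (simp add: on_block_nth)
  qed
  then show ?thesis by (simp add: vec_eq_iff)
qed

lemma on_block_mult: "on_block b (A ** B) = on_block b A ** on_block b B"
  unfolding on_block_eq_tens tens_mult by (rule arg_cong[where f = tens]) auto

lemma adj_on_block: "adj (on_block b A) = on_block b (adj A)"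
  unfolding on_block_eq_tens adj_tens by (rule arg_cong[where f = tens]) auto

lemma on_block_one: "on_block b (mat 1) = mat 1"
  by (simp add: on_block_eq_tens tens_one)

lemma unitary_on_block: "unitary A \<Longrightarrow> unitary (on_block b A)"
  by (simp add: unitary_def adj_on_block on_block_one flip: on_block_mult)

lemma on_block_scal: "on_block b (k \<cdot> A) = k \<cdot> on_block b A"
  by (simp add: vec_eq_iff on_block_nth)

lemma on_block_sum: "on_block b (\<Sum>i\<in>I. A i) = (\<Sum>i\<in>I. on_block b (A i))"
  by (simp add: vec_eq_iff on_block_nth)

definition at_block :: "'b \<Rightarrow> ('q, 'd) basis \<Rightarrow> ('b \<times> 'q, 'd::nontriv) basis"
  where "at_block b a = (\<lambda>(b', q). if b' = b then a q else 0)"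

lemma on_block_weyl: "on_block b (weyl a c) = weyl (at_block b a) (at_block b c)"
  unfolding on_block_eq_tens weyl_eq_tens
proof (rule arg_cong[where f = tens], rule ext)
  fix b'
  show "(if b' = b then weyl a c else mat 1)
    = weyl (\<lambda>q. at_block b a (b', q)) (\<lambda>q. at_block b c (b', q))"
    using weyl_0[where 'a = 'b and 'b = 'c] by (auto simp: at_block_def zero_fun_def)
qed

lemma at_block_single: "at_block b (0(i := t)) = 0((b, i) := t)"
  by (auto simp: at_block_def fun_eq_iff)

text \<open>The tensor power of A is the product of its copies on the individual blocks, each of
  which fixes v.\<close>

lemma tens_fixed:
  assumes "\<And>b. on_block b A *v v = v"
  shows "tens (\<lambda>_. A) *v v = v"
proof -
  have "tens (\<lambda>b. if b \<in> B then A else mat 1) *v v = v" for B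
  proof (induction B rule: finite_induct[OF finite])
    case 1
    show ?case by (simp add: tens_one)
  next
    case (2 b B)
    have "tens (\<lambda>b'. if b' \<in> insert b B then A else mat 1)
        = on_block b A ** tens (\<lambda>b. if b \<in> B then A else mat 1)"
      unfolding on_block_eq_tens tens_mult by (rule arg_cong[where f = tens]) (use 2(2) in auto)
    then show ?case by (simp add: 2 assms flip: matrix_vector_mul_assoc)
  qed
  from this[of UNIV] show ?thesis by simp
qed

lemma on_block_fixes_code:
  assumes "v \<in> code_space (blocks_stabilizer S)" "s \<in> S"
  shows "on_block b s *v v = v"
proof -
  have "on_block b s \<in> blocks_stabilizer S"
    unfolding blocks_stabilizer_def using assms(2) by (intro generate.incl) blast
  then show ?thesis using assms(1) by (simp add: code_space_def)
qed

lemma code_space_blocksI: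
  assumes adj_mem: "\<And>s. s \<in> S \<Longrightarrow> adj s \<in> S" and U: "\<And>s. s \<in> S \<Longrightarrow> unitary s"
    and v: "\<And>b s. s \<in> S \<Longrightarrow> on_block b s *v v = v"
  shows "v \<in> code_space (blocks_stabilizer S)"
proof -
  have "h *v v = v" if "h \<in> blocks_stabilizer S" for h
    using that unfolding blocks_stabilizer_def
  proof (induction rule: generate.induct)
    case one
    show ?case by (simp add: unitary_group_def)
  next
    case (incl h)
    then show ?case using v by auto
  next
    case (inv h)
    then obtain b s where "s \<in> S" "h = on_block b s" by auto
    then show ?case
      using U by (simp add: inv_unitary_group unitary_on_block adj_on_block v adj_mem)
  next
    case (eng h1 h2)
    then show ?case by (simp add: unitary_group_def flip: matrix_vector_mul_assoc)
  qed
  then show ?thesis by (simp add: code_space_def)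
qed

section \<open>The joint code of all blocks: encoding and operators of small support\<close>

context pauli_code
begin

lemma tens_proj_fixes:
  assumes "v \<in> code_space (blocks_stabilizer S)"
  shows "tens (\<lambda>_. proj) *v v = v"
proof (rule tens_fixed)
  fix b
  have "on_block b proj *v v = (1 / of_nat (card S)) *s (\<Sum>s\<in>S. on_block b s *v v)"
    by (simp only: proj_def on_block_scal on_block_sum scal_mult_vec sum_mult_vec)
  also have "(\<Sum>s\<in>S. on_block b s *v v) = (\<Sum>s\<in>S. v)"
    using on_block_fixes_code[OF assms] by (intro sum.cong) auto
  also have "\<dots> = of_nat (card S) *s v"
    unfolding vec_eq_iff sum_component vector_smult_component by simp
  finally show "on_block b proj *v v = v"
    using card_S_nonzero by (simp add: vector_smult_assoc)
qed

lemma blocks_encoding: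
  assumes V: "logical_encoding S LX LZ V"
  shows "logical_encoding (blocks_stabilizer S :: ('b::finite \<times> 'q, 'd) op set)
    (blocks_logical LX) (blocks_logical LZ) (tens (\<lambda>_. V))"
proof -
  define W :: "complex ^ ('b \<times> 'k, 'd) basis ^ ('b \<times> 'q, 'd) basis" where "W = tens (\<lambda>_. V)"
  have W_block: "on_block b A ** W = tens (\<lambda>b'. if b' = b then A ** V else V)" for b A
    unfolding W_def on_block_eq_tens tens_mult by (rule arg_cong[where f = tens]) auto
  have block_W: "W ** on_block b A = tens (\<lambda>b'. if b' = b then V ** A else V)" for b A
    unfolding W_def on_block_eq_tens tens_mult by (rule arg_cong[where f = tens]) auto
  have "adj W ** W = mat 1"
    by (simp add: W_def adj_tens tens_mult logical_encodingD(1)[OF V] tens_one)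
  moreover have "range ((*v) W) = code_space (blocks_stabilizer S)"
  proof (intro equalityI subsetI)
    fix v assume "v \<in> range ((*v) W)"
    then obtain w where v: "v = W *v w" by blast
    show "v \<in> code_space (blocks_stabilizer S)"
    proof (rule code_space_blocksI)
      fix b :: 'b and s assume "s \<in> S"
      then have "s ** V = V" by (rule logical_encodingD(3)[OF V])
      then have "on_block b s ** W = W"
        unfolding W_block by (simp only: if_cancel W_def)
      then show "on_block b s *v v = v" by (simp add: v matrix_vector_mul_assoc)
    qed (simp_all add: adj_mem S_unitary)
  next
    fix v :: "('b \<times> 'q, 'd) state" assume v: "v \<in> code_space (blocks_stabilizer S)"
    \<comment> \<open>For surjectivity: a vector of the joint code is fixed by the tensor power of
      \<open>proj\<close>, which is absorbed by the projection W adj W.\<close>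
    have "V ** adj V ** proj = proj" by (rule encoding_absorb[OF V]) (rule proj_absorb)
    then have "W ** adj W ** tens (\<lambda>_. proj) = tens (\<lambda>_. proj)"
      by (simp add: W_def adj_tens tens_mult)
    then have "(W ** adj W ** tens (\<lambda>_. proj)) *v v = v"
      by (simp only: tens_proj_fixes[OF v])
    then have "W *v (adj W *v v) = v"
      by (simp only: tens_proj_fixes[OF v] flip: matrix_vector_mul_assoc)
    then show "v \<in> range ((*v) W)" by (metis rangeI)
  qed
  moreover have "\<exists>c. cmod c = 1 \<and> W ** at_qudit p pauli_X = mat c ** blocks_logical LX p ** W" for p
  proof -
    obtain b i where p: "p = (b, i)" by (cases p)
    obtain c where c: "cmod c = 1" "V ** weyl (0(i := 1)) 0 = c \<cdot> (LX i ** V)"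
      using phase_eq_sym[OF logical_encodingD(4)[OF V, of i]] by (auto simp: phase_eq_def)
    have "at_qudit p pauli_X = on_block b (weyl (0(i := 1)) (0(i := 0)))"
      unfolding on_block_weyl at_block_single by (simp only: at_qudit_X p zero_upd_zero)
    then have at: "at_qudit p pauli_X = on_block b (weyl (0(i := 1)) 0)" by (simp only: zero_upd_zero)
    have "W ** at_qudit p pauli_X = c \<cdot> (on_block b (LX i) ** W)"
      unfolding at block_W W_block by (rule tens_scal_single[of b]) (simp_all add: c)
    then show ?thesis
      using c(1) by (intro exI[of _ c]) (simp add: p blocks_logical_def mat_mult_eq_scal)
  qed
  moreover have "\<exists>c. cmod c = 1 \<and> W ** at_qudit p pauli_Z = mat c ** blocks_logical LZ p ** W" for p
  proof -
    obtain b i where p: "p = (b, i)" by (cases p)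
    obtain c where c: "cmod c = 1" "V ** weyl 0 (0(i := 1)) = c \<cdot> (LZ i ** V)"
      using phase_eq_sym[OF logical_encodingD(5)[OF V, of i]] by (auto simp: phase_eq_def)
    have "at_qudit p pauli_Z = on_block b (weyl (0(i := 0)) (0(i := 1)))"
      unfolding on_block_weyl at_block_single by (simp only: at_qudit_Z p zero_upd_zero)
    then have at: "at_qudit p pauli_Z = on_block b (weyl 0 (0(i := 1)))" by (simp only: zero_upd_zero)
    have "W ** at_qudit p pauli_Z = c \<cdot> (on_block b (LZ i) ** W)"
      unfolding at block_W W_block by (rule tens_scal_single[of b]) (simp_all add: c)
    then show ?thesis
      using c(1) by (intro exI[of _ c]) (simp add: p blocks_logical_def mat_mult_eq_scal)
  qed
  ultimately have "logical_encoding (blocks_stabilizer S) (blocks_logical LX) (blocks_logical LZ) W"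
    unfolding logical_encoding_def by blast
  then show ?thesis by (simp only: W_def)
qed

text \<open>Expand K in Weyl operators. A surviving term, viewed in block b, is supported inside the
  image of supp K under \<open>\<sigma> b\<close>. Each block separately sees fewer than d_down
  parts, so no factor r is lost, and the term compresses to a product of scalars.\<close>

lemma small_support_acts_as_scalar:
  fixes K :: "('b::finite \<times> 'q, 'd) op" and Q :: "'p::finite \<Rightarrow> 'q set"
  assumes \<sigma>: "\<And>b. bij (\<sigma> b)"
    and K: "\<And>v. v \<in> code_space (blocks_stabilizer S) \<Longrightarrow> K *v v \<in> code_space (blocks_stabilizer S)"
    and small: "card (supp (blocks_partition \<sigma> Q) K) < min_distance Q S LX LZ"
  shows "\<exists>c. \<forall>v\<in>code_space (blocks_stabilizer S). K *v v = c *s v"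
proof -
  let ?R = "supp (blocks_partition \<sigma> Q) K"
  let ?P = "tens (\<lambda>_. proj) :: ('b \<times> 'q, 'd) op"
  have "\<exists>k. ?P ** (weyl_coeff K a c \<cdot> weyl a c) ** ?P = k \<cdot> ?P" for a c
  proof (cases "weyl_coeff K a c = 0")
    case True
    then show ?thesis by (intro exI[of _ 0]) simp
  next
    case False
    have "\<exists>k. proj ** weyl (\<lambda>q. a (b, q)) (\<lambda>q. c (b, q)) ** proj = k \<cdot> proj" for b
    proof (rule small_support_scalar[OF is_pauli_weyl])
      have "supp Q (weyl (\<lambda>q. a (b, q)) (\<lambda>q. c (b, q))) \<subseteq> \<sigma> b ` ?R"
      proof
        fix j assume "j \<in> supp Q (weyl (\<lambda>q. a (b, q)) (\<lambda>q. c (b, q)))"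
        then obtain q where q: "q \<in> Q j" "a (b, q) \<noteq> 0 \<or> c (b, q) \<noteq> 0" by (auto simp: supp_weyl)
        obtain i where i: "j = \<sigma> b i" using \<sigma>[of b] by (metis bij_pointE)
        have "i \<in> ?R"
        proof (rule ccontr)
          assume "i \<notin> ?R"
          then have "acts_only_on K (- blocks_partition \<sigma> Q i)" by (simp add: supp_def)
          moreover have "(b, q) \<notin> - blocks_partition \<sigma> Q i"
            using q i by (auto simp: blocks_partition_def)
          ultimately show False using weyl_coeff_acts_only_on False q(2) by blast
        qed
        then show "j \<in> \<sigma> b ` ?R" using i by blast
      qed
      then have "card (supp Q (weyl (\<lambda>q. a (b, q)) (\<lambda>q. c (b, q)))) \<le> card ?R"
        by (meson card_image_le card_mono finite finite_imageI le_trans)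
      then show "card (supp Q (weyl (\<lambda>q. a (b, q)) (\<lambda>q. c (b, q)))) < min_distance Q S LX LZ"
        using small by simp
    qed
    then obtain k where k: "\<And>b. proj ** weyl (\<lambda>q. a (b, q)) (\<lambda>q. c (b, q)) ** proj = k b \<cdot> proj"
      by metis
    have "?P ** weyl a c ** ?P = (\<Prod>b\<in>UNIV. k b) \<cdot> ?P"
      by (simp add: weyl_eq_tens[of a] tens_mult k tens_scal)
    then show ?thesis by (simp, blast)
  qed
  then obtain k where k: "\<And>a c. ?P ** (weyl_coeff K a c \<cdot> weyl a c) ** ?P = k a c \<cdot> ?P" by metis
  have "?P ** K ** ?P = (\<Sum>a\<in>UNIV. \<Sum>c\<in>UNIV. ?P ** (weyl_coeff K a c \<cdot> weyl a c) ** ?P)"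
    by (subst weyl_expansion[of K]) (simp only: matrix_mult_sum_left matrix_mult_sum_right)
  also have "\<dots> = (\<Sum>a\<in>UNIV. \<Sum>c\<in>UNIV. k a c) \<cdot> ?P"
    by (simp only: k scal_sum_left)
  finally have PKP: "?P ** K ** ?P = (\<Sum>a\<in>UNIV. \<Sum>c\<in>UNIV. k a c) \<cdot> ?P" .
  have "K *v v = (\<Sum>a\<in>UNIV. \<Sum>c\<in>UNIV. k a c) *s v" if v: "v \<in> code_space (blocks_stabilizer S)" for v
  proof -
    have "K *v v = ?P *v (K *v (?P *v v))"
      by (simp only: tens_proj_fixes[OF v] tens_proj_fixes[OF K[OF v]])
    also have "\<dots> = (?P ** K ** ?P) *v v"
      by (simp add: matrix_vector_mul_assoc matrix_mul_assoc)
    also have "\<dots> = (\<Sum>a\<in>UNIV. \<Sum>c\<in>UNIV. k a c) *s v"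
      by (simp only: PKP scal_mult_vec tens_proj_fixes[OF v])
    finally show ?thesis .
  qed
  then show ?thesis by blast
qed

end

section \<open>Disjointness and covers\<close>

context pauli_code
begin

lemma nontrivial_exists: "nontrivial \<noteq> {}"
proof -
  have "(1 :: ('k, 'd) basis) \<noteq> 0" by (simp add: fun_eq_iff)
  then show ?thesis using coset_mem_nontrivial by blast
qed

lemma card_S_pos: "card S > 0"
  using finite_S one_mem by (auto simp: card_gt_0_iff)

lemma coset_disjointness_attained:
  assumes "G \<in> nontrivial"
  obtains A where "A \<subseteq> G" "c_disjoint Q c A" "coset_disjointness Q c G = real (card A) / real c"
proof -
  let ?X = "card ` {A. A \<subseteq> G \<and> c_disjoint Q c A}"
  have "finite ?X" using nontrivial_finite[OF assms] by simp
  moreover have "{} \<in> {A. A \<subseteq> G \<and> c_disjoint Q c A}" by (simp add: c_disjoint_def)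
  then have "?X \<noteq> {}" by blast
  ultimately have "Max ?X \<in> ?X" by (rule Max_in)
  then show ?thesis using that by (auto simp: coset_disjointness_def)
qed

lemma one_le_coset_disjointness:
  assumes "G \<in> nontrivial" shows "1 \<le> coset_disjointness Q 1 G"
proof -
  obtain g where g: "g \<in> G" using nontrivial_nonempty[OF assms] by blast
  have "c_disjoint Q 1 {g}"
    unfolding c_disjoint_def
  proof
    fix i
    have "card {a \<in> {g}. i \<in> supp Q a} \<le> card {g}" by (intro card_mono) auto
    then show "card {a \<in> {g}. i \<in> supp Q a} \<le> 1" by simp
  qed
  then have "card {g} \<in> card ` {A. A \<subseteq> G \<and> c_disjoint Q 1 A}" using g by blast
  then have "card {g} \<le> Max (card ` {A. A \<subseteq> G \<and> c_disjoint Q 1 A})"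
    using nontrivial_finite[OF assms] by (intro Max_ge) auto
  then show ?thesis by (simp add: coset_disjointness_def)
qed

text \<open>Beyond c = |S| the values stay below 1, which c = 1 already reaches, so the supremum is
  a maximum over finitely many c. The bound by |S| is what later relates \<Delta> to
  m^(n-k).\<close>

lemma disjointness_attained:
  fixes Q :: "'p::finite \<Rightarrow> 'q set"
  shows "1 \<le> disjointness Q S LX LZ" and "disjointness Q S LX LZ \<le> real (card S)"
    and "\<exists>c\<ge>1. \<forall>G\<in>nontrivial. disjointness Q S LX LZ \<le> coset_disjointness Q c G"
proof -
  define F where "F c = Min (coset_disjointness Q c ` nontrivial)" for c
  have fin: "finite (coset_disjointness Q c ` nontrivial)" for c
    by (rule finite_imageI[OF finite_nontrivial_logical_paulis])
  have F_le: "F c \<le> coset_disjointness Q c G" if "G \<in> nontrivial" for c G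
    unfolding F_def using fin that by (intro Min_le) auto
  have F_bound: "F c \<le> real (card S) / real c" if "1 \<le> c" for c
  proof -
    obtain G where G: "G \<in> nontrivial" using nontrivial_exists by blast
    obtain A where A: "A \<subseteq> G" "coset_disjointness Q c G = real (card A) / real c"
      using coset_disjointness_attained[OF G] by blast
    have "card A \<le> card S"
      using card_mono[OF nontrivial_finite[OF G] A(1)] nontrivial_card[OF G] by simp
    then show ?thesis using F_le[OF G, of c] A(2) by (simp add: divide_right_mono order_trans)
  qed
  have F1: "1 \<le> F 1"
    unfolding F_def using fin nontrivial_exists one_le_coset_disjointness by (subst Min_ge_iff) auto
  obtain c0 where c0: "c0 \<in> {1..card S}" "\<And>c. c \<in> {1..card S} \<Longrightarrow> F c \<le> F c0"
  proof -
    have "Max (F ` {1..card S}) \<in> F ` {1..card S}" using card_S_pos by (intro Max_in) auto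
    then obtain c0 where "c0 \<in> {1..card S}" "F c0 = Max (F ` {1..card S})" by auto
    then show ?thesis using that[of c0] by simp
  qed
  have "F c \<le> F c0" if "1 \<le> c" for c
  proof (cases "c \<le> card S")
    case False
    then have "F c \<le> 1" using F_bound[OF that] that by (smt (verit) divide_le_eq_1 of_nat_less_iff
      not_le of_nat_0_le_iff)
    also have "1 \<le> F c0" using F1 c0(2)[of 1] card_S_pos by simp
    finally show ?thesis .
  qed (use c0 that in auto)
  then have eq: "disjointness Q S LX LZ = F c0"
    unfolding disjointness_def F_def[symmetric] using c0(1) by (intro cSup_eq_maximum) auto
  show "1 \<le> disjointness Q S LX LZ" using F1 c0(2)[of 1] card_S_pos by (simp add: eq)
  have "real (card S) / real c0 \<le> real (card S)"
    using c0(1) by (simp add: divide_le_eq mult_le_cancel_left1)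
  then show "disjointness Q S LX LZ \<le> real (card S)" using F_bound[of c0] c0(1) by (simp add: eq)
  show "\<exists>c\<ge>1. \<forall>G\<in>nontrivial. disjointness Q S LX LZ \<le> coset_disjointness Q c G"
    using c0(1) F_le by (auto simp: eq)
qed

lemma supp_one: "supp Q (mat 1 :: ('q, 'd) op) = {}"
  using supp_weyl[of Q 0 0] by simp

text \<open>
  The block \<open>b\<close> of a logical Pauli is either trivial, and then represented by the identity, or it
  lies in a non-trivial coset.
\<close>

abbreviation choices :: "('q, 'd) op set set"
  where "choices \<equiv> insert {mat 1} nontrivial"

lemma choices_nonempty: "G \<in> choices \<Longrightarrow> G \<noteq> {}"
  using nontrivial_nonempty by auto

lemma choices_pauli: "G \<in> choices \<Longrightarrow> g \<in> G \<Longrightarrow> is_pauli g"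
  using nontrivial_pauli is_pauli_one by auto

text \<open>Averaging over a \<open>c\<close>-disjoint set, each element of \<open>R\<close> is covered with frequency at most \<open>1/\<Delta>\<close>.\<close>

lemma ex_small_intersection:
  fixes Q :: "'p::finite \<Rightarrow> 'q set"
  assumes "G \<in> choices"
  shows "\<exists>g\<in>G. disjointness Q S LX LZ * real (card (supp Q g \<inter> R)) \<le> real (card R)"
proof (cases "G = {mat 1}")
  case False
  then have G: "G \<in> nontrivial" using assms by blast
  let ?D = "disjointness Q S LX LZ"
  note D1 = disjointness_attained(1)[of Q]
  obtain c where c: "c \<ge> 1" "?D \<le> coset_disjointness Q c G"
    using disjointness_attained(3)[of Q] G by blast
  obtain A where A: "A \<subseteq> G" "c_disjoint Q c A" "coset_disjointness Q c G = real (card A) / real c"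
    using coset_disjointness_attained[OF G] by blast
  have Dc: "?D * real c \<le> real (card A)" using c A(3) by (simp add: le_divide_eq)
  have finA: "finite A" using A(1) nontrivial_finite[OF G] by (rule finite_subset)
  have "card A > 0"
  proof -
    have "0 < ?D * real c" using D1 c(1) by (intro mult_pos_pos) auto
    then show ?thesis using Dc by (smt (verit) of_nat_0_less_iff)
  qed
  \<comment> \<open>Double counting of the pairs of a in A and i in R with i in the support of
    a.\<close>
  have "(\<Sum>a\<in>A. card (supp Q a \<inter> R)) = (\<Sum>a\<in>A. \<Sum>i\<in>R. if i \<in> supp Q a then 1 else 0)"
    by (simp add: sum.If_cases Int_commute)
  also have "\<dots> = (\<Sum>i\<in>R. \<Sum>a\<in>A. if i \<in> supp Q a then 1 else 0)" by (rule sum.swap)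
  also have "\<dots> = (\<Sum>i\<in>R. card {a\<in>A. i \<in> supp Q a})"
    using finA by (simp add: sum.If_cases Int_def)
  also have "\<dots> \<le> (\<Sum>i\<in>R. c)"
    using A(2) by (intro sum_mono) (simp add: c_disjoint_def)
  finally have count: "(\<Sum>a\<in>A. card (supp Q a \<inter> R)) \<le> card R * c" by simp
  have "\<exists>a\<in>A. ?D * real (card (supp Q a \<inter> R)) \<le> real (card R)"
  proof (rule ccontr)
    assume "\<not> ?thesis"
    then have "(\<Sum>a\<in>A. real (card R)) < (\<Sum>a\<in>A. ?D * real (card (supp Q a \<inter> R)))"
      using \<open>card A > 0\<close> finA by (intro sum_strict_mono) (auto simp: not_le)
    also have "\<dots> = ?D * real (\<Sum>a\<in>A. card (supp Q a \<inter> R))"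
      by (simp add: sum_distrib_left)
    also have "\<dots> \<le> ?D * real (card R * c)"
      using D1 by (intro mult_left_mono) (simp_all only: of_nat_le_iff count)
    also have "\<dots> = real (card R) * (?D * real c)" by simp
    also have "\<dots> \<le> real (card R) * real (card A)"
      using Dc by (intro mult_left_mono) auto
    finally show False by (simp add: mult.commute)
  qed
  then show ?thesis using A(1) by blast
qed (simp add: supp_one)

lemma ex_le_max_distance_choices:
  assumes "G \<in> choices" shows "\<exists>g\<in>G. card (supp Q g) \<le> max_distance Q S LX LZ"
  using assms ex_le_max_distance by (auto simp: supp_one)

text \<open>For a single part the averaging bound leaves no room: \<Delta> times the size of the
  intersection is at most 1, and \<Delta> > 1, so the intersection is empty.\<close>

lemma ex_avoiding:
  fixes Q :: "'p::finite \<Rightarrow> 'q set"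
  assumes "G \<in> choices" "disjointness Q S LX LZ > 1"
  shows "\<exists>g\<in>G. i \<notin> supp Q g"
proof -
  obtain g where g: "g \<in> G" "disjointness Q S LX LZ * real (card (supp Q g \<inter> {i})) \<le> 1"
    using ex_small_intersection[OF assms(1), of Q "{i}"] by auto
  then show ?thesis using assms(2) by (cases "i \<in> supp Q g") auto
qed

text \<open>Blocks are processed one at a time, and the averaging bound is always applied to the
  parts of R that no earlier block has touched, transported by \<open>\<sigma> b\<close>. Each block
  leaves at least the fraction 1 - 1/\<Delta> of them untouched.\<close>

lemma ex_greedy_choice:
  fixes Q :: "'p::finite \<Rightarrow> 'q set" and \<sigma> :: "'b::finite \<Rightarrow> 'p \<Rightarrow> 'p"
  assumes \<sigma>: "\<And>b. bij (\<sigma> b)" and G: "\<And>b. G b \<in> choices"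
  shows "\<exists>g. (\<forall>b. g b \<in> G b) \<and> real (card R) * (1 - 1 / disjointness Q S LX LZ) ^ card B
    \<le> real (card {i\<in>R. \<forall>b\<in>B. \<sigma> b i \<notin> supp Q (g b)})"
proof (induction B rule: finite_induct[OF finite])
  case 1
  have "\<forall>b. \<exists>g. g \<in> G b" using choices_nonempty[OF G] by blast
  then obtain g where "\<And>b. g b \<in> G b" by metis
  then show ?case by (intro exI[of _ g]) simp
next
  case (2 b B)
  let ?D = "disjointness Q S LX LZ"
  note D1 = disjointness_attained(1)[of Q]
  obtain g where g: "\<And>b. g b \<in> G b"
    and gB: "real (card R) * (1 - 1 / ?D) ^ card B \<le> real (card {i\<in>R. \<forall>b\<in>B. \<sigma> b i \<notin> supp Q (g b)})"
    using 2(3) by blast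
  define R' where "R' = {i\<in>R. \<forall>b\<in>B. \<sigma> b i \<notin> supp Q (g b)}"
  have inj: "inj_on (\<sigma> b) X" for X using \<sigma>[of b] by (meson bij_is_inj inj_on_subset subset_UNIV)
  obtain h where h: "h \<in> G b" "?D * real (card (supp Q h \<inter> \<sigma> b ` R')) \<le> real (card (\<sigma> b ` R'))"
    using ex_small_intersection[OF G] by blast
  have "supp Q h \<inter> \<sigma> b ` R' = \<sigma> b ` {i\<in>R'. \<sigma> b i \<in> supp Q h}" by auto
  then have card_h: "?D * real (card {i\<in>R'. \<sigma> b i \<in> supp Q h}) \<le> real (card R')"
    using h(2) by (simp add: card_image[OF inj])
  have "card ({i\<in>R'. \<sigma> b i \<in> supp Q h} \<union> {i\<in>R'. \<sigma> b i \<notin> supp Q h})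
      = card {i\<in>R'. \<sigma> b i \<in> supp Q h} + card {i\<in>R'. \<sigma> b i \<notin> supp Q h}"
    by (rule card_Un_disjoint) auto
  moreover have "{i\<in>R'. \<sigma> b i \<in> supp Q h} \<union> {i\<in>R'. \<sigma> b i \<notin> supp Q h} = R'" by auto
  ultimately have split: "real (card R') = real (card {i\<in>R'. \<sigma> b i \<in> supp Q h})
      + real (card {i\<in>R'. \<sigma> b i \<notin> supp Q h})" by simp
  have "real (card {i\<in>R'. \<sigma> b i \<in> supp Q h}) \<le> real (card R') / ?D"
    using card_h D1 by (simp add: le_divide_eq mult.commute)
  then have step: "real (card R') * (1 - 1 / ?D) \<le> real (card {i\<in>R'. \<sigma> b i \<notin> supp Q h})"
    using split by (simp add: right_diff_distrib)
  have "real (card R) * (1 - 1 / ?D) ^ card (insert b B)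
      = (real (card R) * (1 - 1 / ?D) ^ card B) * (1 - 1 / ?D)"
    using 2(1,2) by simp
  also have "\<dots> \<le> real (card R') * (1 - 1 / ?D)"
    using gB D1 unfolding R'_def by (intro mult_right_mono) auto
  also have "\<dots> \<le> real (card {i\<in>R'. \<sigma> b i \<notin> supp Q h})" by (rule step)
  also have "{i\<in>R'. \<sigma> b i \<notin> supp Q h} = {i\<in>R. \<forall>b'\<in>insert b B. \<sigma> b' i \<notin> supp Q ((g(b := h)) b')}"
    using 2(2) by (auto simp: R'_def)
  finally show ?case using g h(1) by (intro exI[of _ "g(b := h)"]) auto
qed

text \<open>The parts of the joint partition that \<open>tens g\<close> can touch; the permutations
  translate them into parts of a single block.\<close>

definition cover :: "('p \<Rightarrow> 'q set) \<Rightarrow> ('b \<Rightarrow> 'p \<Rightarrow> 'p) \<Rightarrow> ('b \<Rightarrow> ('q, 'd) op) \<Rightarrow> 'p set"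
  where "cover Q \<sigma> g = {i. \<exists>b. \<sigma> b i \<in> supp Q (g b)}"

text \<open>
  With more than \<open>fact N * card S\<close> blocks, the greedy choice may cover everything, but a choice
  avoiding a single element of \<open>R\<close> already suffices, since \<open>(1 - 1/\<Delta>)\<close> to the power
  \<open>fact N * card S\<close> is at most \<open>exp (- fact N) \<le> 1/N\<close>.
\<close>

lemma ex_shrinking_choice:
  fixes Q :: "'p::finite \<Rightarrow> 'q set" and \<sigma> :: "'b::finite \<Rightarrow> 'p \<Rightarrow> 'p"
  assumes \<sigma>: "\<And>b. bij (\<sigma> b)" and G: "\<And>b. G b \<in> choices"
    and D: "disjointness Q S LX LZ > 1"
    and r': "r' = CARD('b) \<or> r' = fact CARD('p) * card S"
  shows "\<exists>g. (\<forall>b. g b \<in> G b) \<and>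
    real (card (R \<inter> cover Q \<sigma> g)) \<le> real (card R) * (1 - (1 - 1 / disjointness Q S LX LZ) ^ r')"
  using r'
proof
  assume r': "r' = CARD('b)"
  obtain g where g: "\<And>b. g b \<in> G b" "real (card R) * (1 - 1 / disjointness Q S LX LZ) ^ r'
    \<le> real (card {i\<in>R. \<forall>b\<in>UNIV. \<sigma> b i \<notin> supp Q (g b)})"
    using ex_greedy_choice[where \<sigma> = \<sigma> and G = G and B = UNIV and R = R and Q = Q, OF \<sigma> G] unfolding r' by blast
  have "card ((R \<inter> cover Q \<sigma> g) \<union> {i\<in>R. \<forall>b\<in>UNIV. \<sigma> b i \<notin> supp Q (g b)})
      = card (R \<inter> cover Q \<sigma> g) + card {i\<in>R. \<forall>b\<in>UNIV. \<sigma> b i \<notin> supp Q (g b)}"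
    by (rule card_Un_disjoint) (auto simp: cover_def)
  moreover have "(R \<inter> cover Q \<sigma> g) \<union> {i\<in>R. \<forall>b\<in>UNIV. \<sigma> b i \<notin> supp Q (g b)} = R"
    by (auto simp: cover_def)
  ultimately have "card R = card (R \<inter> cover Q \<sigma> g) + card {i\<in>R. \<forall>b\<in>UNIV. \<sigma> b i \<notin> supp Q (g b)}"
    by simp
  then show ?thesis using g by (intro exI[of _ g]) (auto simp: right_diff_distrib)
next
  assume r': "r' = fact CARD('p) * card S"
  let ?D = "disjointness Q S LX LZ"
  show ?thesis
  proof (cases "R = {}")
    case True
    have "\<forall>b. \<exists>g. g \<in> G b" using choices_nonempty[OF G] by blast
    then obtain g where "\<And>b. g b \<in> G b" by metis
    then show ?thesis using True by (intro exI[of _ g]) simp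
  next
    case False
    then obtain i where i: "i \<in> R" by blast
    have "\<forall>b. \<exists>g. g \<in> G b \<and> \<sigma> b i \<notin> supp Q g" using ex_avoiding[OF G D] by blast
    then obtain g where g: "\<And>b. g b \<in> G b" "\<And>b. \<sigma> b i \<notin> supp Q (g b)" by metis
    have "R \<inter> cover Q \<sigma> g \<subseteq> R - {i}" using g(2) by (auto simp: cover_def)
    then have "card (R \<inter> cover Q \<sigma> g) \<le> card (R - {i})" by (intro card_mono) auto
    moreover have "card (R - {i}) + 1 = card R" using i by (metis card_Suc_Diff1 Suc_eq_plus1 finite)
    ultimately have 1: "real (card (R \<inter> cover Q \<sigma> g)) \<le> real (card R) - 1" by linarith
    \<comment> \<open>One part has been saved, so it remains to see that card R times (1 -
      1/\<Delta>)^r' is at most 1. Here \<Delta> <= |S| enters.\<close>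
    have "1 - 1 / ?D \<le> 1 + - (1 / real (card S))"
      using D disjointness_attained(2)[of Q] by (simp add: frac_le)
    also have "\<dots> \<le> exp (- (1 / real (card S)))" by (rule exp_ge_add_one_self)
    finally have "(1 - 1 / ?D) ^ r' \<le> exp (- (1 / real (card S))) ^ r'"
      using D by (intro power_mono) auto
    also have "\<dots> = exp (- real (fact CARD('p)))"
      using card_S_pos by (simp add: r' flip: exp_of_nat_mult)
    finally have "real (card R) * (1 - 1 / ?D) ^ r' \<le> real CARD('p) * exp (- real (fact CARD('p)))"
      using D by (intro mult_mono) (auto intro: card_mono)
    also have "\<dots> \<le> exp (real (fact CARD('p))) * exp (- real (fact CARD('p)))"
    proof (rule mult_right_mono)
      have "real CARD('p) \<le> real (fact CARD('p))" using fact_ge_self by (simp only: of_nat_le_iff)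
      also have "\<dots> \<le> exp (real (fact CARD('p)))" using exp_ge_add_one_self[of "real (fact CARD('p))"] by linarith
      finally show "real CARD('p) \<le> exp (real (fact CARD('p)))" .
    qed simp
    also have "\<dots> = 1" by (simp flip: exp_add)
    finally show ?thesis using 1 g(1) by (intro exI[of _ g]) (simp add: right_diff_distrib)
  qed
qed

text \<open>If r' is the number of blocks, this is the union bound for the lightest representatives.
  Otherwise r' >= N! >= N, and since d_up >= 1 even the set of all N parts is small enough.\<close>

lemma ex_small_cover:
  fixes Q :: "'p::finite \<Rightarrow> 'q set" and \<sigma> :: "'b::finite \<Rightarrow> 'p \<Rightarrow> 'p"
  assumes \<sigma>: "\<And>b. bij (\<sigma> b)" and G: "\<And>b. G b \<in> choices"
    and up: "max_distance Q S LX LZ > 0"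
    and r': "r' = CARD('b) \<or> r' = fact CARD('p) * card S"
  shows "\<exists>g. (\<forall>b. g b \<in> G b) \<and> card (cover Q \<sigma> g) \<le> r' * max_distance Q S LX LZ"
proof -
  have "\<forall>b. \<exists>g. g \<in> G b \<and> card (supp Q g) \<le> max_distance Q S LX LZ"
    using ex_le_max_distance_choices[OF G] by blast
  then obtain g where g: "\<And>b. g b \<in> G b" "\<And>b. card (supp Q (g b)) \<le> max_distance Q S LX LZ" by metis
  have "card (cover Q \<sigma> g) \<le> r' * max_distance Q S LX LZ"
    using r'
  proof
    assume r': "r' = CARD('b)"
    have "cover Q \<sigma> g = (\<Union>b. \<sigma> b -` supp Q (g b))" by (auto simp: cover_def)
    then have "card (cover Q \<sigma> g) \<le> (\<Sum>b\<in>UNIV. card (\<sigma> b -` supp Q (g b)))"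
      by (simp add: card_UN_le)
    also have "\<dots> \<le> (\<Sum>b\<in>(UNIV :: 'b set). max_distance Q S LX LZ)"
    proof (rule sum_mono)
      fix b
      have "card (\<sigma> b -` supp Q (g b)) \<le> card (supp Q (g b))"
        using \<sigma>[of b] by (simp add: card_vimage_inj bij_is_inj bij_is_surj)
      then show "card (\<sigma> b -` supp Q (g b)) \<le> max_distance Q S LX LZ" using g(2)[of b] by simp
    qed
    finally show ?thesis by (simp add: r')
  next
    assume r': "r' = fact CARD('p) * card S"
    have "card (cover Q \<sigma> g) \<le> CARD('p)" by (intro card_mono) auto
    also have "\<dots> \<le> fact CARD('p)" by (rule fact_ge_self)
    also have "\<dots> \<le> r'" using card_S_pos by (simp add: r')
    also have "\<dots> \<le> r' * max_distance Q S LX LZ" using up by simp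
    finally show ?thesis .
  qed
  then show ?thesis using g(1) by blast
qed

end

section \<open>Logical action of operators on the codeblocks\<close>

lemma phase_eq_left_cancel:
  assumes "adj V ** V = mat 1" "V ** A \<simeq> V ** B" shows "A \<simeq> B"
proof -
  have "adj V ** (V ** A) \<simeq> adj V ** (V ** B)" by (rule phase_eq_mult[OF phase_eq_refl assms(2)])
  then show ?thesis by (simp add: matrix_mul_assoc assms(1))
qed

text \<open>Two encodings differ by a unitary that commutes with \<open>X\<close> and \<open>Z\<close> up to phases, hence by a Pauli.\<close>

lemma represents_encoding_indep:
  fixes V V' :: "complex ^ ('k::finite, 'd::nontriv) basis ^ ('q::finite, 'd) basis"
  assumes V: "logical_encoding S LX LZ V" and V': "logical_encoding S LX LZ V'"
    and P: "represents V P a c"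
  shows "represents V' P a c"
proof -
  note iso = logical_encodingD(1)[OF V] logical_encodingD(1)[OF V']
  define T where "T = adj V ** V'"
  have VT: "V ** T = V'"
    unfolding T_def matrix_mul_assoc by (rule encoding_absorb[OF V]) (rule logical_encodingD(3)[OF V'])
  have "adj T ** T = adj V' ** (V ** T)"
    by (simp add: T_def adj_mult matrix_mul_assoc)
  then have "adj T ** T = mat 1" by (simp only: VT iso)
  then have T: "unitary T" using matrix_left_right_inverse by (auto simp: unitary_def)
  have comm: "T ** weyl x z \<simeq> weyl x z ** T" if L: "L ** V \<simeq> V ** weyl x z" "L ** V' \<simeq> V' ** weyl x z" for L x z
  proof -
    have "V ** (T ** weyl x z) \<simeq> L ** V'"
      using phase_eq_sym[OF L(2)] by (simp only: matrix_mul_assoc VT)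
    also have "L ** V' = (L ** V) ** T" by (simp only: VT flip: matrix_mul_assoc)
    also have "\<dots> \<simeq> (V ** weyl x z) ** T" by (rule phase_eq_mult[OF L(1) phase_eq_refl])
    also have "\<dots> = V ** (weyl x z ** T)" by (simp only: matrix_mul_assoc)
    finally show ?thesis by (rule phase_eq_left_cancel[OF iso(1)])
  qed
  have ex: "\<exists>k. A = k \<cdot> B" if "A \<simeq> B" for A B :: "('k, 'd) op" using that by (auto simp: phase_eq_def)
  have "is_pauli T"
    by (rule commutes_up_to_scalar_imp_pauli[OF T])
      (rule ex, rule comm, rule logical_encodingD(4,5)[OF V], rule logical_encodingD(4,5)[OF V'])+
  then have Tac: "weyl a c ** T \<simeq> T ** weyl a c"
    using is_pauli_commute phase_eq_sym unfolding phase_eq_def by metis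
  have "P ** V' = (P ** V) ** T" by (simp only: VT flip: matrix_mul_assoc)
  also have "\<dots> \<simeq> (V ** weyl a c) ** T"
    using P unfolding represents_def by (rule phase_eq_mult[OF _ phase_eq_refl])
  also have "\<dots> = V ** (weyl a c ** T)" by (simp only: matrix_mul_assoc)
  also have "\<dots> \<simeq> V ** (T ** weyl a c)" by (rule phase_eq_mult[OF phase_eq_refl Tac])
  also have "\<dots> = V' ** weyl a c" by (simp only: matrix_mul_assoc VT)
  finally show ?thesis unfolding represents_def .
qed

lemma represents_tens:
  assumes "\<And>b. represents V (g b) (\<lambda>i. a (b, i)) (\<lambda>i. c (b, i))"
  shows "represents (tens (\<lambda>_. V)) (tens g) a c"
proof -
  obtain k where k: "\<And>b. cmod (k b) = 1"
    "\<And>b. g b ** V = k b \<cdot> (V ** weyl (\<lambda>i. a (b, i)) (\<lambda>i. c (b, i)))"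
    using assms unfolding represents_def phase_eq_def by metis
  have "tens g ** tens (\<lambda>_. V) = (\<Prod>b\<in>UNIV. k b) \<cdot> (tens (\<lambda>_. V) ** weyl a c)"
    by (simp only: tens_mult k(2) tens_scal weyl_eq_tens)
  moreover have "cmod (\<Prod>b\<in>UNIV. k b) = 1" by (simp add: k(1) flip: prod_norm)
  ultimately show ?thesis unfolding represents_def by (simp add: phase_eqI)
qed

lemma phase_eq_tens_weyl:
  assumes "\<And>b. g b \<simeq> weyl (\<alpha> b) (\<gamma> b)"
  shows "tens g \<simeq> weyl (\<lambda>(b, q). \<alpha> b q) (\<lambda>(b, q). \<gamma> b q)"
proof -
  obtain k where k: "\<And>b. cmod (k b) = 1" "\<And>b. g b = k b \<cdot> weyl (\<alpha> b) (\<gamma> b)"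
    using assms unfolding phase_eq_def by metis
  have "tens g = tens (\<lambda>b. k b \<cdot> weyl (\<alpha> b) (\<gamma> b))" by (rule arg_cong[where f = tens]) (simp add: k(2) fun_eq_iff)
  also have "\<dots> = (\<Prod>b\<in>UNIV. k b) \<cdot> weyl (\<lambda>(b, q). \<alpha> b q) (\<lambda>(b, q). \<gamma> b q)"
    by (simp add: tens_scal weyl_eq_tens[of "\<lambda>(b, q). \<alpha> b q"])
  finally show ?thesis using k(1) by (simp add: phase_eqI flip: prod_norm)
qed

text \<open>The invariant of the iteration: what has to be known about K and its logical action W in
  order to form the next commutator. The equations are exact rather than up to phase, because
  commutators remove the phases of the Paulis.\<close>

definition logical_action ::
  "complex ^ ('k::finite, 'd::nontriv) basis ^ ('q::finite, 'd) basis
    \<Rightarrow> ('p \<Rightarrow> 'q set) \<Rightarrow> ('q, 'd) op \<Rightarrow> ('k, 'd) op \<Rightarrow> bool"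
  where "logical_action V Q K W \<longleftrightarrow> unitary K \<and> unitary W \<and>
    K ** V = V ** W \<and> adj K ** V = V ** adj W \<and> local_preserving Q K \<and> local_preserving Q (adj K)"

text \<open>The phase with which P represents p meets its conjugate coming from
  \<open>adj P\<close>, so the two commutators correspond exactly.\<close>

lemma logical_action_commutator:
  assumes V: "adj V ** V = mat 1" and K: "logical_action V Q K W"
    and P: "is_pauli P" "P ** V \<simeq> V ** p" and p: "unitary p"
  shows "logical_action V Q (group_commutator K P) (group_commutator W p)"
proof -
  obtain k where k: "cmod k = 1" "P ** V = k \<cdot> (V ** p)" using P(2) by (auto simp: phase_eq_def)
  note U = is_pauli_unitary[OF P(1)]
  have K1: "unitary K" "unitary W" and K2: "K ** V = V ** W" "adj K ** V = V ** adj W"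
    and K3: "local_preserving Q K" "local_preserving Q (adj K)"
    using K by (simp_all add: logical_action_def)
  have "adj P ** (P ** V) ** adj p = k \<cdot> (adj P ** V)"
    using p by (simp add: k(2) unitary_cancel flip: matrix_mul_assoc)
  then have "V ** adj p = k \<cdot> (adj P ** V)" using U by (simp add: unitary_cancel)
  then have P': "adj P ** V = cnj k \<cdot> (V ** adj p)" using k(1) by (simp add: cnj_mult_self)
  have "group_commutator K P ** V = K ** (P ** (adj K ** (adj P ** V)))"
    by (simp add: group_commutator_def matrix_mul_assoc)
  also have "\<dots> = cnj k \<cdot> (K ** (P ** ((adj K ** V) ** adj p)))"
    by (simp add: P' matrix_mul_assoc)
  also have "\<dots> = cnj k \<cdot> (K ** ((P ** V) ** (adj W ** adj p)))"
    by (simp add: K2 matrix_mul_assoc)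
  also have "\<dots> = (K ** V) ** (p ** (adj W ** adj p))"
    using k(1) by (simp add: k(2) cnj_mult_self matrix_mul_assoc)
  also have "\<dots> = V ** group_commutator W p"
    by (simp add: K2 group_commutator_def matrix_mul_assoc)
  finally have 1: "group_commutator K P ** V = V ** group_commutator W p" .
  have "adj (group_commutator K P) ** V = P ** (K ** (adj P ** (adj K ** V)))"
    by (simp add: group_commutator_def adj_mult matrix_mul_assoc)
  also have "\<dots> = P ** (K ** ((adj P ** V) ** adj W))"
    by (simp add: K2 matrix_mul_assoc)
  also have "\<dots> = cnj k \<cdot> (P ** ((K ** V) ** (adj p ** adj W)))"
    by (simp add: P' matrix_mul_assoc)
  also have "\<dots> = cnj k \<cdot> ((P ** V) ** (W ** (adj p ** adj W)))"
    by (simp add: K2 matrix_mul_assoc)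
  also have "\<dots> = V ** adj (group_commutator W p)"
    using k(1) by (simp add: k(2) cnj_mult_self group_commutator_def adj_mult matrix_mul_assoc)
  finally have 2: "adj (group_commutator K P) ** V = V ** adj (group_commutator W p)" .
  have "unitary (group_commutator K P)" "unitary (group_commutator W p)"
    unfolding group_commutator_def by (intro unitary_mult unitary_adj K1 U p)+
  then show ?thesis
    using 1 2 local_preserving_commutator[OF K3 P(1)] by (simp add: logical_action_def)
qed

text \<open>K maps the code space into itself, so V adj V absorbs into K V and gives K V = V W. The
  adjoint equation follows from this and the unitarity of K and W.\<close>

lemma logical_actionI:
  assumes V: "logical_encoding S LX LZ V" and K: "logical_operator S K"
    and loc: "local_preserving Q K" "local_preserving Q (adj K)"
  shows "logical_action V Q K (adj V ** K ** V)"
proof -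
  define W where "W = adj V ** K ** V"
  have U: "unitary K" using K by (simp add: logical_operator_def)
  have "s ** (K ** V) = K ** V" if "s \<in> S" for s
  proof -
    have "(s ** (K ** V)) *v w = (K ** V) *v w" for w
    proof -
      have "V *v w \<in> code_space S" using logical_encodingD(2)[OF V] by blast
      then have "K *v (V *v w) \<in> code_space S" using K by (simp add: logical_operator_def)
      then show ?thesis using that by (simp add: code_space_def matrix_vector_mul_assoc)
    qed
    then show ?thesis unfolding matrix_eq by blast
  qed
  then have "V ** adj V ** (K ** V) = K ** V" by (rule encoding_absorb[OF V])
  then have 1: "K ** V = V ** W" by (simp add: W_def matrix_mul_assoc)
  have "adj W ** W = adj V ** adj K ** (V ** W)" by (simp add: W_def adj_mult matrix_mul_assoc)
  also have "\<dots> = adj V ** (adj K ** (K ** V))" by (simp only: 1 matrix_mul_assoc)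
  also have "\<dots> = mat 1" using U by (simp add: unitary_cancel logical_encodingD(1)[OF V])
  finally have UW: "unitary W" using matrix_left_right_inverse by (auto simp: unitary_def)
  have "adj K ** V = adj K ** (V ** W) ** adj W"
    using UW by (simp add: unitary_cancel flip: matrix_mul_assoc)
  also have "\<dots> = V ** adj W"
    unfolding 1[symmetric] using U by (simp add: unitary_cancel)
  finally show ?thesis using U UW 1 loc by (simp add: logical_action_def W_def)
qed

text \<open>Level \<open>0\<close> consists of the scalars, which makes level \<open>1\<close> an instance of the general step.\<close>

fun hierarchy :: "nat \<Rightarrow> ('q::finite, 'd::nontriv) op set"
  where
    "hierarchy 0 = {W. W \<simeq> mat 1}"
  | "hierarchy (Suc j) = clifford_level (Suc j)"

text \<open>For j > 0 this is the recursion of the hierarchy. For j = 0, scalar commutators say that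
  W commutes with all Weyl operators up to scalars, hence is a Pauli up to phase.\<close>

lemma hierarchy_step:
  assumes W: "unitary W" and comm: "\<And>p. p \<in> pauli_group \<Longrightarrow> group_commutator W p \<in> hierarchy j"
  shows "W \<in> hierarchy (Suc j)"
proof (cases j)
  case 0
  have "\<exists>k. W ** weyl a c = k \<cdot> (weyl a c ** W)" for a c
  proof -
    have "W ** weyl a c ** adj W ** adj (weyl a c) \<simeq> mat 1"
      using comm[OF weyl_mem_pauli_group, of a c] 0 by (simp add: group_commutator_def)
    then obtain k where "W ** weyl a c ** adj W ** adj (weyl a c) = k \<cdot> mat 1"
      by (auto simp: phase_eq_def)
    then have "W ** weyl a c ** adj W ** adj (weyl a c) ** (weyl a c ** W) = k \<cdot> (weyl a c ** W)"
      by simp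
    then have "W ** weyl a c = k \<cdot> (weyl a c ** W)"
      using W unitary_weyl[of a c] by (simp add: unitary_cancel flip: matrix_mul_assoc)
    then show ?thesis by blast
  qed
  then have "is_pauli W" by (intro commutes_up_to_scalar_imp_pauli W)
  then obtain a c k where "cmod k = 1" "W = k \<cdot> weyl a c" by (auto simp: is_pauli_def phase_eq_def)
  then show ?thesis using 0 weyl_mem_pauli_group[of a c] by (auto simp: mat_mult_eq_scal)
qed (use W comm in simp)

section \<open>Iterated commutators and descent through the hierarchy\<close>

context pauli_code
begin

text \<open>The exponents are split by blocks: a block with zero exponents gets the identity alone,
  any other block a full coset. Stabilizer factors contribute zero exponents, so all choices act
  alike up to phase. Independence of the encoding extends this from the tensor power of one encoding
  to every V.\<close>

lemma ex_block_choices: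
  fixes a c :: "('b::finite \<times> 'k, 'd) basis"
  shows "\<exists>G. (\<forall>b. G b \<in> choices) \<and> (\<forall>g V. (\<forall>b. g b \<in> G b) \<longrightarrow>
    logical_encoding (blocks_stabilizer S) (blocks_logical LX) (blocks_logical LZ) V \<longrightarrow>
    represents V (tens g) a c)"
proof -
  define x z where "x b = (\<lambda>i. a (b, i))" and "z b = (\<lambda>i. c (b, i))" for b
  define G where "G b = (if x b = 0 \<and> z b = 0 then {mat 1}
    else (\<lambda>s. s ** logical_pauli LX LZ (residue_rep (x b)) (residue_rep (z b))) ` S)" for b
  obtain V where V: "logical_encoding S LX LZ V" using encoding_exists by blast
  have "G b \<in> choices" for b
    using coset_mem_nontrivial[of "x b" "z b"] by (auto simp: G_def)
  moreover have "represents V' (tens g) a c"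
    if g: "\<And>b. g b \<in> G b"
      and V': "logical_encoding (blocks_stabilizer S) (blocks_logical LX) (blocks_logical LZ) V'" for g V'
  proof -
    have "represents V (g b) (x b) (z b)" for b
    proof (cases "x b = 0 \<and> z b = 0")
      case True
      then have "g b = mat 1" using g[of b] by (simp add: G_def)
      then show ?thesis using True by (simp add: represents_one)
    next
      case False
      then obtain s where s: "s \<in> S" "g b = s ** logical_pauli LX LZ (residue_rep (x b)) (residue_rep (z b))"
        using g[of b] by (auto simp: G_def)
      have "represents V (g b) (0 + x b) (0 + z b)"
        unfolding s(2) using represents_logical_pauli[OF V, of "residue_rep (x b)" "residue_rep (z b)"]
        by (intro represents_mult represents_one logical_encodingD(3)[OF V s(1)]) simp
      then show ?thesis by simp
    qed
    then have "represents (tens (\<lambda>_. V)) (tens g) a c"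
      unfolding x_def z_def by (rule represents_tens)
    then show ?thesis by (rule represents_encoding_indep[OF blocks_encoding[OF V] V'])
  qed
  ultimately show ?thesis by blast
qed

text \<open>The exponents of the blocks glue to a single Weyl operator, from which both claims are
  read off.\<close>

lemma tens_choice:
  assumes "\<And>b. g b \<in> G b" "\<And>b. G b \<in> choices"
  shows "is_pauli (tens g)" and "i \<notin> cover Q \<sigma> g \<Longrightarrow> acts_only_on (tens g) (- blocks_partition \<sigma> Q i)"
proof -
  have "\<exists>a c. g b \<simeq> weyl a c" for b
    using choices_pauli[OF assms(2,1)] by (simp add: is_pauli_def)
  then obtain \<alpha> \<gamma> where g: "\<And>b. g b \<simeq> weyl (\<alpha> b) (\<gamma> b)" by metis
  note t = phase_eq_tens_weyl[of g \<alpha> \<gamma>, OF g]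
  show "is_pauli (tens g)" using t by (auto simp: is_pauli_def)
  show "acts_only_on (tens g) (- blocks_partition \<sigma> Q i)" if i: "i \<notin> cover Q \<sigma> g"
    unfolding acts_only_on_phase_eq[OF t] acts_only_on_weyl_iff
    using i by (auto simp: cover_def blocks_partition_def supp_phase_eq[OF g] supp_weyl)
qed

text \<open>The end of the iteration: K acts on the code as a scalar, and the unitarity of W makes
  that scalar a phase.\<close>

lemma scalar_logical_action:
  fixes V :: "complex ^ ('b::finite \<times> 'k, 'd) basis ^ ('b \<times> 'q, 'd) basis"
    and Q :: "'p::finite \<Rightarrow> 'q set"
  assumes \<sigma>: "\<And>b. bij (\<sigma> b)"
    and V: "logical_encoding (blocks_stabilizer S) (blocks_logical LX) (blocks_logical LZ) V"
    and K: "logical_action V (blocks_partition \<sigma> Q) K W"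
    and small: "card (supp (blocks_partition \<sigma> Q) K) < min_distance Q S LX LZ"
  shows "W \<simeq> mat 1"
proof -
  have KV: "K ** V = V ** W" and UW: "unitary W" using K by (simp_all add: logical_action_def)
  have "K *v v \<in> code_space (blocks_stabilizer S)" if v: "v \<in> code_space (blocks_stabilizer S)" for v
  proof -
    obtain w where "v = V *v w" using v logical_encodingD(2)[OF V] by blast
    then have "K *v v = V *v (W *v w)" by (simp add: matrix_vector_mul_assoc KV)
    then show ?thesis using logical_encodingD(2)[OF V] by blast
  qed
  then obtain k where k: "\<And>v. v \<in> code_space (blocks_stabilizer S) \<Longrightarrow> K *v v = k *s v"
    using small_support_acts_as_scalar[OF \<sigma> _ small] by blast
  have "(K ** V) *v w = (k \<cdot> V) *v w" for w
  proof -
    have "V *v w \<in> code_space (blocks_stabilizer S)" using logical_encodingD(2)[OF V] by blast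
    then show ?thesis using k by (simp add: scal_mult_vec flip: matrix_vector_mul_assoc)
  qed
  then have "K ** V = k \<cdot> V" unfolding matrix_eq by blast
  then have "adj V ** (V ** W) = k \<cdot> (adj V ** V)" by (simp flip: KV)
  then have W: "W = k \<cdot> mat 1" by (simp add: matrix_mul_assoc logical_encodingD(1)[OF V])
  then have "cmod k = 1" using UW unitary_scal_iff[OF unitary_one] by blast
  then show ?thesis unfolding W by (rule phase_eqI)
qed

text \<open>
  Multiplying a logical Pauli by stabilizers does not change the logical action of its commutator
  with \<open>K\<close>, but it changes the support of the commutator.
\<close>

lemma commutator_with_choice:
  fixes V :: "complex ^ ('b::finite \<times> 'k, 'd) basis ^ ('b \<times> 'q, 'd) basis"
    and Q :: "'p::finite \<Rightarrow> 'q set"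
  assumes V: "logical_encoding (blocks_stabilizer S) (blocks_logical LX) (blocks_logical LZ) V"
    and K: "logical_action V (blocks_partition \<sigma> Q) K W" and p: "p \<in> pauli_group"
  shows "\<exists>G. (\<forall>b. G b \<in> choices) \<and> (\<forall>g. (\<forall>b. g b \<in> G b) \<longrightarrow>
    logical_action V (blocks_partition \<sigma> Q) (group_commutator K (tens g)) (group_commutator W p) \<and>
    supp (blocks_partition \<sigma> Q) (group_commutator K (tens g))
      \<subseteq> supp (blocks_partition \<sigma> Q) K \<inter> cover Q \<sigma> g)"
proof -
  obtain a c where ac: "p \<simeq> weyl a c"
    using pauli_group_is_pauli[OF p] by (auto simp: is_pauli_def)
  obtain G where G: "\<And>b. G b \<in> choices"
    and rep: "\<And>g. (\<And>b. g b \<in> G b) \<Longrightarrow> represents V (tens g) a c"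
    using ex_block_choices[of a c] V by blast
  have "logical_action V (blocks_partition \<sigma> Q) (group_commutator K (tens g)) (group_commutator W p) \<and>
    supp (blocks_partition \<sigma> Q) (group_commutator K (tens g))
      \<subseteq> supp (blocks_partition \<sigma> Q) K \<inter> cover Q \<sigma> g" if g: "\<And>b. g b \<in> G b" for g
  proof
    note P = tens_choice(1)[of g G, OF g G]
    have "tens g ** V \<simeq> V ** weyl a c" using rep[OF g] by (simp add: represents_def)
    also have "\<dots> \<simeq> V ** p" by (rule phase_eq_mult[OF phase_eq_refl phase_eq_sym[OF ac]])
    finally show "logical_action V (blocks_partition \<sigma> Q) (group_commutator K (tens g)) (group_commutator W p)"
      using logical_action_commutator[OF logical_encodingD(1)[OF V] K P]
        is_pauli_unitary[OF pauli_group_is_pauli[OF p]] by blast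
    have "i \<in> cover Q \<sigma> g" if "i \<in> supp (blocks_partition \<sigma> Q) (group_commutator K (tens g))" for i
    proof (rule ccontr)
      assume "i \<notin> cover Q \<sigma> g"
      then have "acts_only_on (tens g) (- blocks_partition \<sigma> Q i)" by (rule tens_choice(2)[OF g G])
      moreover have "unitary K" "local_preserving (blocks_partition \<sigma> Q) K"
        using K by (simp_all add: logical_action_def)
      ultimately show False
        using supp_commutator_disjoint[of K "blocks_partition \<sigma> Q" "tens g" i] is_pauli_unitary[OF P] that
        by simp
    qed
    then show "supp (blocks_partition \<sigma> Q) (group_commutator K (tens g))
      \<subseteq> supp (blocks_partition \<sigma> Q) K \<inter> cover Q \<sigma> g"
      by (intro Int_greatest supp_commutator_subset[OF P] subsetI)
  qed
  then show ?thesis using G by blast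
qed

text \<open>Induction on j with K and W free. For every p, representatives can be chosen so that the
  commutator has at most f times the support of K, which turns the bound with f^(j+1) for K into the
  bound with f^j for the commutator.\<close>

lemma logical_action_in_hierarchy:
  fixes V :: "complex ^ ('b::finite \<times> 'k, 'd) basis ^ ('b \<times> 'q, 'd) basis"
    and Q :: "'p::finite \<Rightarrow> 'q set"
  assumes \<sigma>: "\<And>b. bij (\<sigma> b)"
    and V: "logical_encoding (blocks_stabilizer S) (blocks_logical LX) (blocks_logical LZ) V"
    and D: "disjointness Q S LX LZ > 1"
    and r': "r' = CARD('b) \<or> r' = fact CARD('p) * card S"
    and f: "f = 1 - (1 - 1 / disjointness Q S LX LZ) ^ r'"
    and K: "logical_action V (blocks_partition \<sigma> Q) K W"
    and small: "real (card (supp (blocks_partition \<sigma> Q) K)) * f ^ j < real (min_distance Q S LX LZ)"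
  shows "W \<in> hierarchy j"
  using K small
proof (induction j arbitrary: K W)
  case 0
  then show ?case using scalar_logical_action[OF \<sigma> V] by simp
next
  case (Suc j)
  have "f \<ge> 0" unfolding f using D by (simp add: power_le_one)
  have "group_commutator W p \<in> hierarchy j" if p: "p \<in> pauli_group" for p
  proof -
    let ?R = "supp (blocks_partition \<sigma> Q) K"
    obtain G where G: "\<And>b. G b \<in> choices"
      and GG: "\<forall>g. (\<forall>b. g b \<in> G b) \<longrightarrow>
    logical_action V (blocks_partition \<sigma> Q) (group_commutator K (tens g)) (group_commutator W p) \<and>
    supp (blocks_partition \<sigma> Q) (group_commutator K (tens g)) \<subseteq> ?R \<inter> cover Q \<sigma> g"
      using commutator_with_choice[OF V Suc.prems(1) p] by (elim exE conjE) (rule that, simp_all)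
    have act: "\<And>g. (\<And>b. g b \<in> G b) \<Longrightarrow>
        logical_action V (blocks_partition \<sigma> Q) (group_commutator K (tens g)) (group_commutator W p)"
      and sub: "\<And>g. (\<And>b. g b \<in> G b) \<Longrightarrow>
        supp (blocks_partition \<sigma> Q) (group_commutator K (tens g)) \<subseteq> ?R \<inter> cover Q \<sigma> g"
      using GG by simp_all
    obtain g where g: "\<And>b. g b \<in> G b" "real (card (?R \<inter> cover Q \<sigma> g)) \<le> real (card ?R) * f"
      using ex_shrinking_choice[where \<sigma> = \<sigma> and G = G and R = ?R, OF \<sigma> G D r'] unfolding f by blast
    have "card (supp (blocks_partition \<sigma> Q) (group_commutator K (tens g))) \<le> card (?R \<inter> cover Q \<sigma> g)"
      using sub[OF g(1)] by (intro card_mono) auto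
    then have "real (card (supp (blocks_partition \<sigma> Q) (group_commutator K (tens g)))) \<le> real (card ?R) * f"
      using g(2) by linarith
    then have "real (card (supp (blocks_partition \<sigma> Q) (group_commutator K (tens g)))) * f ^ j
        \<le> real (card ?R) * f * f ^ j"
      using \<open>f \<ge> 0\<close> by (intro mult_right_mono) auto
    also have "\<dots> < real (min_distance Q S LX LZ)" using Suc.prems(2) by (simp add: mult.assoc)
    finally show ?thesis using Suc.IH[OF act[OF g(1)]] by blast
  qed
  then show ?case using Suc.prems(1) by (intro hierarchy_step) (simp_all add: logical_action_def)
qed

end

section \<open>From the hypotheses on the code to the theorem\<close>

lemma commutator_eq_mat:
  assumes "unitary A" "unitary B" "group_commutator A B = mat c"
  shows "A ** B = c \<cdot> (B ** A)"
proof -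
  have "A ** B = group_commutator A B ** (B ** A)"
    using assms(1,2) by (simp add: group_commutator_def unitary_cancel flip: matrix_mul_assoc)
  then show ?thesis by (simp add: assms(3) mat_mult_eq_scal)
qed

lemma stabilizer_code_imp_pauli_code:
  fixes S :: "('q::finite, 'd::nontriv) op set" and LX LZ :: "'k::finite \<Rightarrow> ('q, 'd) op"
  assumes code: "stabilizer_code CARD('k) S" and logical: "logical_pauli_generators S LX LZ"
  shows "pauli_code S LX LZ"
proof -
  obtain s where s: "\<And>i. i < CARD('q) - CARD('k) \<Longrightarrow> s i \<in> pauli_group"
    and S: "S = generate unitary_group (s ` {..<CARD('q) - CARD('k)})"
    using code unfolding stabilizer_code_def by blast
  let ?H = "s ` {..<CARD('q) - CARD('k)}"
  have H: "is_pauli h" if "h \<in> ?H" for h using that s pauli_group_is_pauli by blast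
  have pauli: "is_pauli h" if "h \<in> S" for h
    using that unfolding S
  proof (induction rule: generate.induct)
    case one
    show ?case using is_pauli_one by (simp add: unitary_group_def)
  next
    case (inv h)
    then show ?case by (simp add: inv_unitary_group H is_pauli_unitary is_pauli_adj)
  next
    case (eng h1 h2)
    then show ?case by (simp add: unitary_group_def is_pauli_mult)
  qed (rule H)
  have carrier: "?H \<subseteq> carrier unitary_group"
    using H is_pauli_unitary by (auto simp: unitary_group_def)
  have comm: "LX i ** LX j = LX j ** LX i" "LZ i ** LZ j = LZ j ** LZ i"
    "LX i ** LZ j = (if i = j then inverse (root_of_unity TYPE('d)) else 1) \<cdot> (LZ j ** LX i)" for i j
    using logical commutator_eq_mat[of "LX i" "LX j" 1] commutator_eq_mat[of "LZ i" "LZ j" 1]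
      commutator_eq_mat[of "LX i" "LZ j"]
    by (auto simp: logical_pauli_generators_def pauli_group_is_pauli is_pauli_unitary)
  have L: "is_pauli (LX i)" "is_pauli (LZ i)" for i
    using logical by (simp_all add: logical_pauli_generators_def pauli_group_is_pauli)
  show ?thesis
  proof
    have "card S > 0" using code by (simp add: stabilizer_code_def)
    then show "finite S" by (rule card_ge_0_finite)
    show "mat 1 \<in> S" unfolding S by (rule generate_unitary_group_one)
    show "s ** t \<in> S" if "s \<in> S" "t \<in> S" for s t
      using that unfolding S by (rule generate_unitary_group_mult)
    show "adj s \<in> S" if "s \<in> S" for s
      using group.generate_m_inv_closed[OF group_unitary_group carrier, of s] that
        inv_unitary_group[OF is_pauli_unitary[OF pauli[OF that]]] by (simp add: S)
    show "is_pauli s" if "s \<in> S" for s by (rule pauli[OF that])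
    show "is_pauli (LX i)" "is_pauli (LZ i)" for i by (rule L)+
    show "s ** LX i = LX i ** s" "s ** LZ i = LZ i ** s" if "s \<in> S" for s i
      using logical that by (simp_all add: logical_pauli_generators_def)
    show "LX i ** LX j = LX j ** LX i" "LZ i ** LZ j = LZ j ** LZ i" for i j by (rule comm)+
    \<comment> \<open>The commutator relation read in the opposite order, which turns the inverse of
      omega into omega.\<close>
    show "LZ i ** LX j = chi (if i = j then 1 else 0 :: 'd mod_ring) \<cdot> (LX j ** LZ i)" for i j
      using comm(3)[of j i] by (auto simp: chi_1[symmetric])
    show "vec.dim (code_space S) = CARD('d) ^ CARD('k)"
      using code by (simp add: stabilizer_code_def)
  qed
qed

lemma disjoint_family_blocks_partition:
  assumes Q: "disjoint_family Q" and \<sigma>: "\<And>b. bij (\<sigma> b)"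
  shows "disjoint_family (blocks_partition \<sigma> Q)"
  unfolding disjoint_family_on_def
proof (intro ballI impI)
  fix i j :: 'a assume "i \<noteq> j"
  then have "Q (\<sigma> b i) \<inter> Q (\<sigma> b j) = {}" for b
    using Q bij_is_inj[OF \<sigma>[of b]] by (auto simp: disjoint_family_on_def inj_eq)
  then show "blocks_partition \<sigma> Q i \<inter> blocks_partition \<sigma> Q j = {}"
    by (auto simp: blocks_partition_def)
qed

theorem theorem7:
  fixes S :: "('q::finite, 'd::nontriv) op set"
    and LX LZ :: "'k::finite \<Rightarrow> ('q, 'd) op"
    and Q :: "'p::finite \<Rightarrow> 'q set"
    and \<sigma> :: "'b::finite \<Rightarrow> 'p \<Rightarrow> 'p"
    and r' M :: nat
  assumes code: "stabilizer_code CARD('k) S"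
    and logical: "logical_pauli_generators S LX LZ"
    and partition: "qudit_partition Q"
    and perms: "\<And>b. bij (\<sigma> b)"
    and r': "r' = min CARD('b) (fact CARD('p) * CARD('d) ^ (CARD('q) - CARD('k)))"
    and M: "M > 0"
    and bound: "real r' * real (max_distance Q S LX LZ) *
        (1 - (1 - 1 / disjointness Q S LX LZ) ^ r') ^ (M - 1)
      < real (min_distance Q S LX LZ)"
  shows "\<forall>U :: ('b \<times> 'q, 'd) op.
      logical_operator (blocks_stabilizer S) U \<and> transversal (blocks_partition \<sigma> Q) U \<longrightarrow>
      U \<in> logical_clifford_level M (blocks_stabilizer S) (blocks_logical LX) (blocks_logical LZ)"
proof (intro allI impI, elim conjE)
  interpret pauli_code S LX LZ by (rule stabilizer_code_imp_pauli_code[OF code logical])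
  let ?D = "disjointness Q S LX LZ"
  let ?Q = "blocks_partition \<sigma> Q"
  define f where "f = 1 - (1 - 1 / ?D) ^ r'"
  have cardS: "card S = CARD('d) ^ (CARD('q) - CARD('k))"
    using code by (simp add: stabilizer_code_def)
  \<comment> \<open>The power m^(n-k) is replaced by the order of S, the form in which it can be
    compared with \<Delta>.\<close>
  have r'_cases: "r' = CARD('b) \<or> r' = fact CARD('p) * card S"
    by (auto simp: r' cardS min_def)
  have r'_pos: "r' \<ge> 1" using card_S_pos by (simp add: r' cardS Suc_le_eq)
  have up: "min_distance Q S LX LZ \<le> max_distance Q S LX LZ" by (rule min_distance_le_max_distance)
  have f0: "0 \<le> f" using disjointness_attained(1)[of Q] by (simp add: f_def power_le_one)
  have "0 \<le> real r' * real (max_distance Q S LX LZ) * f ^ (M - 1)" using f0 by simp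
  then have "min_distance Q S LX LZ > 0" using bound by (simp add: f_def)
  then have up_pos: "max_distance Q S LX LZ > 0" using up by simp
  \<comment> \<open>The case \<Delta> = 1 depends on r' >= 1: only then is the factor 1 - 0^r' equal
    to 1, so that the bound contradicts d_down <= d_up.\<close>
  have D: "?D > 1"
  proof (rule ccontr)
    assume "\<not> ?D > 1"
    then have "?D = 1" using disjointness_attained(1)[of Q] by simp
    then have "real r' * real (max_distance Q S LX LZ) < real (min_distance Q S LX LZ)"
      using bound r'_pos by (simp add: power_0_left)
    moreover have "1 * real (max_distance Q S LX LZ) \<le> real r' * real (max_distance Q S LX LZ)"
      using r'_pos by (intro mult_right_mono) auto
    ultimately show False using up by simp
  qed
  fix U :: "('b \<times> 'q, 'd) op"
  assume U: "logical_operator (blocks_stabilizer S) U" "transversal ?Q U"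
  have "disjoint_family ?Q"
    using partition perms by (intro disjoint_family_blocks_partition) (simp_all add: qudit_partition_def)
  then have loc: "local_preserving ?Q U" "local_preserving ?Q (adj U)"
    using U by (auto intro: transversal_imp_local_preserving simp: logical_operator_def)
  have "adj V ** U ** V \<in> clifford_level M"
    if V: "logical_encoding (blocks_stabilizer S) (blocks_logical LX) (blocks_logical LZ) V" for V
  proof -
    note act = logical_actionI[OF V U(1) loc]
    have "adj V ** U ** V \<in> hierarchy (Suc (M - 1))"
    proof (rule hierarchy_step)
      show "unitary (adj V ** U ** V)" using act by (simp add: logical_action_def)
      fix p :: "('b \<times> 'k, 'd) op" assume p: "p \<in> pauli_group"
      obtain G where G: "\<forall>b. G b \<in> choices" and comm: "\<forall>g. (\<forall>b. g b \<in> G b) \<longrightarrow>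
        logical_action V ?Q (group_commutator U (tens g)) (group_commutator (adj V ** U ** V) p) \<and>
        supp ?Q (group_commutator U (tens g)) \<subseteq> supp ?Q U \<inter> cover Q \<sigma> g"
        using commutator_with_choice[OF V act p] by (elim exE conjE) (rule that)
      \<comment> \<open>Nothing is known about the support of U, so the first commutator is confined
        by the cover of light representatives. The induction takes over with M - 1 steps
        left.\<close>
      obtain g where g: "\<forall>b. g b \<in> G b" "card (cover Q \<sigma> g) \<le> r' * max_distance Q S LX LZ"
        using ex_small_cover[where \<sigma> = \<sigma> and G = G, OF perms _ up_pos r'_cases] G by blast
      let ?K = "group_commutator U (tens g)"
      have "card (supp ?Q ?K) \<le> card (cover Q \<sigma> g)"
        using comm g(1) by (intro card_mono) auto
      then have "real (card (supp ?Q ?K)) \<le> real r' * real (max_distance Q S LX LZ)"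
        using g(2) by (metis le_trans of_nat_le_iff of_nat_mult)
      then have "real (card (supp ?Q ?K)) * f ^ (M - 1)
          \<le> real r' * real (max_distance Q S LX LZ) * f ^ (M - 1)"
        using f0 by (intro mult_right_mono) auto
      also have "\<dots> < real (min_distance Q S LX LZ)" using bound by (simp add: f_def)
      finally have small: "real (card (supp ?Q ?K)) * f ^ (M - 1) < real (min_distance Q S LX LZ)" .
      show "group_commutator (adj V ** U ** V) p \<in> hierarchy (M - 1)"
        by (rule logical_action_in_hierarchy[OF perms V D r'_cases f_def _ small]) (use comm g(1) in blast)
    qed
    then show ?thesis using M by (cases M) simp_all
  qed
  then show "U \<in> logical_clifford_level M (blocks_stabilizer S) (blocks_logical LX) (blocks_logical LZ)"
    using U(1) encoding_exists blocks_encoding unfolding logical_clifford_level_def by blast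
qed

end
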